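(* Let $G_1$ and $G_2$ be two graphs on disjoint vertex sets and let $r$ be a positive integer. Then $$\mathrm{reg}(R_{G_1*G_2}/I_r(G_1*G_2))=\max\left\{\mathrm{reg}(R_{G_1}/I_r(G_1)),\ \mathrm{reg}(R_{G_2}/I_r(G_2))\right\}.$$
   Context: Graphs are finite and simple, and $\mathbb K$ is a field. For a graph $G$ with vertex set $V(G)$, $R_G$ is the polynomial ring over $\mathbb K$ whose variables are the vertices of $G$ (standard grading). For a positive integer $r$, $I_r(G)\subseteq R_G$ is the square-free monomial ideal generated by the monomials $\prod_{x\in A}x$, where $A$ ranges over all subsets $A\subseteq V(G)$ with $|A|=r+1$ such that the induced subgraph $G[A]$ is connected. The join $G_1*G_2$ of graphs with disjoint vertex sets has vertex set $V(G_1)\sqcup V(G_2)$ and edge set $E(G_1)\cup E(G_2)\cup\{\{x,y\}\mid x\in V(G_1),\,y\in V(G_2)\}$. $\beta_{i,j}(R/I)$ denotes the $(i,j)$-th graded Betti number of $R/I$, i.e. the multiplicity of $R(-j)$ in homological degree $i$ of its graded minimal free resolution, and the Castelnuovo-Mumford regularity is $\mathrm{reg}(R/I)=\max\{j-i\mid \beta_{i,j}(R/I)\ne 0\}$.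
   Formalization: Added hypothesis: if I_r(G_1*G_2) is nonzero then I_r(G_1) or I_r(G_2) is nonzero; without it the claim fails, e.g. for r=1 and two single vertices, where the left side is 1 and the right side is 0. *)

theory Defs
  imports
    "HOL-Library.Poly_Mapping"
    "HOL-Algebra.Ideal"
    "Jordan_Normal_Form.Matrix"
    "Graph_Theory.Graph_Theory"
begin

section \<open>The polynomial ring on a set of variables\<close>

text \<open>
  A polynomial is a finitely supported map from exponent vectors to coefficients, and its
  arithmetic is that of the type class \<^class>\<open>comm_ring_1\<close>. The ring \<open>K[V]\<close> is the subring of
  those polynomials that involve only variables from \<open>V\<close>; it is packaged as a \<open>HOL-Algebra\<close> ring
  so that generated ideals are the library's \<^const>\<open>genideal\<close>.
\<close>

type_synonym ('v, 'k) mpoly = "('v \<Rightarrow>\<^sub>0 nat) \<Rightarrow>\<^sub>0 'k"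

definition var :: "'v \<Rightarrow> ('v, 'k::field) mpoly" where
  "var x = Poly_Mapping.single (Poly_Mapping.single x 1) 1"

definition poly_ring :: "'v set \<Rightarrow> ('v, 'k::field) mpoly ring" where
  "poly_ring V =
     \<lparr> carrier = {p. \<forall>m \<in> Poly_Mapping.keys p. Poly_Mapping.keys m \<subseteq> V},
       monoid.mult = (*), one = 1, zero = 0, add = (+) \<rparr>"

lemma carrier_poly_ring:
  "p \<in> carrier (poly_ring V) \<longleftrightarrow> (\<forall>m \<in> Poly_Mapping.keys p. Poly_Mapping.keys m \<subseteq> V)"
  by (simp add: poly_ring_def)

lemma poly_ring_simps [simp]:
  "p \<otimes>\<^bsub>poly_ring V\<^esub> q = p * q" "p \<oplus>\<^bsub>poly_ring V\<^esub> q = p + q"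
  "\<one>\<^bsub>poly_ring V\<^esub> = 1" "\<zero>\<^bsub>poly_ring V\<^esub> = 0"
  by (simp_all add: poly_ring_def)

lemma cring_poly_ring: "cring (poly_ring V :: ('v, 'k::field) mpoly ring)"
proof (rule cringI)
  have add: "p + q \<in> carrier (poly_ring V)"
    if "p \<in> carrier (poly_ring V)" "q \<in> carrier (poly_ring V)" for p q :: "('v, 'k) mpoly"
    using that Poly_Mapping.keys_add[of p q] unfolding carrier_poly_ring by blast
  have neg: "- p \<in> carrier (poly_ring V)"
    if "p \<in> carrier (poly_ring V)" for p :: "('v, 'k) mpoly"
    using that unfolding carrier_poly_ring by (simp add: in_keys_iff)
  have mult: "p * q \<in> carrier (poly_ring V)"
    if p: "p \<in> carrier (poly_ring V)" and q: "q \<in> carrier (poly_ring V)"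
    for p q :: "('v, 'k) mpoly"
    unfolding carrier_poly_ring
  proof
    fix m assume "m \<in> Poly_Mapping.keys (p * q)"
    then obtain a b where ab: "m = a + b" "a \<in> Poly_Mapping.keys p" "b \<in> Poly_Mapping.keys q"
      using keys_mult[of p q] by blast
    have "Poly_Mapping.keys m \<subseteq> Poly_Mapping.keys a \<union> Poly_Mapping.keys b"
      using ab(1) Poly_Mapping.keys_add[of a b] by simp
    then show "Poly_Mapping.keys m \<subseteq> V"
      using ab p q unfolding carrier_poly_ring by blast
  qed
  have zero: "0 \<in> carrier (poly_ring V :: ('v, 'k) mpoly ring)"
    and one: "1 \<in> carrier (poly_ring V :: ('v, 'k) mpoly ring)"
    by (simp_all add: carrier_poly_ring)
  show "abelian_group (poly_ring V :: ('v, 'k) mpoly ring)"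
  proof (rule abelian_groupI)
    fix p :: "('v, 'k) mpoly" assume "p \<in> carrier (poly_ring V)"
    then show "\<exists>q \<in> carrier (poly_ring V). q \<oplus>\<^bsub>poly_ring V\<^esub> p = \<zero>\<^bsub>poly_ring V\<^esub>"
      by (intro bexI[of _ "- p"] neg) simp_all
  qed (simp_all add: add zero ac_simps)
  show "Group.comm_monoid (poly_ring V :: ('v, 'k) mpoly ring)"
    by (rule comm_monoidI) (simp_all add: mult one ac_simps)
qed (simp add: distrib_right)

definition mon_degree :: "('v \<Rightarrow>\<^sub>0 nat) \<Rightarrow> nat" where
  "mon_degree m = (\<Sum>x \<in> Poly_Mapping.keys m. Poly_Mapping.lookup m x)"

text \<open>Degrees are integers, so only \<open>0\<close> is homogeneous of negative degree.\<close>

definition homogeneous :: "int \<Rightarrow> ('v, 'k::field) mpoly \<Rightarrow> bool" where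
  "homogeneous d p \<longleftrightarrow> (\<forall>m \<in> Poly_Mapping.keys p. int (mon_degree m) = d)"

definition irrelevant_ideal :: "'v set \<Rightarrow> ('v, 'k::field) mpoly set" where
  "irrelevant_ideal V = Idl\<^bsub>poly_ring V\<^esub> (var ` V)"


section \<open>Graded minimal free resolutions of \<open>K[V]/I\<close>\<close>

definition free_module :: "'v set \<Rightarrow> nat \<Rightarrow> ('v, 'k::field) mpoly vec set" where
  "free_module V n = {v \<in> carrier_vec n. \<forall>b < n. v $ b \<in> carrier (poly_ring V)}"

text \<open>
  A resolution \<open>\<dots> \<rightarrow> F\<^sub>1 \<rightarrow> F\<^sub>0 \<rightarrow> R/I \<rightarrow> 0\<close> by graded free modules of finite rank, in homogeneous
  bases. The list \<open>res_shifts F i\<close> contains the degrees of the basis elements of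
  \<open>F\<^sub>i = (\<Oplus>b. R(- res_shifts F i ! b))\<close>; the matrix \<open>res_map F i\<close> represents the map from
  \<open>F\<^sub>i\<^sub>+\<^sub>1\<close> to \<open>F\<^sub>i\<close>; and \<open>res_aug F\<close> contains representatives in \<open>R\<close> of the images of the basis elements
  of \<open>F\<^sub>0\<close> in \<open>R/I\<close>.
\<close>

record (overloaded) ('v, 'k) resolution =
  res_shifts :: "nat \<Rightarrow> int list"
  res_aug :: "('v, 'k) mpoly vec"
  res_map :: "nat \<Rightarrow> ('v, 'k) mpoly mat"

abbreviation res_rank :: "('v, 'k) resolution \<Rightarrow> nat \<Rightarrow> nat" where
  "res_rank F i \<equiv> length (res_shifts F i)"

text \<open>
  The maps have degree \<open>0\<close>, hence the entry of \<open>res_map F i\<close> in row \<open>a\<close> and column \<open>b\<close> is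
  homogeneous of degree \<open>res_shifts F (Suc i) ! b - res_shifts F i ! a\<close>. The last three
  conditions are surjectivity of \<open>F\<^sub>0 \<rightarrow> R/I\<close>, exactness at \<open>F\<^sub>0\<close>, and exactness at \<open>F\<^sub>i\<^sub>+\<^sub>1\<close>.
\<close>

definition graded_free_resolution ::
    "'v set \<Rightarrow> ('v, 'k::field) mpoly set \<Rightarrow> ('v, 'k) resolution \<Rightarrow> bool" where
  "graded_free_resolution V I F \<longleftrightarrow>
     res_aug F \<in> free_module V (res_rank F 0) \<and>
     (\<forall>b < res_rank F 0. homogeneous (res_shifts F 0 ! b) (res_aug F $ b)) \<and>
     (\<forall>i. res_map F i \<in> carrier_mat (res_rank F i) (res_rank F (Suc i)) \<and>
        (\<forall>a < res_rank F i. \<forall>b < res_rank F (Suc i).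
           res_map F i $$ (a, b) \<in> carrier (poly_ring V) \<and>
           homogeneous (res_shifts F (Suc i) ! b - res_shifts F i ! a) (res_map F i $$ (a, b)))) \<and>
     (\<forall>p \<in> carrier (poly_ring V). \<exists>v \<in> free_module V (res_rank F 0). p - scalar_prod (res_aug F) v \<in> I) \<and>
     {v \<in> free_module V (res_rank F 0). scalar_prod (res_aug F) v \<in> I} =
       (*\<^sub>v) (res_map F 0) ` free_module V (res_rank F 1) \<and>
     (\<forall>i. {v \<in> free_module V (res_rank F (Suc i)). res_map F i *\<^sub>v v = 0\<^sub>v (res_rank F i)} =
       (*\<^sub>v) (res_map F (Suc i)) ` free_module V (res_rank F (Suc (Suc i))))"

text \<open>Minimality: the image of \<open>F\<^sub>i\<^sub>+\<^sub>1\<close> lies in \<open>\<mm> F\<^sub>i\<close>, where \<open>\<mm>\<close> is the irrelevant ideal.\<close>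

definition minimal_graded_free_resolution ::
    "'v set \<Rightarrow> ('v, 'k::field) mpoly set \<Rightarrow> ('v, 'k) resolution \<Rightarrow> bool" where
  "minimal_graded_free_resolution V I F \<longleftrightarrow>
     graded_free_resolution V I F \<and>
     (\<forall>i. \<forall>a < res_rank F i. \<forall>b < res_rank F (Suc i). res_map F i $$ (a, b) \<in> irrelevant_ideal V)"

text \<open>
  For finite \<open>V\<close> and homogeneous \<open>I\<close>, a minimal resolution exists and is unique up to isomorphism,
  so the multiplicity of \<open>R(-j)\<close> in \<open>F\<^sub>i\<close> does not depend on it.
\<close>

definition graded_betti :: "'v set \<Rightarrow> ('v, 'k::field) mpoly set \<Rightarrow> nat \<Rightarrow> int \<Rightarrow> nat" where
  "graded_betti V I i j =
     (THE n. \<exists>F. minimal_graded_free_resolution V I F \<and> n = count_list (res_shifts F i) j)"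

text \<open>The Castelnuovo-Mumford regularity of \<open>K[V]/I\<close>.\<close>

definition reg_quotient :: "'v set \<Rightarrow> ('v, 'k::field) mpoly set \<Rightarrow> int" where
  "reg_quotient V I = Max {j - int i | i j. graded_betti V I i j \<noteq> 0}"


section \<open>The ideals \<open>I\<^sub>r(G)\<close> and the join of graphs\<close>

text \<open>
  A finite simple graph is a \<^locale>\<open>pair_graph\<close>: a finite loop-free symmetric digraph without
  parallel arcs, in which each edge is represented by its two orientations.
\<close>

definition connected_ideal :: "nat \<Rightarrow> 'v pair_pre_digraph \<Rightarrow> ('v, 'k::field) mpoly set" where
  "connected_ideal r G = Idl\<^bsub>poly_ring (pverts G)\<^esub>
     {\<Prod>x \<in> A. var x | A. A \<subseteq> pverts G \<and> card A = r + 1 \<and>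
        Digraph_Component.connected (with_proj G \<restriction> A)}"

definition graph_join :: "'v pair_pre_digraph \<Rightarrow> 'v pair_pre_digraph \<Rightarrow> 'v pair_pre_digraph" where
  "graph_join G\<^sub>1 G\<^sub>2 =
     \<lparr> pverts = pverts G\<^sub>1 \<union> pverts G\<^sub>2,
       parcs = parcs G\<^sub>1 \<union> parcs G\<^sub>2 \<union>
         pverts G\<^sub>1 \<times> pverts G\<^sub>2 \<union> pverts G\<^sub>2 \<times> pverts G\<^sub>1 \<rparr>"

lemma pair_graph_graph_join:
  assumes "pair_graph G\<^sub>1" and "pair_graph G\<^sub>2" and disj: "pverts G\<^sub>1 \<inter> pverts G\<^sub>2 = {}"
  shows "pair_graph (graph_join G\<^sub>1 G\<^sub>2)"
proof -
  interpret A: pair_graph G\<^sub>1 by fact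
  interpret B: pair_graph G\<^sub>2 by fact
  show ?thesis
  proof unfold_locales
    show "symmetric (with_proj (graph_join G\<^sub>1 G\<^sub>2))"
      using A.arcs_symmetric B.arcs_symmetric
      by (auto simp: symmetric_def graph_join_def intro!: symI)
  qed (use disj A.wellformed' B.wellformed' A.no_loops' B.no_loops'
        A.pair_finite_verts B.pair_finite_verts A.pair_finite_arcs B.pair_finite_arcs
        in \<open>auto simp: graph_join_def\<close>)
qed

end

theory Submission
  imports Defs "HOL-Library.Function_Algebras"
begin

text \<open>
  Graded Betti numbers are read off Koszul homology: in a minimal resolution with syzygy modules \<open>M\<^sub>i\<close>
  the rank of \<open>F\<^sub>i\<^sub>+\<^sub>1\<close> in degree \<open>j\<close> is the dimension of \<open>H\<^sub>0(x; M\<^sub>i)\<^sub>j\<close>, and the connecting isomorphisms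
  identify this space with \<open>H\<^sub>i(x; I)\<^sub>j\<close>. This gives uniqueness of the ranks, and also existence of a
  minimal resolution, since the syzygies are finitely generated as soon as the Koszul homology of \<open>I\<close>
  vanishes in large degrees. For a squarefree monomial ideal the Koszul complex splits by
  multidegrees, only squarefree multidegrees \<open>W\<close> contribute, and there it is the complex of those
  \<open>T \<subseteq> W\<close> whose monomial lies in \<open>I\<close>; if it is not exact at \<open>T\<close>, then \<open>|T| - 1\<close> is one of the numbers
  whose maximum is the regularity of \<open>R/I\<close>.

  The ideal of the join contains all sets of size at least \<open>r + 1\<close> that meet both vertex sets. These
  sets form an exact complex in sizes at least \<open>r + 2\<close>, so in that range the complex of the join is
  the direct sum of the complexes of the two graphs. Size \<open>r + 1\<close> is attained by each graph with a
  nonzero ideal.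
\<close>

text \<open>Betti numbers are definite descriptions, so nothing can be computed before existence and
  uniqueness of the ranks are both proved. The sign of the Koszul differential is a parameter
  \<open>s\<close>, restricted only by the identity that makes the square zero. Attaching a fixed
  set \<open>Y\<close> to all index sets replaces \<open>s x S\<close> by
  \<open>s x (S \<union> Y)\<close>, which is not the standard sign of the smaller complex; but the
  regularity does not mention signs, so its formula holds for every admissible sign and complexes
  with different signs need not be compared. Chains are indexed by the exterior part
  \<open>S\<close>; the sets \<open>T\<close> of the overview are the complements
  \<open>W - S\<close>. A class at \<open>W\<close> with \<open>card S = i\<close> belongs to
  homological degree \<open>i + 1\<close> and internal degree \<open>card W\<close> of
  \<open>R/I\<close>, whence \<open>card T - 1\<close>. The differential enlarges \<open>T\<close>.
  Once the mixed sets are truncated to sizes at least \<open>r + 1\<close>, nothing maps into size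
  \<open>r + 1\<close>, so exactness is available only above it. The value \<open>r\<close> of the
  regularity must then come from a generator of one of the two parts, which is the role of the
  hypothesis on nonzero ideals in the theorem.\<close>

abbreviation (input) "keys \<equiv> Poly_Mapping.keys"
abbreviation (input) "lookup \<equiv> Poly_Mapping.lookup"
abbreviation (input) "single \<equiv> Poly_Mapping.single"

section \<open>Koszul complexes\<close>

text \<open>Signs are Booleans because coefficients lie in an arbitrary abelian group, without a
  scalar -1; the product of two signs is then \<open>\<noteq>\<close>.\<close>

definition sg :: "bool \<Rightarrow> 'a::ab_group_add \<Rightarrow> 'a" where
  "sg b v = (if b then - v else v)"

lemma sg_zero [simp]: "sg b 0 = 0"
  and sg_add: "sg b (u + v) = sg b u + sg b v"
  and sg_sg: "sg b (sg c v) = sg (b \<noteq> c) v"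
  and sg_same [simp]: "sg b (sg b v) = v"
  and sg_eq_0 [simp]: "sg b v = 0 \<longleftrightarrow> v = 0"
  by (auto simp: sg_def)

lemma sg_sum: "sg b (sum f A) = (\<Sum>x\<in>A. sg b (f x))"
  by (auto simp: sg_def sum_negf)

text \<open>Exchanging the two summations would only show that the sum equals its own negative,
  which says nothing in characteristic 2. The induction cancels the row of the new element against
  its column.\<close>

lemma sum_antisymmetric:
  fixes t :: "'a \<Rightarrow> 'a \<Rightarrow> 'b::ab_group_add"
  assumes "finite A" and "\<And>x y. x \<in> A \<Longrightarrow> y \<in> A \<Longrightarrow> x \<noteq> y \<Longrightarrow> t y x = - t x y"
  shows "(\<Sum>x\<in>A. \<Sum>y\<in>A - {x}. t x y) = 0"
  using assms
proof (induction A rule: finite_induct)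
  case (insert a A)
  note fin = insert.hyps
  have IH: "(\<Sum>x\<in>A. \<Sum>y\<in>A - {x}. t x y) = 0"
    by (rule insert.IH) (use insert.prems in blast)
  have "(\<Sum>y\<in>insert a A - {x}. t x y) = t x a + (\<Sum>y\<in>A - {x}. t x y)" if "x \<in> A" for x
  proof -
    have "insert a A - {x} = insert a (A - {x})" using that fin by auto
    then show ?thesis using fin by simp
  qed
  then have "(\<Sum>x\<in>insert a A. \<Sum>y\<in>insert a A - {x}. t x y)
      = (\<Sum>y\<in>A. t a y) + (\<Sum>x\<in>A. t x a + (\<Sum>y\<in>A - {x}. t x y))"
    using fin by simp
  also have "\<dots> = (\<Sum>y\<in>A. t a y) + (\<Sum>x\<in>A. t x a)"
    using IH by (simp add: sum.distrib)
  also have "(\<Sum>x\<in>A. t x a) = (\<Sum>x\<in>A. - t a x)"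
  proof (rule sum.cong)
    fix x assume "x \<in> A"
    then show "t x a = - t a x" using insert.prems[of a x] fin by auto
  qed simp
  finally show ?case by (simp add: sum_negf)
qed simp

text \<open>
  A chain assigns to a set \<open>S\<close> of variables the coefficient of the basis element \<open>e\<^sub>S\<close>.
\<close>

definition kd :: "'v set \<Rightarrow> ('v \<Rightarrow> 'v set \<Rightarrow> bool) \<Rightarrow> ('v \<Rightarrow> 'a \<Rightarrow> 'a) \<Rightarrow>
    ('v set \<Rightarrow> 'a::ab_group_add) \<Rightarrow> 'v set \<Rightarrow> 'a" where
  "kd V s X z S = (if S \<subseteq> V then \<Sum>x\<in>V - S. sg (s x S) (X x (z (insert x S))) else 0)"

text \<open>The differential inside one multidegree: there each coefficient is a scalar times a
  determined monomial, so multiplication by a variable becomes the identity on scalars.\<close>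

abbreviation kd\<^sub>1 :: "'v set \<Rightarrow> ('v \<Rightarrow> 'v set \<Rightarrow> bool) \<Rightarrow> ('v set \<Rightarrow> 'a::ab_group_add) \<Rightarrow> 'v set \<Rightarrow> 'a" where
  "kd\<^sub>1 V s \<equiv> kd V s (\<lambda>_ u. u)"

text \<open>\<open>swap\<close> says that removing \<open>x\<close> and \<open>y\<close> in the two
  possible orders gives opposite signs; this is all that the square of the differential and the cone
  construction use.\<close>

locale koszul_sign =
  fixes V :: "'v set" and s :: "'v \<Rightarrow> 'v set \<Rightarrow> bool"
  assumes finite_V: "finite V"
    and swap: "\<lbrakk>x \<in> V; y \<in> V; x \<noteq> y; S \<subseteq> V; x \<notin> S; y \<notin> S\<rbrakk> \<Longrightarrow>
      (s x (insert y S) \<noteq> s y S) \<noteq> (s y (insert x S) \<noteq> s x S)"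
begin

lemma kd_kd:
  fixes X :: "'v \<Rightarrow> 'a \<Rightarrow> 'a::ab_group_add"
  assumes add: "\<And>x u v. X x (u + v) = X x u + X x v"
    and comm: "\<And>x y u. X x (X y u) = X y (X x u)"
  shows "kd V s X (kd V s X z) = 0"
proof
  fix S
  have zero: "X x 0 = 0" for x using add[of x 0 0] by simp
  have neg: "X x (- u) = - X x u" for x u
    using add[of x u "- u"] zero[of x] by (simp add: eq_neg_iff_add_eq_0 add.commute)
  have sum: "X x (sum f A) = (\<Sum>a\<in>A. X x (f a))" for x A and f :: "'v \<Rightarrow> 'a"
    by (induction A rule: infinite_finite_induct) (auto simp: zero add)
  have sgX: "X x (sg b u) = sg b (X x u)" for x b u by (simp add: sg_def neg)
  show "kd V s X (kd V s X z) S = 0 S"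
  proof (cases "S \<subseteq> V")
    case True
    define t where "t x y = sg (s x S) (sg (s y (insert x S)) (X x (X y (z (insert y (insert x S))))))" for x y
    have "kd V s X (kd V s X z) S = (\<Sum>x\<in>V - S. \<Sum>y\<in>(V - S) - {x}. t x y)"
    proof -
      have "sg (s x S) (X x (kd V s X z (insert x S))) = (\<Sum>y\<in>(V - S) - {x}. t x y)"
        if "x \<in> V - S" for x
      proof -
        have "V - insert x S = (V - S) - {x}" by auto
        moreover have "insert x S \<subseteq> V" using that True by auto
        ultimately show ?thesis by (simp add: kd_def sum sgX sg_sum t_def)
      qed
      then show ?thesis using True by (simp add: kd_def[of V s X "kd V s X z"])
    qed
    also have "\<dots> = 0"
    proof (rule sum_antisymmetric)
      fix x y assume xy: "x \<in> V - S" "y \<in> V - S" "x \<noteq> y"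
      have "t y x = sg (s y S \<noteq> s x (insert y S)) (X x (X y (z (insert y (insert x S)))))"
        by (simp add: t_def sg_sg comm[of y x] insert_commute)
      moreover have "t x y = sg (s x S \<noteq> s y (insert x S)) (X x (X y (z (insert y (insert x S)))))"
        by (simp add: t_def sg_sg)
      ultimately show "t y x = - t x y"
        using swap[of x y S] xy True by (auto simp: sg_def)
    qed (use finite_V in auto)
    finally show ?thesis by simp
  qed (simp add: kd_def)
qed

text \<open>Exterior multiplication by the basis element of \<open>p\<close>, a contracting
  homotopy.\<close>

definition cone :: "'v \<Rightarrow> ('v set \<Rightarrow> 'a::ab_group_add) \<Rightarrow> 'v set \<Rightarrow> 'a" where
  "cone p c S = (if p \<in> S \<and> S \<subseteq> V then sg (s p (S - {p})) (c (S - {p})) else 0)"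

text \<open>This is the homotopy formula d(e_p c) + e_p (d c) = c, evaluated at \<open>S\<close>.
  The second summand vanishes for \<open>p \<notin> S\<close> by definition and for
  \<open>p \<in> S\<close> by \<open>cyc\<close>.\<close>

lemma kd_cone:
  assumes p: "p \<in> V" and S: "S \<subseteq> V"
    and cyc: "p \<in> S \<Longrightarrow> kd\<^sub>1 V s c (S - {p}) = 0"
  shows "kd\<^sub>1 V s (cone p c) S = c S"
proof (cases "p \<in> S")
  case False
  have "(\<Sum>x\<in>V - S. sg (s x S) (cone p c (insert x S)))
      = (\<Sum>x\<in>V - S. if x = p then c S else 0)"
    using False S p by (intro sum.cong) (auto simp: cone_def)
  then show ?thesis using False p S finite_V by (simp add: kd_def)
next
  case True
  define T where "T = S - {p}"
  have T: "S = insert p T" "p \<notin> T" "T \<subseteq> V" using True S by (auto simp: T_def)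
  have VT: "V - T = insert p (V - S)" "p \<notin> V - S" using T p by auto
  \<comment> \<open>The cycle condition at \<open>T = S - {p}\<close> with the term
    \<open>x = p\<close> split off; the remaining sum is, up to sign, what the differential of the
    cone yields at \<open>S\<close>.\<close>
  have eq0: "sg (s p T) (c S) + (\<Sum>x\<in>V - S. sg (s x T) (c (insert x T))) = 0"
  proof -
    have "(\<Sum>x\<in>V - T. sg (s x T) (c (insert x T))) = 0"
      using cyc[OF True] T(3) by (simp add: kd_def flip: T_def)
    moreover have "finite (V - S)" using finite_V by simp
    ultimately show ?thesis by (simp only: VT sum.insert T(1)[symmetric] not_False_eq_True)
  qed
  have "kd\<^sub>1 V s (cone p c) S
      = (\<Sum>x\<in>V - S. sg (s x S) (sg (s p (insert x T)) (c (insert x T))))"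
  proof -
    have "cone p c (insert x S) = sg (s p (insert x T)) (c (insert x T))" if "x \<in> V - S" for x
    proof -
      have "insert x S - {p} = insert x T" using that T by auto
      then show ?thesis using that T p by (auto simp: cone_def)
    qed
    then show ?thesis using S by (simp add: kd_def)
  qed
  also have "\<dots> = (\<Sum>x\<in>V - S. - sg (s p T) (sg (s x T) (c (insert x T))))"
  proof (intro sum.cong refl)
    fix x assume "x \<in> V - S"
    then show "sg (s x S) (sg (s p (insert x T)) (c (insert x T)))
        = - sg (s p T) (sg (s x T) (c (insert x T)))"
      using swap[of x p T] T p by (auto simp: sg_def)
  qed
  also have "\<dots> = - sg (s p T) (\<Sum>x\<in>V - S. sg (s x T) (c (insert x T)))"
    by (simp add: sum_negf sg_sum)
  also have "\<dots> = c S"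
  proof -
    have "(\<Sum>x\<in>V - S. sg (s x T) (c (insert x T))) = - sg (s p T) (c S)"
      using eq0 by (metis add_eq_0_iff)
    then show ?thesis by (auto simp: sg_def)
  qed
  finally show ?thesis .
qed

end

text \<open>Enumerate \<open>V\<close> and take the parity of the number of elements of
  \<open>S\<close> before \<open>x\<close>. Inserting \<open>y\<close> changes it exactly if
  \<open>y\<close> comes before \<open>x\<close>, and of two distinct elements exactly one comes
  before the other.\<close>

lemma koszul_sign_exists:
  fixes V :: "'v set"
  assumes "finite V"
  shows "\<exists>s. koszul_sign V s"
proof -
  obtain f :: "'v \<Rightarrow> nat" where f: "inj_on f V"
    using finite_imp_inj_to_nat_seg[OF assms] by auto
  have "koszul_sign V (\<lambda>x S. odd (card {y \<in> S. f y < f x}))"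
  proof
    have *: "odd (card {z \<in> insert y S. f z < f x}) \<longleftrightarrow> odd (card {z \<in> S. f z < f x}) \<noteq> (f y < f x)"
      if "S \<subseteq> V" "y \<notin> S" for x y S
    proof -
      have "finite S" using that assms finite_subset by blast
      moreover have "{z \<in> insert y S. f z < f x}
          = (if f y < f x then insert y {z \<in> S. f z < f x} else {z \<in> S. f z < f x})" by auto
      ultimately show ?thesis using that by simp
    qed
    fix x y S assume "x \<in> V" "y \<in> V" "x \<noteq> y" "S \<subseteq> V" "x \<notin> S" "y \<notin> S"
    moreover from this f have "f x < f y \<longleftrightarrow> \<not> f y < f x" by (metis inj_onD linorder_neqE_nat less_asym)
    ultimately show "(odd (card {z \<in> insert y S. f z < f x}) \<noteq> odd (card {z \<in> S. f z < f y})) \<noteq>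
        (odd (card {z \<in> insert x S. f z < f y}) \<noteq> odd (card {z \<in> S. f z < f x}))"
      unfolding *[OF \<open>S \<subseteq> V\<close> \<open>y \<notin> S\<close>] *[OF \<open>S \<subseteq> V\<close> \<open>x \<notin> S\<close>] by blast
  qed (rule assms)
  then show ?thesis by blast
qed

section \<open>Isomorphisms of subquotients\<close>

text \<open>
  The isomorphisms \<open>Z/B \<cong> Z'/B'\<close> that occur below are connecting homomorphisms, which are not
  induced by maps \<open>Z \<rightarrow> Z'\<close>; they are induced by linear relations.
\<close>

definition subq_iso :: "('k \<Rightarrow> 'a \<Rightarrow> 'a::ab_group_add) \<Rightarrow> 'a set \<Rightarrow> 'a set \<Rightarrow> 'a set \<Rightarrow> 'a set \<Rightarrow> bool" where
  "subq_iso sc Z B Z' B' \<longleftrightarrow> (\<exists>\<rho>.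
     (\<forall>z z'. \<rho> z z' \<longrightarrow> z \<in> Z \<and> z' \<in> Z' \<and> (z \<in> B \<longleftrightarrow> z' \<in> B')) \<and>
     (\<forall>z\<in>Z. \<exists>z'. \<rho> z z') \<and> (\<forall>z'\<in>Z'. \<exists>z. \<rho> z z') \<and>
     (\<forall>z z' w w'. \<rho> z z' \<longrightarrow> \<rho> w w' \<longrightarrow> \<rho> (z + w) (z' + w')) \<and>
     (\<forall>c z z'. \<rho> z z' \<longrightarrow> \<rho> (sc c z) (sc c z')))"

lemma subq_iso_refl:
  assumes "\<And>z w. z \<in> Z \<Longrightarrow> w \<in> Z \<Longrightarrow> z + w \<in> Z" "\<And>c z. z \<in> Z \<Longrightarrow> sc c z \<in> Z"
  shows "subq_iso sc Z B Z B"
  unfolding subq_iso_def using assms by (intro exI[of _ "\<lambda>z z'. z = z' \<and> z \<in> Z"]) blast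

lemma subq_iso_sym: "subq_iso sc Z B Z' B' \<Longrightarrow> subq_iso sc Z' B' Z B"
  unfolding subq_iso_def by (elim exE, rule_tac x = "\<lambda>z z'. \<rho> z' z" in exI) blast

lemma subq_iso_trans:
  assumes "subq_iso sc Z B Z' B'" "subq_iso sc Z' B' Z'' B''"
  shows "subq_iso sc Z B Z'' B''"
proof -
  obtain \<rho> where r:
     "\<forall>z z'. \<rho> z z' \<longrightarrow> z \<in> Z \<and> z' \<in> Z' \<and> (z \<in> B \<longleftrightarrow> z' \<in> B')"
     "\<forall>z\<in>Z. \<exists>z'. \<rho> z z'" "\<forall>z'\<in>Z'. \<exists>z. \<rho> z z'"
     "\<forall>z z' w w'. \<rho> z z' \<longrightarrow> \<rho> w w' \<longrightarrow> \<rho> (z + w) (z' + w')"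
     "\<forall>c z z'. \<rho> z z' \<longrightarrow> \<rho> (sc c z) (sc c z')"
    using assms(1) unfolding subq_iso_def by blast
  obtain \<sigma> where s:
     "\<forall>z z'. \<sigma> z z' \<longrightarrow> z \<in> Z' \<and> z' \<in> Z'' \<and> (z \<in> B' \<longleftrightarrow> z' \<in> B'')"
     "\<forall>z\<in>Z'. \<exists>z'. \<sigma> z z'" "\<forall>z'\<in>Z''. \<exists>z. \<sigma> z z'"
     "\<forall>z z' w w'. \<sigma> z z' \<longrightarrow> \<sigma> w w' \<longrightarrow> \<sigma> (z + w) (z' + w')"
     "\<forall>c z z'. \<sigma> z z' \<longrightarrow> \<sigma> (sc c z) (sc c z')"
    using assms(2) unfolding subq_iso_def by blast
  show ?thesis unfolding subq_iso_def
  proof (intro exI[of _ "\<rho> OO \<sigma>"] conjI allI impI ballI)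
    fix z z' assume "(\<rho> OO \<sigma>) z z'"
    then show "z \<in> Z" "z' \<in> Z''" "z \<in> B \<longleftrightarrow> z' \<in> B''" using r(1) s(1) by blast+
  next
    fix z assume "z \<in> Z" then show "\<exists>z'. (\<rho> OO \<sigma>) z z'" using r(1,2) s(2) by blast
  next
    fix z assume "z \<in> Z''" then show "\<exists>z'. (\<rho> OO \<sigma>) z' z" using r(3) s(1,3) by blast
  next
    fix z z' w w' assume "(\<rho> OO \<sigma>) z z'" "(\<rho> OO \<sigma>) w w'"
    then show "(\<rho> OO \<sigma>) (z + w) (z' + w')" using r(4) s(4) by blast
  next
    fix c z z' assume "(\<rho> OO \<sigma>) z z'"
    then show "(\<rho> OO \<sigma>) (sc c z) (sc c z')" using r(5) s(5) by blast
  qed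
qed

lemma subq_iso_subset: "subq_iso sc Z B Z' B' \<Longrightarrow> Z \<subseteq> B \<longleftrightarrow> Z' \<subseteq> B'"
  unfolding subq_iso_def by blast

section \<open>Koszul homology and dimension shift\<close>

locale graded_ops = koszul_sign V s
  for V :: "'v set" and s :: "'v \<Rightarrow> 'v set \<Rightarrow> bool" +
  fixes X :: "'v \<Rightarrow> 'a \<Rightarrow> 'a::ab_group_add" and sc :: "'k \<Rightarrow> 'a \<Rightarrow> 'a"
  assumes X_add: "X x (u + v) = X x u + X x v"
    and X_comm: "X x (X y u) = X y (X x u)"
    and sc_add: "sc c (u + v) = sc c u + sc c v"
    and X_sc: "X x (sc c u) = sc c (X x u)"
begin

text \<open>A graded submodule is given by the family of its homogeneous components; the total
  module is never formed, since Koszul homology is taken degree by degree.\<close>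

definition gsub :: "(int \<Rightarrow> 'a set) \<Rightarrow> bool" where
  "gsub G \<longleftrightarrow> (\<forall>j. 0 \<in> G j \<and> (\<forall>u\<in>G j. \<forall>v\<in>G j. u + v \<in> G j) \<and> (\<forall>u\<in>G j. - u \<in> G j) \<and>
     (\<forall>u\<in>G j. \<forall>c. sc c u \<in> G j) \<and> (\<forall>u\<in>G j. \<forall>x\<in>V. X x u \<in> G (j + 1)))"

lemma gsubD:
  assumes "gsub G"
  shows "0 \<in> G j" "u \<in> G j \<Longrightarrow> v \<in> G j \<Longrightarrow> u + v \<in> G j" "u \<in> G j \<Longrightarrow> - u \<in> G j"
    "u \<in> G j \<Longrightarrow> sc c u \<in> G j" "u \<in> G j \<Longrightarrow> x \<in> V \<Longrightarrow> X x u \<in> G (j + 1)"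
    "u \<in> G j \<Longrightarrow> v \<in> G j \<Longrightarrow> u - v \<in> G j"
proof -
  show "u - v \<in> G j" if "u \<in> G j" "v \<in> G j"
    using assms that unfolding gsub_def by (metis ab_group_add_class.ab_diff_conv_add_uminus)
qed (use assms in \<open>auto simp: gsub_def\<close>)

lemma gsub_sum: "gsub G \<Longrightarrow> (\<And>x. x \<in> A \<Longrightarrow> f x \<in> G j) \<Longrightarrow> sum f A \<in> G j"
proof (induction A rule: infinite_finite_induct)
  case (insert x A)
  then show ?case using gsubD(2)[OF insert.prems(1)] by simp
qed (simp_all add: gsubD(1))

lemma gsub_sg: "gsub G \<Longrightarrow> u \<in> G j \<Longrightarrow> sg b u \<in> G j"
  using gsubD(3)[of G u j] by (simp add: sg_def)

text \<open>The basis element of \<open>S\<close> has internal degree \<open>card S\<close>, hence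
  the shift by \<open>i\<close>. Values elsewhere are fixed to 0 so that equality of chains is
  equality of functions.\<close>

definition kchains :: "(int \<Rightarrow> 'a set) \<Rightarrow> nat \<Rightarrow> int \<Rightarrow> ('v set \<Rightarrow> 'a) set" where
  "kchains G i j = {z. \<forall>S. if S \<subseteq> V \<and> card S = i then z S \<in> G (j - int i) else z S = 0}"

lemma kchainsI:
  assumes "\<And>S. S \<subseteq> V \<Longrightarrow> card S = i \<Longrightarrow> z S \<in> G (j - int i)"
    and "\<And>S. \<not> (S \<subseteq> V \<and> card S = i) \<Longrightarrow> z S = 0"
  shows "z \<in> kchains G i j"
  using assms by (simp add: kchains_def)

lemma kchainsD:
  assumes "z \<in> kchains G i j"
  shows "S \<subseteq> V \<Longrightarrow> card S = i \<Longrightarrow> z S \<in> G (j - int i)"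
    and "\<not> (S \<subseteq> V \<and> card S = i) \<Longrightarrow> z S = 0"
  using assms unfolding kchains_def by (auto dest!: spec[of _ S])

definition kcycles :: "(int \<Rightarrow> 'a set) \<Rightarrow> nat \<Rightarrow> int \<Rightarrow> ('v set \<Rightarrow> 'a) set" where
  "kcycles G i j = {z \<in> kchains G i j. kd V s X z = 0}"

definition kbounds :: "(int \<Rightarrow> 'a set) \<Rightarrow> nat \<Rightarrow> int \<Rightarrow> ('v set \<Rightarrow> 'a) set" where
  "kbounds G i j = kd V s X ` kchains G (Suc i) j"

definition csc :: "'k \<Rightarrow> ('v set \<Rightarrow> 'a) \<Rightarrow> 'v set \<Rightarrow> 'a" where
  "csc c z = (\<lambda>S. sc c (z S))"

abbreviation kh_iso where
  "kh_iso G i G' i' j \<equiv>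
     subq_iso csc (kcycles G i j) (kbounds G i j) (kcycles G' i' j) (kbounds G' i' j)"

lemma X_zero [simp]: "X x 0 = 0"
  using X_add[of x 0 0] by simp

lemma sc_zero [simp]: "sc c 0 = 0"
  using sc_add[of c 0 0] by simp

lemma sc_neg: "sc c (- u) = - sc c u"
  using sc_add[of c u "- u"] by (simp add: eq_neg_iff_add_eq_0 add.commute)

lemma sc_sum: "sc c (sum f A) = (\<Sum>x\<in>A. sc c (f x))"
  by (induction A rule: infinite_finite_induct) (auto simp: sc_add)

lemma kd_add: "kd V s X (z + w) = kd V s X z + kd V s X w"
  by (rule ext) (simp add: kd_def X_add sg_add sum.distrib)

lemma kd_minus: "kd V s X (z - w) = kd V s X z - kd V s X w"
  using kd_add[of "z - w" w] by (simp add: algebra_simps)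

lemma kd_csc: "kd V s X (csc c z) = csc c (kd V s X z)"
proof -
  have "sg b (sc c u) = sc c (sg b u)" for b u by (simp add: sg_def sc_neg)
  then show ?thesis by (simp add: kd_def csc_def X_sc sc_sum fun_eq_iff)
qed

lemma kd_kd0: "kd V s X (kd V s X z) = 0"
  by (rule kd_kd) (rule X_add X_comm)+

lemma kchains_add: "gsub G \<Longrightarrow> z \<in> kchains G i j \<Longrightarrow> w \<in> kchains G i j \<Longrightarrow> z + w \<in> kchains G i j"
  by (intro kchainsI) (auto intro: gsubD(2) kchainsD(1) simp: kchainsD(2))

lemma kchains_minus: "gsub G \<Longrightarrow> z \<in> kchains G i j \<Longrightarrow> w \<in> kchains G i j \<Longrightarrow> z - w \<in> kchains G i j"
  by (intro kchainsI) (auto intro: gsubD(6) kchainsD(1) simp: kchainsD(2))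

lemma kchains_csc: "gsub G \<Longrightarrow> z \<in> kchains G i j \<Longrightarrow> csc c z \<in> kchains G i j"
  unfolding csc_def by (intro kchainsI) (auto intro: gsubD(4) kchainsD(1) simp: kchainsD(2))

lemma kd_kchains:
  assumes G: "gsub G" and z: "z \<in> kchains G (Suc i) j"
  shows "kd V s X z \<in> kchains G i j"
proof (rule kchainsI)
  fix S assume S: "S \<subseteq> V" "card S = i"
  have "X x (z (insert x S)) \<in> G (j - int i)" if "x \<in> V - S" for x
  proof -
    have "finite S" using S finite_V finite_subset by blast
    then have "z (insert x S) \<in> G (j - int (Suc i))"
      using that S by (intro kchainsD(1)[OF z]) auto
    from gsubD(5)[OF G this, of x] that show ?thesis by (simp add: algebra_simps)
  qed
  then show "kd V s X z S \<in> G (j - int i)"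
    using S by (auto simp: kd_def intro!: gsub_sum[OF G] gsub_sg[OF G])
next
  fix S assume S: "\<not> (S \<subseteq> V \<and> card S = i)"
  have "z (insert x S) = 0" if "x \<in> V - S" "S \<subseteq> V" for x
  proof -
    have "finite S" using that finite_V finite_subset by blast
    then show ?thesis using that S by (intro kchainsD(2)[OF z]) auto
  qed
  then show "kd V s X z S = 0" by (auto simp: kd_def)
qed

lemma kcycles_0: "kcycles G 0 j = kchains G 0 j"
proof -
  have "kd V s X z = 0" if z: "z \<in> kchains G 0 j" for z
  proof (rule ext)
    fix S
    have "z (insert x S) = 0" if "S \<subseteq> V" for x
    proof -
      have "finite S" using that finite_V finite_subset by blast
      then show ?thesis by (intro kchainsD(2)[OF z]) auto
    qed
    then show "kd V s X z S = 0 S" by (simp add: kd_def)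
  qed
  then show ?thesis by (auto simp: kcycles_def)
qed

lemma kcycles_add: "gsub G \<Longrightarrow> z \<in> kcycles G i j \<Longrightarrow> w \<in> kcycles G i j \<Longrightarrow> z + w \<in> kcycles G i j"
  by (simp add: kcycles_def kchains_add kd_add)

lemma kcycles_csc: "gsub G \<Longrightarrow> z \<in> kcycles G i j \<Longrightarrow> csc c z \<in> kcycles G i j"
  by (simp add: kcycles_def kchains_csc kd_csc) (simp add: csc_def fun_eq_iff)

lemma kbounds_add: "gsub G \<Longrightarrow> z \<in> kbounds G i j \<Longrightarrow> w \<in> kbounds G i j \<Longrightarrow> z + w \<in> kbounds G i j"
  unfolding kbounds_def by (auto simp flip: kd_add intro!: imageI kchains_add)

lemma kh_iso_refl: "gsub G \<Longrightarrow> kh_iso G i G i j"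
  by (rule subq_iso_refl) (auto simp: kcycles_add kcycles_csc)

section \<open>Short exact sequences 0 -> K -> F -> M -> 0 of graded modules\<close>

context
  fixes F K M :: "int \<Rightarrow> 'a set" and \<phi> :: "'a \<Rightarrow> 'a"
  assumes F: "gsub F"
    and phi_add: "\<And>u v. \<phi> (u + v) = \<phi> u + \<phi> v"
    and phi_X: "\<And>x u. \<phi> (X x u) = X x (\<phi> u)"
    and phi_sc: "\<And>c u. \<phi> (sc c u) = sc c (\<phi> u)"
    and K: "\<And>j. K j = {v \<in> F j. \<phi> v = 0}"
    and M: "\<And>j. M j = \<phi> ` F j"
begin

lemma phi_0: "\<phi> 0 = 0"
  using phi_add[of 0 0] by simp

lemma phi_neg: "\<phi> (- u) = - \<phi> u"
  using phi_add[of u "- u"] phi_0 by (simp add: eq_neg_iff_add_eq_0 add.commute)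

lemma phi_minus: "\<phi> (u - v) = \<phi> u - \<phi> v"
  using phi_add[of "u - v" v] by (simp add: algebra_simps)

lemma phi_sum: "\<phi> (sum f A) = (\<Sum>x\<in>A. \<phi> (f x))"
  by (induction A rule: infinite_finite_induct) (auto simp: phi_add phi_0)

lemma gsub_K: "gsub K"
  using F unfolding gsub_def K by (auto simp: phi_add phi_0 phi_neg phi_X phi_sc)

lemma kd_phi: "kd V s X (\<phi> \<circ> z) = \<phi> \<circ> kd V s X z"
proof -
  have "sg b (\<phi> u) = \<phi> (sg b u)" for b u by (simp add: sg_def phi_neg)
  then show ?thesis by (simp add: kd_def phi_sum phi_0 fun_eq_iff flip: phi_X)
qed

lemma phi_kchains: "z \<in> kchains F i j \<Longrightarrow> \<phi> \<circ> z \<in> kchains M i j"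
  by (rule kchainsI) (auto simp: M phi_0 kchainsD)

lemma lift_kchains:
  assumes "z \<in> kchains M i j"
  obtains y where "y \<in> kchains F i j" "\<phi> \<circ> y = z"
proof -
  have "\<exists>v. (if S \<subseteq> V \<and> card S = i then v \<in> F (j - int i) else v = 0) \<and> \<phi> v = z S" for S
  proof (cases "S \<subseteq> V \<and> card S = i")
    case True
    then show ?thesis using kchainsD(1)[OF assms, of S] by (auto simp: M)
  next
    case False
    then show ?thesis using kchainsD(2)[OF assms, of S] phi_0 by auto
  qed
  then obtain y where "\<And>S. (if S \<subseteq> V \<and> card S = i then y S \<in> F (j - int i) else y S = 0) \<and> \<phi> (y S) = z S"
    by metis
  then have "y \<in> kchains F i j" "\<phi> \<circ> y = z" by (auto simp: kchains_def)
  then show ?thesis by (rule that)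
qed

lemma kchains_K: "z \<in> kchains K i j \<longleftrightarrow> z \<in> kchains F i j \<and> \<phi> \<circ> z = 0"
proof
  assume z: "z \<in> kchains K i j"
  have "\<phi> (z S) = 0" for S
    using kchainsD[OF z, of S] by (cases "S \<subseteq> V \<and> card S = i") (auto simp: K phi_0)
  moreover have "z \<in> kchains F i j"
    using kchainsD[OF z] by (intro kchainsI) (auto simp: K)
  ultimately show "z \<in> kchains F i j \<and> \<phi> \<circ> z = 0" by (simp add: fun_eq_iff)
next
  assume z: "z \<in> kchains F i j \<and> \<phi> \<circ> z = 0"
  then have "\<phi> (z S) = 0" for S by (simp add: fun_eq_iff)
  then show "z \<in> kchains K i j" using z kchainsD[of z F i j] by (intro kchainsI) (simp_all add: K)
qed

lemma phi_comp_add: "\<phi> \<circ> (z + w) = (\<phi> \<circ> z) + (\<phi> \<circ> w)"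
  by (simp add: fun_eq_iff phi_add)

lemma phi_comp_minus: "\<phi> \<circ> (z - w) = (\<phi> \<circ> z) - (\<phi> \<circ> w)"
  by (simp add: fun_eq_iff phi_minus)

text \<open>In the long exact sequence \<open>exact\<close> makes H_{i+1}(F) vanish and
  \<open>minimal\<close> makes H_i(K) -> H_i(F) zero, so the connecting map H_{i+1}(M) -> H_i(K) is
  bijective. The witness is the usual zigzag: lift a cycle of \<open>M\<close> to a chain
  \<open>y\<close> of \<open>F\<close> and take its boundary, without choosing a lift.\<close>

lemma kh_iso_shift:
  assumes exact: "kcycles F (Suc i) j \<subseteq> kbounds F (Suc i) j"
    and minimal: "kcycles K i j \<subseteq> kbounds F i j"
  shows "kh_iso M (Suc i) K i j"
  unfolding subq_iso_def
proof (intro exI[of _ "\<lambda>z z'. kd V s X z = 0 \<and> (\<exists>y\<in>kchains F (Suc i) j. \<phi> \<circ> y = z \<and> kd V s X y = z')"]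
    conjI allI impI ballI; (elim conjE bexE)?)
  fix z z' y assume z: "kd V s X z = 0" "y \<in> kchains F (Suc i) j" "\<phi> \<circ> y = z" "kd V s X y = z'"
  show "z \<in> kcycles M (Suc i) j" using z phi_kchains by (auto simp: kcycles_def)
  show "z' \<in> kcycles K i j"
    using z kd_phi[of y] by (auto simp: kcycles_def kchains_K kd_kchains[OF F] kd_kd0)
  show "z \<in> kbounds M (Suc i) j \<longleftrightarrow> z' \<in> kbounds K i j"
  proof
    assume "z \<in> kbounds M (Suc i) j"
    then obtain w where "w \<in> kchains M (Suc (Suc i)) j" "z = kd V s X w" by (auto simp: kbounds_def)
    then obtain u where u: "u \<in> kchains F (Suc (Suc i)) j" "z = kd V s X (\<phi> \<circ> u)"
      using lift_kchains by metis
    have "y - kd V s X u \<in> kchains K (Suc i) j"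
      using u z by (simp add: kchains_K kchains_minus[OF F] kd_kchains[OF F] phi_comp_minus kd_phi)
    moreover have "kd V s X (y - kd V s X u) = z'" using z by (simp add: kd_minus kd_kd0)
    ultimately show "z' \<in> kbounds K i j" by (auto simp: kbounds_def)
  next
    assume "z' \<in> kbounds K i j"
    then obtain u where u: "u \<in> kchains F (Suc i) j" "\<phi> \<circ> u = 0" "z' = kd V s X u"
      by (auto simp: kbounds_def kchains_K)
    then have "y - u \<in> kcycles F (Suc i) j" using z by (simp add: kcycles_def kchains_minus[OF F] kd_minus)
    then obtain t where t: "t \<in> kchains F (Suc (Suc i)) j" "y - u = kd V s X t"
      using exact by (auto simp: kbounds_def)
    have "z = \<phi> \<circ> (y - u)" using z u by (simp add: phi_comp_minus)
    then have "z = kd V s X (\<phi> \<circ> t)" using t by (simp add: kd_phi)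
    then show "z \<in> kbounds M (Suc i) j" using phi_kchains[OF t(1)] by (auto simp: kbounds_def)
  qed
next
  fix z assume z: "z \<in> kcycles M (Suc i) j"
  then obtain y where "y \<in> kchains F (Suc i) j" "\<phi> \<circ> y = z"
    using lift_kchains[of z "Suc i" j] by (auto simp: kcycles_def)
  then show "\<exists>z'. kd V s X z = 0 \<and> (\<exists>y\<in>kchains F (Suc i) j. \<phi> \<circ> y = z \<and> kd V s X y = z')"
    using z by (auto simp: kcycles_def)
next
  fix z' assume z': "z' \<in> kcycles K i j"
  then obtain y where y: "y \<in> kchains F (Suc i) j" "kd V s X y = z'"
    using minimal by (auto simp: kbounds_def)
  moreover have "kd V s X (\<phi> \<circ> y) = 0" using y z' by (simp add: kd_phi kcycles_def kchains_K)
  ultimately show "\<exists>z. kd V s X z = 0 \<and> (\<exists>y\<in>kchains F (Suc i) j. \<phi> \<circ> y = z \<and> kd V s X y = z')" by blast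
next
  fix z z' w w' y y'
  assume "kd V s X z = 0" "kd V s X w = 0" "y \<in> kchains F (Suc i) j" "\<phi> \<circ> y = z" "kd V s X y = z'"
    "y' \<in> kchains F (Suc i) j" "\<phi> \<circ> y' = w" "kd V s X y' = w'"
  then show "kd V s X (z + w) = 0"
    "\<exists>y\<in>kchains F (Suc i) j. \<phi> \<circ> y = z + w \<and> kd V s X y = z' + w'"
    by (auto simp: kd_add kchains_add[OF F] phi_comp_add intro!: bexI[of _ "y + y'"])
next
  fix c z z' y
  assume "kd V s X z = 0" "y \<in> kchains F (Suc i) j" "\<phi> \<circ> y = z" "kd V s X y = z'"
  moreover from this have "\<phi> \<circ> csc c y = csc c z" by (auto simp: csc_def phi_sc)
  ultimately show "kd V s X (csc c z) = 0"
    "\<exists>y\<in>kchains F (Suc i) j. \<phi> \<circ> y = csc c z \<and> kd V s X y = csc c z'"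
    by (auto simp: kd_csc kchains_csc[OF F] intro!: bexI[of _ "csc c y"]) (simp add: csc_def fun_eq_iff)
qed

text \<open>A surjection whose kernel maps to zero in H_0(F) identifies H_0(F) with H_0(M):
  generators of a minimal cover correspond to minimal generators of \<open>M\<close>.\<close>

lemma kh_iso_cover:
  assumes minimal: "kcycles K 0 j \<subseteq> kbounds F 0 j"
  shows "kh_iso F 0 M 0 j"
  unfolding subq_iso_def
proof (intro exI[of _ "\<lambda>z z'. z \<in> kcycles F 0 j \<and> z' = \<phi> \<circ> z"] conjI allI impI ballI; (elim conjE)?)
  fix z z' assume z: "z \<in> kcycles F 0 j" "z' = \<phi> \<circ> z"
  then show "z \<in> kcycles F 0 j" by simp
  show "z' \<in> kcycles M 0 j" using z phi_kchains by (simp add: kcycles_0)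
  show "z \<in> kbounds F 0 j \<longleftrightarrow> z' \<in> kbounds M 0 j"
  proof
    assume "z \<in> kbounds F 0 j"
    then obtain w where "w \<in> kchains F (Suc 0) j" "z = kd V s X w" by (auto simp: kbounds_def)
    then show "z' \<in> kbounds M 0 j" using z(2) phi_kchains by (auto simp: kbounds_def simp flip: kd_phi)
  next
    assume "z' \<in> kbounds M 0 j"
    then obtain w where "w \<in> kchains M (Suc 0) j" "z' = kd V s X w" by (auto simp: kbounds_def)
    then obtain u where u: "u \<in> kchains F (Suc 0) j" "z' = kd V s X (\<phi> \<circ> u)"
      using lift_kchains by metis
    have "z - kd V s X u \<in> kcycles K 0 j"
      using u z by (simp add: kcycles_0 kchains_K kchains_minus[OF F] kd_kchains[OF F] phi_comp_minus kd_phi)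
    then have "z - kd V s X u \<in> kbounds F 0 j" using minimal by blast
    then have "z - kd V s X u + kd V s X u \<in> kbounds F 0 j"
      by (rule kbounds_add[OF F]) (use u in \<open>auto simp: kbounds_def\<close>)
    then show "z \<in> kbounds F 0 j" by simp
  qed
next
  fix z assume "z \<in> kcycles F 0 j" then show "\<exists>z'. z \<in> kcycles F 0 j \<and> z' = \<phi> \<circ> z" by blast
next
  fix z' assume "z' \<in> kcycles M 0 j"
  then show "\<exists>z. z \<in> kcycles F 0 j \<and> z' = \<phi> \<circ> z" using lift_kchains by (metis kcycles_0)
qed (auto simp: kcycles_add[OF F] kcycles_csc[OF F] phi_comp_add, auto simp: csc_def phi_sc)

end

end

section \<open>Monomials\<close>

lemma poly_mapping_expand:
  fixes p :: "'a \<Rightarrow>\<^sub>0 'b::comm_monoid_add"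
  shows "p = (\<Sum>m\<in>keys p. single m (lookup p m))"
proof (rule poly_mapping_eqI)
  fix n
  show "lookup p n = lookup
      (\<Sum>m\<in>keys p. single m (lookup p m)) n"
    by (auto simp: lookup_sum lookup_single when_def in_keys_iff)
qed

lemma lookup_sg: "lookup (sg b p) n = sg b (lookup p n)"
  by (simp add: sg_def)

lemma lookup_monomial_mult:
  fixes p :: "('v, 'k::field) mpoly"
  shows "lookup (single m c * p) (m + n) = c * lookup p n"
proof -
  have "lookup (single m c * p) (m + n)
      = (\<Sum>l\<in>keys p. lookup
          (single (m + l) (c * lookup p l)) (m + n))"
    by (subst poly_mapping_expand[of p]) (simp add: sum_distrib_left lookup_sum mult_single)
  also have "\<dots> = (\<Sum>l\<in>keys p. if l = n then c * lookup p l else 0)"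
    by (intro sum.cong) (auto simp: lookup_single when_def)
  also have "\<dots> = c * lookup p n"
    by (simp add: in_keys_iff)
  finally show ?thesis .
qed

lemma keys_monomial_mult:
  fixes p :: "('v, 'k::field) mpoly"
  shows "keys (single m c * p) \<subseteq> (+) m ` keys p"
proof
  fix n assume "n \<in> keys (single m c * p)"
  then obtain a b where "n = a + b" "a \<in> keys (single m c)" "b \<in> keys p"
    using keys_mult[of "single m c" p] by blast
  then show "n \<in> (+) m ` keys p" by (auto split: if_splits)
qed

lemma lookup_const_mult:
  fixes p :: "('v, 'k::field) mpoly"
  shows "lookup (single 0 c * p) n = c * lookup p n"
  using lookup_monomial_mult[of 0 c p n] by simp

lemma lookup_var_mult:
  fixes p :: "('v, 'k::field) mpoly"
  shows "lookup (var x * p) n =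
    (if x \<in> keys n then lookup p (n - single x 1) else 0)"
proof (cases "x \<in> keys n")
  case True
  then have "n = single x 1 + (n - single x 1)"
    by (intro poly_mapping_eqI) (auto simp: lookup_add lookup_minus lookup_single when_def in_keys_iff)
  then show ?thesis using True lookup_monomial_mult[of "single x 1" 1 p "n - single x 1"]
    by (simp add: var_def)
next
  case False
  have "n \<notin> keys (var x * p)"
  proof
    assume "n \<in> keys (var x * p)"
    then obtain l where "n = single x 1 + l"
      using keys_monomial_mult unfolding var_def by blast
    then show False using False by (simp add: in_keys_iff lookup_add)
  qed
  then show ?thesis using False by (simp add: in_keys_iff)
qed

lemma keys_add_nat:
  fixes m n :: "'v \<Rightarrow>\<^sub>0 nat"
  shows "keys (m + n) = keys m \<union> keys n"
  by (auto simp: in_keys_iff lookup_add)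

lemma mon_degree_superset:
  assumes "finite A" "keys m \<subseteq> A"
  shows "mon_degree m = (\<Sum>x\<in>A. lookup m x)"
  unfolding mon_degree_def using assms
  by (intro sum.mono_neutral_left) (auto simp: in_keys_iff)

lemma mon_degree_add: "mon_degree (m + n) = mon_degree m + mon_degree n"
proof -
  let ?A = "keys m \<union> keys n"
  have "mon_degree (m + n) = (\<Sum>x\<in>?A. lookup (m + n) x)"
    by (rule mon_degree_superset) (auto simp: keys_add_nat)
  also have "\<dots> = mon_degree m + mon_degree n"
    by (simp add: lookup_add sum.distrib mon_degree_superset[of ?A m] mon_degree_superset[of ?A n])
  finally show ?thesis .
qed

lemma mon_degree_single [simp]: "mon_degree (single x k) = k"
  by (simp add: mon_degree_def)

lemma mon_degree_0 [simp]: "mon_degree 0 = 0"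
  by (simp add: mon_degree_def)

definition sqm :: "'v set \<Rightarrow> 'v \<Rightarrow>\<^sub>0 nat" where
  "sqm S = (\<Sum>x\<in>S. single x 1)"

lemma lookup_sqm: "finite S \<Longrightarrow> lookup (sqm S) x = (if x \<in> S then 1 else 0)"
  by (simp add: sqm_def lookup_sum lookup_single when_def)

lemma keys_sqm [simp]: "finite S \<Longrightarrow> keys (sqm S) = S"
  by (auto simp: in_keys_iff lookup_sqm split: if_splits)

lemma mon_degree_sqm [simp]: "finite S \<Longrightarrow> mon_degree (sqm S) = card S"
  by (simp add: mon_degree_def lookup_sqm)

lemma finite_subset_keys: "S \<subseteq> keys m \<Longrightarrow> finite S"
  by (erule finite_subset) simp

lemma sqm_diff_add: "S \<subseteq> keys m \<Longrightarrow> (m - sqm S) + sqm S = m"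
  using finite_subset_keys[of S m]
  by (intro poly_mapping_eqI) (auto simp: lookup_add lookup_minus lookup_sqm in_keys_iff)

lemma sqm_diff_insert:
  assumes "finite S" "x \<notin> S"
  shows "m - sqm S - single x 1 = m - sqm (insert x S)"
  using assms by (intro poly_mapping_eqI) (auto simp: lookup_minus lookup_sqm lookup_single when_def)

lemma mon_degree_diff_sqm:
  assumes "S \<subseteq> keys m"
  shows "mon_degree (m - sqm S) + card S = mon_degree m"
proof -
  have "finite S" using assms by (rule finite_subset_keys)
  then show ?thesis using mon_degree_add[of "m - sqm S" "sqm S"] by (simp add: sqm_diff_add[OF assms])
qed

lemma sqm_diff:
  assumes "finite W" "S \<subseteq> W"
  shows "sqm W - sqm S = sqm (W - S)"
proof -
  have "finite S" using assms finite_subset by blast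
  then show ?thesis using assms by (intro poly_mapping_eqI) (auto simp: lookup_minus lookup_sqm)
qed

lemma sqm_keys:
  assumes "\<And>x. lookup m x \<le> 1"
  shows "sqm (keys m) = m"
proof (rule poly_mapping_eqI)
  fix x show "lookup (sqm (keys m)) x = lookup m x"
    using assms[of x] by (auto simp: lookup_sqm in_keys_iff)
qed

section \<open>Koszul homology of monomial submodules of free modules\<close>

text \<open>
  Elements of all free modules \<open>R\<^sup>n\<close> are represented in the single type \<open>nat \<Rightarrow> R\<close>, with zero entries
  from position \<open>n\<close> on.
\<close>

definition vX :: "'v \<Rightarrow> (nat \<Rightarrow> ('v, 'k::field) mpoly) \<Rightarrow> nat \<Rightarrow> ('v, 'k) mpoly" where
  "vX x v = (\<lambda>a. var x * v a)"

definition vsc :: "'k \<Rightarrow> (nat \<Rightarrow> ('v, 'k::field) mpoly) \<Rightarrow> nat \<Rightarrow> ('v, 'k) mpoly" where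
  "vsc c v = (\<lambda>a. single 0 c * v a)"

text \<open>
  The submodule spanned by monomials \<open>x\<^sup>m e\<^sub>a\<close>, with \<open>P a j\<close> the set of those \<open>m\<close> for which this element
  has degree \<open>j\<close>.
\<close>

definition mono_mod :: "(nat \<Rightarrow> int \<Rightarrow> ('v \<Rightarrow>\<^sub>0 nat) set) \<Rightarrow> int \<Rightarrow> (nat \<Rightarrow> ('v, 'k::field) mpoly) set" where
  "mono_mod P j = {v. \<forall>a. keys (v a) \<subseteq> P a j}"

definition free_exps :: "'v set \<Rightarrow> int list \<Rightarrow> nat \<Rightarrow> int \<Rightarrow> ('v \<Rightarrow>\<^sub>0 nat) set" where
  "free_exps V sh a j = {m. a < length sh \<and> keys m \<subseteq> V \<and> int (mon_degree m) = j - sh ! a}"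

text \<open>The ideal is treated as a submodule of the free module of rank one, hence the position
  \<open>a = 0\<close>.\<close>

definition ideal_exps :: "'v set \<Rightarrow> 'v set set \<Rightarrow> nat \<Rightarrow> int \<Rightarrow> ('v \<Rightarrow>\<^sub>0 nat) set" where
  "ideal_exps V E a j = {m. a = 0 \<and> keys m \<subseteq> V \<and> int (mon_degree m) = j \<and>
     (\<exists>A\<in>E. A \<subseteq> keys m)}"

text \<open>The component of multidegree \<open>m\<close> at position \<open>a\<close> of a chain.\<close>

definition cf :: "('v set \<Rightarrow> nat \<Rightarrow> ('v, 'k::field) mpoly) \<Rightarrow> nat \<Rightarrow> ('v \<Rightarrow>\<^sub>0 nat) \<Rightarrow> 'v set \<Rightarrow> 'k" where
  "cf z a m S = (if S \<subseteq> keys m then lookup (z S a) (m - sqm S) else 0)"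

locale poly_koszul = koszul_sign V s for V :: "'v set" and s +
  fixes coefficients :: "'k::field itself"
begin

sublocale graded_ops V s "vX :: 'v \<Rightarrow> (nat \<Rightarrow> ('v, 'k) mpoly) \<Rightarrow> _" vsc
  by unfold_locales (simp_all add: vX_def vsc_def fun_eq_iff algebra_simps)

lemma koszul_sign_subset: "W \<subseteq> V \<Longrightarrow> koszul_sign W s"
  using finite_V swap by (auto simp: koszul_sign_def finite_subset subset_iff)

lemma gsub_mono_mod:
  assumes "\<And>a j m x. m \<in> P a j \<Longrightarrow> x \<in> V \<Longrightarrow> single x 1 + m \<in> P a (j + 1)"
  shows "gsub (mono_mod P)"
  unfolding gsub_def
proof (intro allI conjI ballI)
  fix j c and u v :: "nat \<Rightarrow> ('v, 'k) mpoly"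
  assume u: "u \<in> mono_mod P j"
  show "- u \<in> mono_mod P j" using u by (simp add: mono_mod_def)
  show "vsc c u \<in> mono_mod P j"
    using u keys_monomial_mult[of 0 c] unfolding mono_mod_def vsc_def by fastforce
  show "vX x u \<in> mono_mod P (j + 1)" if "x \<in> V" for x
    using u keys_monomial_mult[of "single x 1" 1] assms[OF _ that]
    unfolding mono_mod_def vX_def var_def by blast
  assume "v \<in> mono_mod P j"
  with u show "u + v \<in> mono_mod P j"
    using Poly_Mapping.keys_add unfolding mono_mod_def by fastforce
qed (simp add: mono_mod_def)

text \<open>The differential preserves multidegrees. A variable outside \<open>keys m\<close>
  contributes nothing, because it cannot divide the coefficient monomial \<open>m - sqm S\<close>;
  so the component is a complex on \<open>keys m\<close> with scalar coefficients.\<close>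

lemma cf_kd:
  fixes z :: "'v set \<Rightarrow> nat \<Rightarrow> ('v, 'k) mpoly"
  assumes m: "keys m \<subseteq> V" and S: "S \<subseteq> keys m"
  shows "cf (kd V s vX z) a m S = kd\<^sub>1 (keys m) s (cf z a m) S"
proof -
  have fin: "finite S" using S by (rule finite_subset_keys)
  have fun_sum: "(sum f A) a = (\<Sum>x\<in>A. f x a)" for f :: "'v \<Rightarrow> nat \<Rightarrow> ('v, 'k) mpoly" and A
    by (induction A rule: infinite_finite_induct) auto
  have "cf (kd V s vX z) a m S
      = (\<Sum>x\<in>V - S. sg (s x S) (lookup (var x * z (insert x S) a) (m - sqm S)))"
  proof -
    have "sg b v a = sg b (v a)" for b and v :: "nat \<Rightarrow> ('v, 'k) mpoly" by (simp add: sg_def)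
    then show ?thesis using m S by (auto simp: cf_def kd_def fun_sum lookup_sum lookup_sg vX_def)
  qed
  also have "\<dots> = (\<Sum>x\<in>V - S. if x \<in> keys m then sg (s x S) (cf z a m (insert x S)) else 0)"
  proof (intro sum.cong refl)
    fix x assume x: "x \<in> V - S"
    have "x \<in> keys (m - sqm S) \<longleftrightarrow> x \<in> keys m"
      using x fin by (simp add: in_keys_iff lookup_minus lookup_sqm)
    then show "sg (s x S) (lookup (var x * z (insert x S) a) (m - sqm S))
        = (if x \<in> keys m then sg (s x S) (cf z a m (insert x S)) else 0)"
      using x fin S sqm_diff_insert[of S x m] by (simp add: lookup_var_mult cf_def)
  qed
  also have "\<dots> = (\<Sum>x\<in>keys m - S. sg (s x S) (cf z a m (insert x S)))"
    using m finite_V by (intro sum.mono_neutral_cong_right) auto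
  finally show ?thesis using S by (simp add: kd_def)
qed

text \<open>The coefficient of a monomial \<open>n\<close> at \<open>S\<close> belongs to the
  multidegree \<open>n + sqm S\<close>, so the multidegree components determine the whole
  chain.\<close>

lemma chain_eqI:
  fixes z w :: "'v set \<Rightarrow> nat \<Rightarrow> ('v, 'k) mpoly"
  assumes z: "\<And>S. \<not> S \<subseteq> V \<Longrightarrow> z S = w S"
    and keys: "\<And>S a. keys (z S a) \<subseteq> {m. keys m \<subseteq> V}"
      "\<And>S a. keys (w S a) \<subseteq> {m. keys m \<subseteq> V}"
    and cf: "\<And>a m S. keys m \<subseteq> V \<Longrightarrow> S \<subseteq> keys m \<Longrightarrow> cf z a m S = cf w a m S"
  shows "z = w"
proof (intro ext poly_mapping_eqI)
  fix S a n
  show "lookup (z S a) n = lookup (w S a) n"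
  proof (cases "S \<subseteq> V \<and> keys n \<subseteq> V")
    case True
    then have fin: "finite S" using finite_V finite_subset by blast
    have *: "n + sqm S - sqm S = n"
      by (intro poly_mapping_eqI) (simp add: lookup_minus lookup_add)
    show ?thesis
      using cf[of "n + sqm S" S a] True fin by (simp add: keys_add_nat cf_def * )
  next
    case False
    then show ?thesis using z keys by (cases "S \<subseteq> V") (auto simp: in_keys_iff subset_iff, metis)
  qed
qed

lemma kchains_keys:
  assumes "z \<in> kchains (mono_mod P) i j" "\<And>a j. P a j \<subseteq> {m. keys m \<subseteq> V}"
  shows "keys (z S a) \<subseteq> {m. keys m \<subseteq> V}"
proof (cases "S \<subseteq> V \<and> card S = i")
  case True
  then have "z S \<in> mono_mod P (j - int i)" using kchainsD(1)[OF assms(1)] by blast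
  then show ?thesis using assms(2) unfolding mono_mod_def by blast
next
  case False
  then show ?thesis using kchainsD(2)[OF assms(1) False] by simp
qed

text \<open>\<open>b\<close> is a preimage of the component of multidegree \<open>m\<close> under
  the scalar differential; the support condition guarantees that \<open>b\<close> describes a chain
  of the module with exponents \<open>P\<close> in degree \<open>j\<close>.\<close>

definition filling where
  "filling P i j z a m b \<longleftrightarrow>
    (\<forall>S. b S \<noteq> 0 \<longrightarrow> S \<subseteq> keys m \<and> card S = Suc i \<and> m - sqm S \<in> P a (j - int (Suc i))) \<and>
    (\<forall>S\<subseteq>keys m. kd\<^sub>1 (keys m) s b S = cf z a m S)"

text \<open>Monomial submodules split by multidegrees, so a preimage may be chosen in each
  multidegree separately and the choices summed.\<close>

lemma kbounds_mono_modI: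
  fixes z :: "'v set \<Rightarrow> nat \<Rightarrow> ('v, 'k) mpoly"
  assumes P: "gsub (mono_mod P :: int \<Rightarrow> (nat \<Rightarrow> ('v, 'k) mpoly) set)"
    and PV: "\<And>a j. P a j \<subseteq> {m. keys m \<subseteq> V}"
    and z: "z \<in> kchains (mono_mod P) i j"
    and ex: "\<And>a m. keys m \<subseteq> V \<Longrightarrow> \<exists>b. filling P i j z a m b"
  shows "z \<in> kbounds (mono_mod P) i j"
proof -
  define b where "b a m = (SOME b. filling P i j z a m b)" for a m
  have "filling P i j z a m (b a m)" if "keys m \<subseteq> V" for a m
    using someI_ex[OF ex[OF that]] unfolding b_def .
  then have b: "\<And>a m S. keys m \<subseteq> V \<Longrightarrow> b a m S \<noteq> 0 \<Longrightarrow>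
        S \<subseteq> keys m \<and> card S = Suc i \<and> m - sqm S \<in> P a (j - int (Suc i))"
    and kdb: "\<And>a m S. keys m \<subseteq> V \<Longrightarrow> S \<subseteq> keys m \<Longrightarrow> kd\<^sub>1 (keys m) s (b a m) S = cf z a m S"
    unfolding filling_def by blast+
  \<comment> \<open>Only the finitely many multidegrees that occur in \<open>z\<close> are filled;
    otherwise the sum of the choices would not be a polynomial.\<close>
  define D where "D a = {m. keys m \<subseteq> V \<and> (\<exists>S. cf z a m S \<noteq> 0)}" for a
  have D: "finite (D a)" for a
  proof (rule finite_subset)
    show "D a \<subseteq> (\<Union>S\<in>Pow V. (\<lambda>n. n + sqm S) ` keys (z S a))"
    proof
      fix m assume "m \<in> D a"
      then obtain S where S: "S \<subseteq> keys m" "keys m \<subseteq> V"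
          "m - sqm S \<in> keys (z S a)"
        by (auto simp: D_def cf_def in_keys_iff split: if_splits)
      then have "m \<in> (\<lambda>n. n + sqm S) ` keys (z S a)"
        using sqm_diff_add[OF S(1)] by (intro image_eqI[of _ _ "m - sqm S"]) auto
      then show "m \<in> (\<Union>S\<in>Pow V. (\<lambda>n. n + sqm S) ` keys (z S a))" using S by blast
    qed
  qed (use finite_V in auto)
  define y where "y S a = (\<Sum>m\<in>D a. single (m - sqm S) (b a m S))" for S a
  have keys_y: "\<exists>m\<in>D a. n = m - sqm S \<and> b a m S \<noteq> 0" if n: "n \<in> keys (y S a)" for S a n
  proof -
    have "n \<in> (\<Union>m\<in>D a. keys (single (m - sqm S) (b a m S)))"
      using n keys_sum[of "\<lambda>m. single (m - sqm S) (b a m S)" "D a"] unfolding y_def by blast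
    then show ?thesis by (auto split: if_splits)
  qed
  have y: "y \<in> kchains (mono_mod P) (Suc i) j"
  proof (rule kchainsI)
    fix S assume "S \<subseteq> V" "card S = Suc i"
    show "y S \<in> mono_mod P (j - int (Suc i))"
      unfolding mono_mod_def using keys_y b by (fastforce simp: D_def)
  next
    fix S assume S: "\<not> (S \<subseteq> V \<and> card S = Suc i)"
    have "b a m S = 0" if "m \<in> D a" for a m using b[of m a S] that S by (auto simp: D_def)
    then show "y S = 0" by (auto simp: y_def fun_eq_iff)
  qed
  have "kd V s vX y = z"
  proof (rule chain_eqI)
    show "\<And>S. \<not> S \<subseteq> V \<Longrightarrow> kd V s vX y S = z S" using kchainsD(2)[OF z] by (simp add: kd_def)
    show "\<And>S a. keys (kd V s vX y S a) \<subseteq> {m. keys m \<subseteq> V}"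
      by (rule kchains_keys[OF kd_kchains[OF P y] PV])
    show "\<And>S a. keys (z S a) \<subseteq> {m. keys m \<subseteq> V}"
      by (rule kchains_keys[OF z PV])
    fix a S and m :: "'v \<Rightarrow>\<^sub>0 nat" assume m: "keys m \<subseteq> V" and S: "S \<subseteq> keys m"
    have cfy: "cf y a m T = (if m \<in> D a then b a m T else 0)" for T
    proof (cases "T \<subseteq> keys m")
      case True
      have "lookup (y T a) (m - sqm T)
          = (\<Sum>m'\<in>D a. if m' = m then b a m T else 0)"
        unfolding y_def lookup_sum
      proof (intro sum.cong refl)
        fix m' assume m': "m' \<in> D a"
        \<comment> \<open>Different multidegrees do not interfere at the same \<open>T\<close>: the
          monomial \<open>m' - sqm T\<close> together with \<open>T \<subseteq> keys m'\<close>
          determines \<open>m'\<close>.\<close>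
        have "m' = m" if "b a m' T \<noteq> 0" "m' - sqm T = m - sqm T"
        proof -
          have "T \<subseteq> keys m'" using b that m' by (auto simp: D_def)
          then show ?thesis using sqm_diff_add[OF True] sqm_diff_add[of T m'] that by metis
        qed
        then show "lookup (single (m' - sqm T) (b a m' T)) (m - sqm T)
            = (if m' = m then b a m T else 0)"
          by (auto simp: lookup_single when_def)
      qed
      then show ?thesis using True D[of a] by (simp add: cf_def)
    next
      case False
      then show ?thesis using b[OF m, of a T] by (auto simp: cf_def)
    qed
    have "cf (kd V s vX y) a m S = kd\<^sub>1 (keys m) s (cf y a m) S"
      by (rule cf_kd[OF m S])
    also have "\<dots> = cf z a m S"
    proof (cases "m \<in> D a")
      case True
      then have "cf y a m = b a m" using cfy by auto
      then show ?thesis using kdb[OF m S] by simp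
    next
      case False
      then have "cf z a m S = 0" "cf y a m = (\<lambda>_. 0)" using m cfy by (auto simp: D_def)
      then show ?thesis by (simp add: kd_def)
    qed
    finally show "cf (kd V s vX y) a m S = cf z a m S" .
  qed
  with y show ?thesis by (auto simp: kbounds_def)
qed

text \<open>Division by \<open>x\<^sub>p\<close> contracts the component of multidegree \<open>m\<close>, provided that it stays in the module.\<close>

lemma cone_filling:
  assumes P: "gsub (mono_mod P :: int \<Rightarrow> (nat \<Rightarrow> ('v, 'k) mpoly) set)"
    and z: "z \<in> kcycles (mono_mod P) i j"
    and m: "keys m \<subseteq> V" and p: "p \<in> keys m"
    and div: "\<And>S. S \<subseteq> keys m \<Longrightarrow> p \<notin> S \<Longrightarrow> card S = i \<Longrightarrow> m - sqm S \<in> P a (j - int i) \<Longrightarrow>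
      m - sqm (insert p S) \<in> P a (j - int (Suc i))"
  shows "\<exists>b. filling P i j z a m b"
proof -
  interpret W: koszul_sign "keys m" s by (rule koszul_sign_subset[OF m])
  have zc: "z \<in> kchains (mono_mod P) i j" "kd V s vX z = 0" using z by (auto simp: kcycles_def)
  show ?thesis
    unfolding filling_def
  proof (intro exI[of _ "W.cone p (cf z a m)"] conjI allI impI)
    fix S assume "W.cone p (cf z a m) S \<noteq> 0"
    then have S: "p \<in> S" "S \<subseteq> keys m" "cf z a m (S - {p}) \<noteq> 0"
      by (auto simp: W.cone_def split: if_splits)
    then have l: "m - sqm (S - {p}) \<in> keys (z (S - {p}) a)"
      by (auto simp: cf_def in_keys_iff split: if_splits)
    then have c: "S - {p} \<subseteq> V \<and> card (S - {p}) = i" using kchainsD(2)[OF zc(1), of "S - {p}"] by fastforce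
    then have "m - sqm (S - {p}) \<in> P a (j - int i)"
      using l kchainsD(1)[OF zc(1), of "S - {p}"] unfolding mono_mod_def by blast
    from div[OF _ _ _ this] c S show "m - sqm S \<in> P a (j - int (Suc i))"
      by (simp add: insert_absorb subset_insertI2 Diff_subset_conv)
    have "finite S" using S(2) by (rule finite_subset_keys)
    with c S show "card S = Suc i" by (metis card.remove)
    show "S \<subseteq> keys m" by fact
  next
    fix S assume S: "S \<subseteq> keys m"
    show "kd\<^sub>1 (keys m) s (W.cone p (cf z a m)) S = cf z a m S"
    proof (rule W.kd_cone[OF p S])
      have "kd\<^sub>1 (keys m) s (cf z a m) (S - {p}) = cf (kd V s vX z) a m (S - {p})"
        by (rule cf_kd[OF m, symmetric]) (use S in blast)
      then show "kd\<^sub>1 (keys m) s (cf z a m) (S - {p}) = 0"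
        by (simp add: zc cf_def)
    qed
  qed
qed

abbreviation free_mod :: "int list \<Rightarrow> int \<Rightarrow> (nat \<Rightarrow> ('v, 'k) mpoly) set" where
  "free_mod sh \<equiv> mono_mod (free_exps V sh)"

lemma gsub_free_mod: "gsub (free_mod sh)"
  by (rule gsub_mono_mod) (auto simp: free_exps_def keys_add_nat mon_degree_add split: if_splits)

text \<open>In a multidegree \<open>m \<noteq> 0\<close> every variable \<open>p\<close> that
  divides \<open>m\<close> gives a cone, because in a free module the quotient by \<open>p\<close>
  stays in the module. In multidegree 0 only the constants at \<open>S = {}\<close> survive, and
  \<open>const\<close> excludes them.\<close>

lemma free_mod_exact:
  assumes z: "z \<in> kcycles (free_mod sh) i j"
    and const: "i = 0 \<Longrightarrow> \<forall>a. lookup (z {} a) 0 = 0"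
  shows "z \<in> kbounds (free_mod sh) i j"
proof (rule kbounds_mono_modI[OF gsub_free_mod])
  show zc: "z \<in> kchains (free_mod sh) i j" using z by (simp add: kcycles_def)
  fix a :: nat and m :: "'v \<Rightarrow>\<^sub>0 nat" assume m: "keys m \<subseteq> V"
  show "\<exists>b. filling (free_exps V sh) i j z a m b"
  proof (cases "m = 0")
    case True
    have "cf z a m {} = 0"
    proof (cases "i = 0")
      case True
      then show ?thesis using const \<open>m = 0\<close> by (simp add: cf_def sqm_def)
    next
      case False
      then have "z {} = 0" using kchainsD(2)[OF zc, of "{}"] by simp
      then show ?thesis by (simp add: cf_def)
    qed
    then show ?thesis using True by (intro exI[of _ "\<lambda>_. 0"]) (auto simp: filling_def kd_def)
  next
    case False
    then obtain p where p: "p \<in> keys m" by (metis ex_in_conv keys_eq_empty)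
    show ?thesis
    proof (rule cone_filling[OF gsub_free_mod z m p])
      fix S assume S: "S \<subseteq> keys m" "p \<notin> S" "card S = i" "m - sqm S \<in> free_exps V sh a (j - int i)"
      have fin: "finite S" using S(1) by (rule finite_subset_keys)
      have "keys (m - sqm (insert p S)) \<subseteq> keys m"
        by (auto simp: in_keys_iff lookup_minus)
      then show "m - sqm (insert p S) \<in> free_exps V sh a (j - int (Suc i))"
        using S p m fin mon_degree_diff_sqm[of S m] mon_degree_diff_sqm[of "insert p S" m]
        by (auto simp: free_exps_def)
    qed
  qed
qed (auto simp: free_exps_def)

end

section \<open>Koszul homology of squarefree monomial ideals\<close>

text \<open>
  For \<open>W \<subseteq> V\<close>, the component of multidegree \<open>W\<close> of the Koszul complex of the ideal generated by
  the squarefree monomials \<open>E\<close> has a basis indexed by the sets \<open>S \<subseteq> W\<close> such that \<open>W - S\<close> contains a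
  member of \<open>E\<close>.
\<close>

definition sqf_chain :: "'v set set \<Rightarrow> 'v set \<Rightarrow> nat \<Rightarrow> ('v set \<Rightarrow> 'k::zero) \<Rightarrow> bool" where
  "sqf_chain E W i c \<longleftrightarrow> (\<forall>S. c S \<noteq> 0 \<longrightarrow> S \<subseteq> W \<and> card S = i \<and> (\<exists>A\<in>E. A \<subseteq> W - S))"

text \<open>Nonvanishing of Koszul homology in multidegree \<open>W\<close>. The field is an
  argument, since this can depend on the characteristic.\<close>

definition sqf_hnz :: "'k::field itself \<Rightarrow> ('v \<Rightarrow> 'v set \<Rightarrow> bool) \<Rightarrow> 'v set set \<Rightarrow> 'v set \<Rightarrow> nat \<Rightarrow> bool" where
  "sqf_hnz k s E W i \<longleftrightarrow> (\<exists>c :: 'v set \<Rightarrow> 'k. sqf_chain E W i c \<and> kd\<^sub>1 W s c = 0 \<and>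
     \<not> (\<exists>b. sqf_chain E W (Suc i) b \<and> kd\<^sub>1 W s b = c))"

lemma sqf_hnz_card:
  fixes E :: "'v set set" and k :: "'k::field itself"
  assumes "sqf_hnz k s E W i" "finite W"
  shows "i \<le> card W"
proof -
  obtain c :: "'v set \<Rightarrow> 'k" where c: "sqf_chain E W i c"
      "\<not> (\<exists>b. sqf_chain E W (Suc i) b \<and> kd\<^sub>1 W s b = c)"
    using assms(1) by (auto simp: sqf_hnz_def)
  have "c \<noteq> 0"
  proof
    assume "c = 0"
    then have "sqf_chain E W (Suc i) (\<lambda>_. 0 :: 'k) \<and> kd\<^sub>1 W s (\<lambda>_. 0) = c"
      by (simp add: sqf_chain_def kd_def fun_eq_iff)
    with c(2) show False by blast
  qed
  then obtain S where "c S \<noteq> 0" by (auto simp: fun_eq_iff)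
  with c(1) assms(2) show ?thesis unfolding sqf_chain_def by (metis card_mono)
qed

context poly_koszul
begin

abbreviation ideal_mod :: "'v set set \<Rightarrow> int \<Rightarrow> (nat \<Rightarrow> ('v, 'k) mpoly) set" where
  "ideal_mod E \<equiv> mono_mod (ideal_exps V E)"

lemma gsub_ideal_mod: "gsub (ideal_mod E)"
  by (rule gsub_mono_mod) (auto simp: ideal_exps_def keys_add_nat mon_degree_add split: if_splits)

lemma ideal_exps_V: "ideal_exps V E a j \<subseteq> {m. keys m \<subseteq> V}"
  by (auto simp: ideal_exps_def)

lemma cf_neq_0_kchains:
  assumes "z \<in> kchains (mono_mod P) i j" "cf z a m S \<noteq> 0"
  shows "S \<subseteq> keys m" "card S = i" "m - sqm S \<in> P a (j - int i)"
proof -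
  have l: "S \<subseteq> keys m" "m - sqm S \<in> keys (z S a)"
    using assms(2) by (auto simp: cf_def in_keys_iff split: if_splits)
  then have c: "S \<subseteq> V \<and> card S = i"
    using kchainsD(2)[OF assms(1), of S] by fastforce
  show "S \<subseteq> keys m" "card S = i" using l c by auto
  show "m - sqm S \<in> P a (j - int i)"
    using l kchainsD(1)[OF assms(1), of S] c unfolding mono_mod_def by blast
qed

text \<open>A cycle that is not a boundary has a multidegree without a filling. That multidegree is
  squarefree, hence some \<open>W\<close>, and its component is a class at \<open>W\<close>;
  conversely, a class at \<open>W\<close> gives a cycle concentrated in that multidegree.\<close>

lemma ideal_mod_nonexact:
  "\<not> kcycles (ideal_mod E) i j \<subseteq> kbounds (ideal_mod E) i j \<longleftrightarrow>
    (\<exists>W\<subseteq>V. int (card W) = j \<and> sqf_hnz TYPE('k) s E W i)"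
proof
  assume "\<not> kcycles (ideal_mod E) i j \<subseteq> kbounds (ideal_mod E) i j"
  then obtain z where z: "z \<in> kcycles (ideal_mod E) i j" "z \<notin> kbounds (ideal_mod E) i j" by blast
  then have zc: "z \<in> kchains (ideal_mod E) i j" "kd V s vX z = 0" by (auto simp: kcycles_def)
  obtain a m where m: "keys m \<subseteq> V" and nob: "\<not> (\<exists>b. filling (ideal_exps V E) i j z a m b)"
    using kbounds_mono_modI[OF gsub_ideal_mod ideal_exps_V zc(1)] z(2) by blast
  \<comment> \<open>If the exponent of \<open>p\<close> in \<open>m\<close> is at least 2, dividing
    the coefficient monomial by \<open>p\<close> does not change its support, so it stays in the
    squarefree monomial ideal and the cone at \<open>p\<close> fills the component.\<close>
  have sq: "lookup m p \<le> 1" for p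
  proof (rule ccontr)
    assume p: "\<not> lookup m p \<le> 1"
    then have pm: "p \<in> keys m" by (simp add: in_keys_iff)
    show False
    proof (rule nob[THEN notE], rule cone_filling[OF gsub_ideal_mod z(1) m pm])
      fix S assume S: "S \<subseteq> keys m" "p \<notin> S" "card S = i" "m - sqm S \<in> ideal_exps V E a (j - int i)"
      have fin: "finite S" using S(1) by (rule finite_subset_keys)
      have "keys (m - sqm (insert p S)) = keys (m - sqm S)"
        using fin S(2) p by (auto simp: in_keys_iff lookup_minus lookup_sqm split: if_splits)
      then show "m - sqm (insert p S) \<in> ideal_exps V E a (j - int (Suc i))"
        using S pm m fin mon_degree_diff_sqm[of S m] mon_degree_diff_sqm[of "insert p S" m]
        by (auto simp: ideal_exps_def)
    qed
  qed
  define W where "W = keys m"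
  have mW: "m = sqm W" using sqm_keys[of m] sq by (simp add: W_def)
  have finW: "finite W" by (simp add: W_def)
  have keys_diff: "keys (m - sqm S) = W - S" if "S \<subseteq> W" for S
    using that finW by (simp add: mW sqm_diff)
  define c where "c = cf z a m"
  have "c \<noteq> (\<lambda>_. 0)"
  proof
    assume "c = (\<lambda>_. 0)"
    then have "cf z a m = (\<lambda>_. 0)" by (simp add: c_def)
    then have "filling (ideal_exps V E) i j z a m (\<lambda>_. 0)"
      by (simp add: filling_def kd_def)
    with nob show False by blast
  qed
  then obtain S0 where S0: "c S0 \<noteq> 0" by auto
  have nz: "S \<subseteq> W \<and> card S = i \<and> m - sqm S \<in> ideal_exps V E a (j - int i)" if "c S \<noteq> 0" for S
    using cf_neq_0_kchains[OF zc(1), of a m S] that by (simp add: c_def W_def)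
  have a0: "a = 0" using nz[OF S0] by (simp add: ideal_exps_def)
  have deg: "int (card W) = j"
    using nz[OF S0] mon_degree_diff_sqm[of S0 m] finW by (auto simp: ideal_exps_def mW)
  have "sqf_chain E W i c"
    unfolding sqf_chain_def
  proof (intro allI impI)
    fix S assume "c S \<noteq> 0"
    from nz[OF this] keys_diff[of S]
    show "S \<subseteq> W \<and> card S = i \<and> (\<exists>A\<in>E. A \<subseteq> W - S)"
      by (simp add: ideal_exps_def)
  qed
  moreover have "kd\<^sub>1 W s c = 0"
  proof
    fix S
    show "kd\<^sub>1 W s c S = 0 S"
    proof (cases "S \<subseteq> W")
      case True
      have "cf (kd V s vX z) a m S = 0" unfolding zc(2) by (simp add: cf_def)
      then show ?thesis
        using cf_kd[OF m, of S z a] True by (simp only: W_def c_def zero_fun_apply)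
    qed (simp add: kd_def)
  qed
  moreover have "\<not> (\<exists>b. sqf_chain E W (Suc i) b \<and> kd\<^sub>1 W s b = c)"
  proof
    assume "\<exists>b. sqf_chain E W (Suc i) b \<and> kd\<^sub>1 W s b = c"
    then obtain b where b: "sqf_chain E W (Suc i) b" "kd\<^sub>1 W s b = c" by blast
    have "S \<subseteq> keys m \<and> card S = Suc i \<and> m - sqm S \<in> ideal_exps V E a (j - int (Suc i))"
      if "b S \<noteq> 0" for S
    proof -
      have S: "S \<subseteq> W" "card S = Suc i" "\<exists>A\<in>E. A \<subseteq> W - S" using b(1) that by (auto simp: sqf_chain_def)
      then show ?thesis
        using mon_degree_diff_sqm[of S m] deg m keys_diff[of S] finW
        by (auto simp: ideal_exps_def a0 simp flip: W_def) (auto simp: mW)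
    qed
    then have "filling (ideal_exps V E) i j z a m b"
      using b(2) unfolding filling_def c_def W_def by (intro conjI allI impI) simp_all
    with nob show False by blast
  qed
  ultimately have "sqf_hnz TYPE('k) s E W i" by (auto simp: sqf_hnz_def)
  then show "\<exists>W\<subseteq>V. int (card W) = j \<and> sqf_hnz TYPE('k) s E W i"
    using deg m by (auto simp: W_def)
next
  assume "\<exists>W\<subseteq>V. int (card W) = j \<and> sqf_hnz TYPE('k) s E W i"
  then obtain W and c :: "'v set \<Rightarrow> 'k" where W: "W \<subseteq> V" "int (card W) = j"
    and c: "sqf_chain E W i c" "kd\<^sub>1 W s c = 0"
      "\<not> (\<exists>b. sqf_chain E W (Suc i) b \<and> kd\<^sub>1 W s b = c)"
    by (auto simp: sqf_hnz_def)
  have finW: "finite W" using W(1) finite_V finite_subset by blast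
  have keysW: "keys (sqm W) = W" using finW by simp
  have mV: "keys (sqm W) \<subseteq> V" using W finW by simp
  \<comment> \<open>Homogenisation of \<open>c\<close>: the coefficient at \<open>S\<close> is
    multiplied by the monomial of \<open>W - S\<close>, so that everything lies in multidegree
    \<open>W\<close>.\<close>
  define z where "z S a = (if a = (0::nat) \<and> S \<subseteq> W then single (sqm W - sqm S) (c S) else 0)" for S a
  have cfz: "cf z a m S = (if a = 0 \<and> m = sqm W then c S else 0)" for a m S
  proof (cases "a = 0 \<and> S \<subseteq> keys m \<and> S \<subseteq> W")
    case True
    have "m = sqm W" if "sqm W - sqm S = m - sqm S"
      using that True sqm_diff_add[of S m] sqm_diff_add[of S "sqm W"] finW by simp
    then show ?thesis using True by (auto simp: cf_def z_def lookup_single when_def)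
  next
    case False
    have "c S = 0" if "\<not> S \<subseteq> W" using c(1) that by (auto simp: sqf_chain_def)
    then show ?thesis using False finW by (auto simp: cf_def z_def)
  qed
  have zc: "z \<in> kchains (ideal_mod E) i j"
  proof (rule kchainsI)
    fix S assume S: "S \<subseteq> V" "card S = i"
    show "z S \<in> ideal_mod E (j - int i)"
      unfolding mono_mod_def mem_Collect_eq
    proof (intro allI subsetI)
      fix a n assume n: "n \<in> keys (z S a)"
      then have S': "a = 0" "S \<subseteq> W" "n = sqm W - sqm S" "c S \<noteq> 0" by (auto simp: z_def split: if_splits)
      moreover have "finite S" using S'(2) finW finite_subset by blast
      ultimately show "n \<in> ideal_exps V E a (j - int i)"
        using c(1) W finW S by (auto simp: ideal_exps_def sqf_chain_def sqm_diff card_Diff_subset card_mono of_nat_diff)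
    qed
  next
    fix S assume S: "\<not> (S \<subseteq> V \<and> card S = i)"
    have "c S = 0" using c(1) S W(1) unfolding sqf_chain_def by blast
    then show "z S = 0" by (simp add: z_def fun_eq_iff)
  qed
  have "kd V s vX z = 0"
  proof (rule chain_eqI)
    show "\<And>S. \<not> S \<subseteq> V \<Longrightarrow> kd V s vX z S = 0 S" by (simp add: kd_def)
    show "keys (kd V s vX z S a) \<subseteq> {m. keys m \<subseteq> V}" for S a
    proof (cases i)
      case 0
      then have "z \<in> kcycles (ideal_mod E) 0 j" using zc by (simp add: kcycles_0)
      then show ?thesis by (simp add: kcycles_def)
    next
      case (Suc i')
      then show ?thesis
        using kchains_keys[OF kd_kchains[OF gsub_ideal_mod, of z E i' j] ideal_exps_V] zc by simp
    qed
    show "keys ((0 :: 'v set \<Rightarrow> nat \<Rightarrow> ('v, 'k) mpoly) S a) \<subseteq> {m. keys m \<subseteq> V}" for S a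
      by simp
    fix a S and m :: "'v \<Rightarrow>\<^sub>0 nat" assume m: "keys m \<subseteq> V" "S \<subseteq> keys m"
    have "cf z a m = (if a = 0 \<and> m = sqm W then c else (\<lambda>_. 0))" using cfz by auto
    moreover have "kd\<^sub>1 W s (\<lambda>_. 0 :: 'k) S = 0" for W S by (simp add: kd_def)
    ultimately show "cf (kd V s vX z) a m S = cf 0 a m S"
      using c(2) keysW unfolding cf_kd[OF m] by (auto simp: cf_def)
  qed
  then have "z \<in> kcycles (ideal_mod E) i j" using zc by (simp add: kcycles_def)
  moreover have "z \<notin> kbounds (ideal_mod E) i j"
  proof
    assume "z \<in> kbounds (ideal_mod E) i j"
    then obtain y where y: "y \<in> kchains (ideal_mod E) (Suc i) j" "kd V s vX y = z" by (auto simp: kbounds_def)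
    define b where "b = cf y 0 (sqm W)"
    have "sqf_chain E W (Suc i) b"
      unfolding sqf_chain_def
    proof (intro allI impI)
      fix S assume "b S \<noteq> 0"
      from cf_neq_0_kchains[OF y(1) this[unfolded b_def]]
      show "S \<subseteq> W \<and> card S = Suc i \<and> (\<exists>A\<in>E. A \<subseteq> W - S)"
        using keysW finW by (auto simp: ideal_exps_def sqm_diff)
    qed
    moreover have "kd\<^sub>1 W s b = c"
    proof
      fix S
      show "kd\<^sub>1 W s b S = c S"
      proof (cases "S \<subseteq> W")
        case True
        then have "kd\<^sub>1 W s b S = cf z 0 (sqm W) S"
          using cf_kd[OF mV, of S y 0] unfolding keysW y(2) b_def by simp
        then show ?thesis by (simp add: cfz)
      next
        case False
        then have "c S = 0" using c(1) by (auto simp: sqf_chain_def)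
        then show ?thesis using False by (simp add: kd_def)
      qed
    qed
    ultimately show False using c(3) by blast
  qed
  ultimately show "\<not> kcycles (ideal_mod E) i j \<subseteq> kbounds (ideal_mod E) i j" by blast
qed

end

section \<open>The polynomial ring\<close>

lemma prod_var: "finite A \<Longrightarrow> (\<Prod>x\<in>A. var x :: ('v, 'k::field) mpoly) = single (sqm A) 1"
  by (induction A rule: finite_induct) (simp_all add: sqm_def var_def mult_single)

text \<open>The right side is itself an ideal and contains the generators; conversely each monomial
  in it is a multiple of a generator. Membership is thereby a condition on supports, which is what
  the multidegree splitting needs.\<close>

lemma genideal_sqfree:
  fixes E :: "'v set set"
  assumes V: "finite V" and E: "\<And>A. A \<in> E \<Longrightarrow> A \<subseteq> V"
  shows "Idl\<^bsub>poly_ring V\<^esub> {\<Prod>x\<in>A. var x | A. A \<in> E} =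
    {p :: ('v, 'k::field) mpoly. \<forall>m\<in>keys p. keys m \<subseteq> V \<and> (\<exists>A\<in>E. A \<subseteq> keys m)}"
    (is "?I = ?J")
proof -
  have finE: "finite A" if "A \<in> E" for A using finite_subset[OF E[OF that] V] .
  interpret R: cring "poly_ring V :: ('v, 'k) mpoly ring" by (rule cring_poly_ring)
  have gen_carrier: "{\<Prod>x\<in>A. var x | A. A \<in> E} \<subseteq> carrier (poly_ring V :: ('v, 'k) mpoly ring)"
    using finE by (auto simp: prod_var carrier_poly_ring dest: subsetD[OF E])
  interpret I: ideal ?I "poly_ring V :: ('v, 'k) mpoly ring"
    by (rule R.genideal_ideal[OF gen_carrier])
  have J: "ideal ?J (poly_ring V)"
  proof (rule idealI)
    show "ring (poly_ring V :: ('v, 'k) mpoly ring)" by (rule R.ring_axioms)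
    show "subgroup ?J (add_monoid (poly_ring V :: ('v, 'k) mpoly ring))"
    proof
      show "?J \<subseteq> carrier (add_monoid (poly_ring V))" by (auto simp: carrier_poly_ring)
      show "p \<otimes>\<^bsub>add_monoid (poly_ring V)\<^esub> q \<in> ?J" if "p \<in> ?J" "q \<in> ?J" for p q :: "('v, 'k) mpoly"
        using that Poly_Mapping.keys_add[of p q] by auto
      show "\<one>\<^bsub>add_monoid (poly_ring V)\<^esub> \<in> ?J" by simp
      fix p :: "('v, 'k) mpoly" assume p: "p \<in> ?J"
      have "\<ominus>\<^bsub>poly_ring V\<^esub> p = - p"
        by (rule R.minus_equality) (use p in \<open>auto simp: carrier_poly_ring\<close>)
      then show "inv\<^bsub>add_monoid (poly_ring V)\<^esub> p \<in> ?J" using p by (simp add: a_inv_def)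
    qed
    fix p q :: "('v, 'k) mpoly" assume p: "p \<in> ?J" and q: "q \<in> carrier (poly_ring V)"
    have *: "q * p \<in> ?J"
    proof (intro CollectI ballI)
      fix m assume "m \<in> keys (q * p)"
      then obtain a b where ab: "m = a + b" "a \<in> keys q" "b \<in> keys p"
        using keys_mult[of q p] by blast
      have "keys a \<subseteq> V" using q ab(2) unfolding carrier_poly_ring by blast
      moreover have "keys b \<subseteq> V \<and> (\<exists>A\<in>E. A \<subseteq> keys b)" using p ab(3) by blast
      ultimately show "keys m \<subseteq> V \<and> (\<exists>A\<in>E. A \<subseteq> keys m)"
        unfolding ab(1) keys_add_nat by blast
    qed
    show "q \<otimes>\<^bsub>poly_ring V\<^esub> p \<in> ?J" using * by simp
    show "p \<otimes>\<^bsub>poly_ring V\<^esub> q \<in> ?J" using * by (simp add: mult.commute)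
  qed
  have "?I \<subseteq> ?J"
    by (rule R.genideal_minimal[OF J]) (use finE in \<open>auto simp: prod_var dest: subsetD[OF E]\<close>)
  moreover have "?J \<subseteq> ?I"
  proof
    fix p assume p: "p \<in> ?J"
    have mono: "single m c \<in> ?I" if m: "m \<in> keys p" for m c
    proof -
      obtain A where A: "A \<in> E" "A \<subseteq> keys m" "keys m \<subseteq> V" using p m by blast
      have "(\<Prod>x\<in>A. var x :: ('v, 'k) mpoly) \<in> ?I"
        by (rule subsetD[OF R.genideal_self[OF gen_carrier]]) (use A(1) in blast)
      moreover have "single (m - sqm A) c \<in> carrier (poly_ring V :: ('v, 'k) mpoly ring)"
      proof -
        have "keys (m - sqm A) \<subseteq> keys m" by (auto simp: in_keys_iff lookup_minus)
        then show ?thesis using A(3) by (auto simp: carrier_poly_ring)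
      qed
      ultimately have "single (m - sqm A) c * (\<Prod>x\<in>A. var x) \<in> ?I"
        by (rule I.I_l_closed[unfolded poly_ring_simps(1)])
      then show ?thesis using A finE by (simp add: prod_var mult_single sqm_diff_add)
    qed
    have "(\<Sum>m\<in>D. single m (lookup p m)) \<in> ?I"
      if "finite D" "D \<subseteq> keys p" for D
      using that
    proof (induction D rule: finite_induct)
      case empty
      show ?case using I.zero_closed by simp
    next
      case (insert m D)
      then show ?case using I.a_closed[OF mono[of m]] by auto
    qed
    from this[OF finite_keys order_refl] show "p \<in> ?I" by (subst poly_mapping_expand)
  qed
  ultimately show ?thesis by blast
qed

text \<open>The squarefree case with singletons as generators. Minimality of a resolution thereby
  means that the matrices have no constant terms.\<close>

lemma irrelevant_ideal_eq:
  fixes V :: "'v set"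
  assumes "finite V"
  shows "irrelevant_ideal V = {p :: ('v, 'k::field) mpoly. p \<in> carrier (poly_ring V) \<and> lookup p 0 = 0}"
proof -
  have "(var ` V :: ('v, 'k) mpoly set) = {\<Prod>x\<in>A. var x | A. A \<in> (\<lambda>x. {x}) ` V}"
    (is "_ = ?G")
  proof -
    have "?G = (\<lambda>A. \<Prod>x\<in>A. var x) ` (\<lambda>x. {x}) ` V" by blast
    also have "\<dots> = var ` V" by (simp add: image_image)
    finally show ?thesis by simp
  qed
  then have "(irrelevant_ideal V :: ('v, 'k) mpoly set) =
    {p. \<forall>m\<in>keys p. keys m \<subseteq> V \<and> (\<exists>A\<in>(\<lambda>x. {x}) ` V. A \<subseteq> keys m)}"
    unfolding irrelevant_ideal_def by (simp only:) (rule genideal_sqfree, use assms in auto)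
  also have "\<dots> = {p. \<forall>m\<in>keys p. keys m \<subseteq> V \<and> m \<noteq> 0}"
  proof -
    have "(\<exists>A\<in>(\<lambda>x. {x}) ` V. A \<subseteq> keys m) \<longleftrightarrow> m \<noteq> 0"
      if "keys m \<subseteq> V" for m :: "'v \<Rightarrow>\<^sub>0 nat"
    proof -
      have "(\<exists>A\<in>(\<lambda>x. {x}) ` V. A \<subseteq> keys m) \<longleftrightarrow> keys m \<noteq> {}"
        using that by blast
      then show ?thesis by simp
    qed
    then show ?thesis by blast
  qed
  also have "\<dots> = {p. p \<in> carrier (poly_ring V) \<and> lookup p 0 = 0}"
    by (auto simp: carrier_poly_ring in_keys_iff)
  finally show ?thesis .
qed

lemma lookup_mult_0:
  fixes p q :: "('v, 'k::field) mpoly"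
  shows "lookup (p * q) 0 = lookup p 0 * lookup q 0"
proof -
  have *: "lookup (single m c * q) 0
      = (if m = 0 then c * lookup q 0 else 0)" for m c
  proof (cases "m = 0")
    case False
    have "0 \<notin> keys (single m c * q)"
    proof
      assume "0 \<in> keys (single m c * q)"
      then obtain l where "0 = m + l" using keys_monomial_mult by blast
      then have "keys (m + l) = {}" by (metis keys_zero)
      then show False using False by (simp add: keys_add_nat)
    qed
    then show ?thesis using False by (simp add: in_keys_iff)
  qed (simp add: lookup_const_mult)
  have "lookup (p * q) 0 = (\<Sum>m\<in>keys p.
      if m = 0 then lookup p m * lookup q 0 else 0)"
    by (subst poly_mapping_expand[of p]) (simp add: sum_distrib_right lookup_sum * )
  then show ?thesis by (auto simp: in_keys_iff)
qed

lemma poly_ring_closed: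
  fixes p q :: "('v, 'k::field) mpoly"
  assumes "p \<in> carrier (poly_ring V)" "q \<in> carrier (poly_ring V)"
  shows "p + q \<in> carrier (poly_ring V)" "p * q \<in> carrier (poly_ring V)"
proof -
  interpret R: cring "poly_ring V :: ('v, 'k) mpoly ring" by (rule cring_poly_ring)
  show "p + q \<in> carrier (poly_ring V)" "p * q \<in> carrier (poly_ring V)"
    using R.add.m_closed[OF assms] R.m_closed[OF assms] by simp_all
qed

lemma poly_ring_consts [simp]:
  "0 \<in> carrier (poly_ring V)" "1 \<in> carrier (poly_ring V)"
  "single 0 c \<in> carrier (poly_ring V)"
  by (simp_all add: carrier_poly_ring)

lemma poly_ring_uminus [simp]: "- p \<in> carrier (poly_ring V) \<longleftrightarrow> p \<in> carrier (poly_ring V)"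
  by (simp add: carrier_poly_ring)

lemma poly_ring_sum:
  fixes f :: "'a \<Rightarrow> ('v, 'k::field) mpoly"
  assumes "\<And>x. x \<in> A \<Longrightarrow> f x \<in> carrier (poly_ring V)"
  shows "sum f A \<in> carrier (poly_ring V)"
  using assms by (induction A rule: infinite_finite_induct) (simp_all add: poly_ring_closed)

section \<open>Homogeneous components\<close>

definition hc :: "int \<Rightarrow> ('v, 'k::field) mpoly \<Rightarrow> ('v, 'k) mpoly" where
  "hc d p = (\<Sum>m | m \<in> keys p \<and> int (mon_degree m) = d. single m (lookup p m))"

lemma lookup_hc:
  "lookup (hc d p) n = (if int (mon_degree n) = d then lookup p n else 0)"
  by (auto simp: hc_def lookup_sum lookup_single when_def in_keys_iff)

lemma keys_hc: "keys (hc d p) = {m \<in> keys p. int (mon_degree m) = d}"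
  by (auto simp: in_keys_iff lookup_hc split: if_splits)

lemma hc_add: "hc d (p + q) = hc d p + hc d q"
  by (rule poly_mapping_eqI) (simp add: lookup_hc lookup_add)

lemma hc_0 [simp]: "hc d 0 = 0"
  by (rule poly_mapping_eqI) (simp add: lookup_hc)

lemma hc_sum: "hc d (sum f A) = (\<Sum>x\<in>A. hc d (f x))"
  by (induction A rule: infinite_finite_induct) (simp_all add: hc_add)

lemma hc_homogeneous: "homogeneous d p \<Longrightarrow> hc d p = p"
  by (rule poly_mapping_eqI) (auto simp: lookup_hc homogeneous_def in_keys_iff)

lemma homogeneous_0_const:
  assumes "homogeneous 0 p"
  shows "p = single 0 (lookup p 0)"
proof (rule poly_mapping_eqI)
  fix m
  have "m = 0" if "m \<in> keys p"
  proof -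
    have "mon_degree m = 0" using assms that by (simp add: homogeneous_def)
    then have "lookup m x = 0" for x by (auto simp: mon_degree_def in_keys_iff)
    then show ?thesis by (intro poly_mapping_eqI) simp
  qed
  then show "lookup p m = lookup (single 0 (lookup p 0)) m"
    by (auto simp: lookup_single when_def in_keys_iff)
qed

lemma hc_monomial_mult:
  "hc d (single m c * p) = single m c * hc (d - int (mon_degree m)) p"
proof (rule poly_mapping_eqI)
  fix n
  show "lookup (hc d (single m c * p)) n =
    lookup (single m c * hc (d - int (mon_degree m)) p) n"
  proof (cases "\<exists>l. n = m + l")
    case True
    then obtain l where "n = m + l" by blast
    then show ?thesis by (auto simp: lookup_hc lookup_monomial_mult mon_degree_add)
  next
    case False
    then have "n \<notin> keys (single m c * q)" for q :: "('a, 'b) mpoly"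
      using keys_monomial_mult[of m c q] by blast
    then show ?thesis by (simp add: lookup_hc in_keys_iff)
  qed
qed

lemma hc_mult:
  assumes "homogeneous e p"
  shows "hc d (p * q) = p * hc (d - e) q"
proof -
  have "hc d (p * q) = (\<Sum>m\<in>keys p. hc d (single m (lookup p m) * q))"
    by (subst poly_mapping_expand[of p]) (simp add: sum_distrib_right hc_sum)
  also have "\<dots> = (\<Sum>m\<in>keys p. single m (lookup p m) * hc (d - e) q)"
    by (intro sum.cong refl) (use assms in \<open>simp add: hc_monomial_mult homogeneous_def\<close>)
  also have "\<dots> = p * hc (d - e) q"
    by (subst (3) poly_mapping_expand[of p]) (simp add: sum_distrib_right)
  finally show ?thesis .
qed

section \<open>Graded free modules and degree-preserving matrices\<close>

definition fmod :: "'v set \<Rightarrow> nat \<Rightarrow> (nat \<Rightarrow> ('v, 'k::field) mpoly) set" where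
  "fmod V n = {v. \<forall>a. if a < n then v a \<in> carrier (poly_ring V) else v a = 0}"

definition hcv :: "int list \<Rightarrow> int \<Rightarrow> (nat \<Rightarrow> ('v, 'k::field) mpoly) \<Rightarrow> nat \<Rightarrow> ('v, 'k) mpoly" where
  "hcv sh j v = (\<lambda>a. if a < length sh then hc (j - sh ! a) (v a) else 0)"

definition mact :: "('v, 'k::field) mpoly mat \<Rightarrow> (nat \<Rightarrow> ('v, 'k) mpoly) \<Rightarrow> nat \<Rightarrow> ('v, 'k) mpoly" where
  "mact A v = (\<lambda>a. if a < dim_row A then \<Sum>b<dim_col A. A $$ (a, b) * v b else 0)"

definition gmat :: "'v set \<Rightarrow> int list \<Rightarrow> int list \<Rightarrow> ('v, 'k::field) mpoly mat \<Rightarrow> bool" where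
  "gmat V sh sh' A \<longleftrightarrow> A \<in> carrier_mat (length sh) (length sh') \<and>
     (\<forall>a<length sh. \<forall>b<length sh'. A $$ (a, b) \<in> carrier (poly_ring V) \<and>
        homogeneous (sh' ! b - sh ! a) (A $$ (a, b)))"

lemma fmod_add: "v \<in> fmod V n \<Longrightarrow> w \<in> fmod V n \<Longrightarrow> v + w \<in> fmod V n"
  by (auto simp: fmod_def poly_ring_closed)

lemma fmod_0: "0 \<in> fmod V n"
  by (simp add: fmod_def)

lemma fmod_sum: "(\<And>x. x \<in> D \<Longrightarrow> f x \<in> fmod V n) \<Longrightarrow> sum f D \<in> fmod V n"
proof (induction D rule: infinite_finite_induct)
  case (insert x D)
  then show ?case using fmod_add[of "f x" V n "sum f D"] by (simp only: sum.insert insertI1 insertI2 not_False_eq_True)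
qed (simp_all only: sum.infinite sum.empty fmod_0 not_False_eq_True)

lemma free_mod_subset_fmod: "mono_mod (free_exps V sh) j \<subseteq> fmod V (length sh)"
  by (auto simp: mono_mod_def free_exps_def fmod_def carrier_poly_ring in_keys_iff subset_iff
      intro!: poly_mapping_eqI) metis

lemma free_mod_iff: "v \<in> mono_mod (free_exps V sh) j \<longleftrightarrow>
    v \<in> fmod V (length sh) \<and> (\<forall>a<length sh. homogeneous (j - sh ! a) (v a))"
proof
  assume v: "v \<in> mono_mod (free_exps V sh) j"
  then show "v \<in> fmod V (length sh) \<and> (\<forall>a<length sh. homogeneous (j - sh ! a) (v a))"
    using free_mod_subset_fmod[of V sh j] by (auto simp: mono_mod_def free_exps_def homogeneous_def subset_iff)
next
  assume v: "v \<in> fmod V (length sh) \<and> (\<forall>a<length sh. homogeneous (j - sh ! a) (v a))"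
  have "keys (v a) \<subseteq> free_exps V sh a j" for a
  proof (cases "a < length sh")
    case True
    then have "v a \<in> carrier (poly_ring V)" "homogeneous (j - sh ! a) (v a)"
      using v by (auto simp: fmod_def)
    then show ?thesis using True by (auto simp: free_exps_def homogeneous_def carrier_poly_ring)
  next
    case False
    then have "v a = 0" using v by (auto simp: fmod_def)
    then show ?thesis by simp
  qed
  then show "v \<in> mono_mod (free_exps V sh) j" by (simp add: mono_mod_def)
qed

lemma hcv_free_mod:
  assumes "v \<in> fmod V (length sh)"
  shows "hcv sh j v \<in> mono_mod (free_exps V sh) j"
proof -
  have "v a \<in> carrier (poly_ring V)" if "a < length sh" for a using assms that by (auto simp: fmod_def)
  then show ?thesis
    by (auto simp: free_mod_iff fmod_def hcv_def carrier_poly_ring keys_hc homogeneous_def)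
qed

lemma hcv_id: "v \<in> mono_mod (free_exps V sh) j \<Longrightarrow> hcv sh j v = v"
  by (auto simp: free_mod_iff fmod_def hcv_def hc_homogeneous fun_eq_iff)

lemma sum_fun_apply: "(sum f A) x = (\<Sum>a\<in>A. f a x)"
  by (induction A rule: infinite_finite_induct) auto

lemma hcv_decompose:
  assumes v: "v \<in> fmod V (length sh)"
  obtains J where "finite J" "v = (\<Sum>j\<in>J. hcv sh j v)"
proof
  define J where "J = (\<Union>a<length sh. (\<lambda>m. int (mon_degree m) + sh ! a) ` keys (v a))"
  show fin: "finite J" by (simp add: J_def)
  show "v = (\<Sum>j\<in>J. hcv sh j v)"
  proof (intro ext poly_mapping_eqI)
    fix a m
    show "lookup (v a) m = lookup ((\<Sum>j\<in>J. hcv sh j v) a) m"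
    proof (cases "a < length sh")
      case True
      have "lookup ((\<Sum>j\<in>J. hcv sh j v) a) m =
          (\<Sum>j\<in>J. if j = int (mon_degree m) + sh ! a then lookup (v a) m else 0)"
        using True by (auto simp: sum_fun_apply hcv_def lookup_sum lookup_hc intro!: sum.cong)
      also have "\<dots> = lookup (v a) m"
      proof (cases "m \<in> keys (v a)")
        case m: True
        then have "int (mon_degree m) + sh ! a \<in> J" using True by (auto simp: J_def)
        then show ?thesis using fin by simp
      qed (auto simp: in_keys_iff intro: sum.neutral)
      finally show ?thesis by simp
    next
      case False
      then show ?thesis using v by (simp add: fmod_def sum_fun_apply hcv_def)
    qed
  qed
qed

lemma mact_add: "mact A (v + w) = mact A v + mact A w"
  by (simp add: mact_def fun_eq_iff distrib_left sum.distrib)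

lemma mact_0: "mact A 0 = 0"
  by (simp add: mact_def fun_eq_iff)

lemma mact_sum: "mact A (sum f D) = (\<Sum>x\<in>D. mact A (f x))"
  by (induction D rule: infinite_finite_induct)
    (simp_all only: sum.infinite sum.empty sum.insert mact_add mact_0 not_False_eq_True)

lemma mact_vX: "mact A (vX x v) = vX x (mact A v)"
  by (auto simp: mact_def vX_def fun_eq_iff sum_distrib_left intro!: sum.cong)

lemma mact_vsc: "mact A (vsc c v) = vsc c (mact A v)"
  by (auto simp: mact_def vsc_def fun_eq_iff sum_distrib_left intro!: sum.cong)

lemma mact_fmod:
  assumes "gmat V sh sh' A" "v \<in> fmod V (length sh')"
  shows "mact A v \<in> fmod V (length sh)"
  using assms unfolding gmat_def mact_def fmod_def
  by (auto intro!: poly_ring_sum poly_ring_closed)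

lemma hcv_mact:
  assumes "gmat V sh sh' A"
  shows "hcv sh j (mact A v) = mact A (hcv sh' j v)"
proof (rule ext)
  fix a
  have d: "dim_row A = length sh" "dim_col A = length sh'" using assms by (auto simp: gmat_def)
  show "hcv sh j (mact A v) a = mact A (hcv sh' j v) a"
  proof (cases "a < length sh")
    case True
    have "hcv sh j (mact A v) a = (\<Sum>b<length sh'. hc (j - sh ! a) (A $$ (a, b) * v b))"
      using True d by (simp add: hcv_def mact_def hc_sum)
    also have "\<dots> = (\<Sum>b<length sh'. A $$ (a, b) * hc (j - sh' ! b) (v b))"
    proof (intro sum.cong refl)
      fix b assume "b \<in> {..<length sh'}"
      then have "homogeneous (sh' ! b - sh ! a) (A $$ (a, b))" using assms True by (auto simp: gmat_def)
      from hc_mult[OF this, of "j - sh ! a" "v b"]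
      show "hc (j - sh ! a) (A $$ (a, b) * v b) = A $$ (a, b) * hc (j - sh' ! b) (v b)" by simp
    qed
    finally show ?thesis using True d by (simp add: hcv_def mact_def)
  qed (simp add: hcv_def mact_def d)
qed

lemma mact_free_mod:
  assumes A: "gmat V sh sh' A" and v: "v \<in> mono_mod (free_exps V sh') j"
  shows "mact A v \<in> mono_mod (free_exps V sh) j"
proof -
  have "mact A v = hcv sh j (mact A v)" using hcv_mact[OF A, of j v] hcv_id[OF v] by simp
  then show ?thesis
    using hcv_free_mod[OF mact_fmod[OF A]] v free_mod_subset_fmod by (metis subsetD)
qed

text \<open>Resolutions are defined by exactness on whole modules, Koszul homology by single
  degrees. Both sides here are stable under homogeneous components and each element is a finite sum
  of its components, so equality may be tested degree by degree.\<close>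

lemma graded_image_iff:
  fixes A :: "('v, 'k::field) mpoly mat"
  assumes A: "gmat V sh sh' A"
    and U: "U \<subseteq> fmod V (length sh)" "0 \<in> U" "\<And>u v. u \<in> U \<Longrightarrow> v \<in> U \<Longrightarrow> u + v \<in> U"
      "\<And>u j. u \<in> U \<Longrightarrow> hcv sh j u \<in> U"
  shows "U = mact A ` fmod V (length sh') \<longleftrightarrow>
    (\<forall>j. U \<inter> mono_mod (free_exps V sh) j = mact A ` mono_mod (free_exps V sh') j)"
proof
  assume UA: "U = mact A ` fmod V (length sh')"
  show "\<forall>j. U \<inter> mono_mod (free_exps V sh) j = mact A ` mono_mod (free_exps V sh') j"
  proof (intro allI subset_antisym subsetI)
    fix j v assume v: "v \<in> U \<inter> mono_mod (free_exps V sh) j"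
    then obtain w where w: "w \<in> fmod V (length sh')" "v = mact A w" using UA by blast
    have "v = mact A (hcv sh' j w)" using v hcv_id w(2) hcv_mact[OF A] by (metis IntD2)
    then show "v \<in> mact A ` mono_mod (free_exps V sh') j" using hcv_free_mod[OF w(1)] by blast
  next
    fix j v assume "v \<in> mact A ` mono_mod (free_exps V sh') j"
    then show "v \<in> U \<inter> mono_mod (free_exps V sh) j"
      using mact_free_mod[OF A] free_mod_subset_fmod UA by blast
  qed
next
  assume *: "\<forall>j. U \<inter> mono_mod (free_exps V sh) j = mact A ` mono_mod (free_exps V sh') j"
  show "U = mact A ` fmod V (length sh')"
  proof (intro subset_antisym subsetI)
    fix v assume v: "v \<in> U"
    then have vf: "v \<in> fmod V (length sh)" using U(1) by blast
    obtain J where J: "finite J" "v = (\<Sum>j\<in>J. hcv sh j v)" using hcv_decompose[OF vf] .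
    have "\<exists>w\<in>mono_mod (free_exps V sh') j. hcv sh j v = mact A w" for j
      using * U(4)[OF v] hcv_free_mod[OF vf] by blast
    then obtain w where w: "\<And>j. w j \<in> mono_mod (free_exps V sh') j" "\<And>j. hcv sh j v = mact A (w j)" by metis
    have "v = mact A (\<Sum>j\<in>J. w j)" using J(2) w(2) by (simp add: mact_sum)
    moreover have "(\<Sum>j\<in>J. w j) \<in> fmod V (length sh')"
      using w(1) free_mod_subset_fmod by (intro fmod_sum) blast
    ultimately show "v \<in> mact A ` fmod V (length sh')" by blast
  next
    fix v assume "v \<in> mact A ` fmod V (length sh')"
    then obtain w where w: "w \<in> fmod V (length sh')" "v = mact A w" by blast
    obtain J where J: "finite J" "w = (\<Sum>j\<in>J. hcv sh' j w)" using hcv_decompose[OF w(1)] .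
    have "mact A (hcv sh' j w) \<in> U" for j using * hcv_free_mod[OF w(1)] by blast
    with J(1) have "(\<Sum>j\<in>J. mact A (hcv sh' j w)) \<in> U"
    proof (induction J rule: finite_induct)
      case empty
      show ?case using U(2) by (simp only: sum.empty)
    next
      case (insert j J)
      then show ?case using U(3) by (simp only: sum.insert not_False_eq_True)
    qed
    moreover have "v = (\<Sum>j\<in>J. mact A (hcv sh' j w))"
      using arg_cong[OF J(2), of "mact A"] unfolding w(2) mact_sum .
    ultimately show "v \<in> U" by simp
  qed
qed

section \<open>Ranks of free modules from Koszul homology\<close>

lemma card_le_of_linear_independence:
  fixes u :: "'b \<Rightarrow> nat \<Rightarrow> 'k::field"
  assumes B: "finite B" and B': "finite B'"
    and supp: "\<And>b a. b \<in> B \<Longrightarrow> a \<notin> B' \<Longrightarrow> u b a = 0"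
    and indep: "\<And>c. (\<And>a. (\<Sum>b\<in>B. c b * u b a) = 0) \<Longrightarrow> \<forall>b\<in>B. c b = 0"
  shows "card B \<le> card B'"
proof -
  let ?sc = "\<lambda>(c::'k) (f::nat \<Rightarrow> 'k) i. c * f i"
  interpret vs: vector_space ?sc
    by unfold_locales (simp_all add: fun_eq_iff algebra_simps)
  \<comment> \<open>The library notion of independence concerns sets; two equal members of the
    family would satisfy the relation with coefficients 1 and -1.\<close>
  have inj: "inj_on u B"
  proof (rule inj_onI, rule ccontr)
    fix b b' assume b: "b \<in> B" "b' \<in> B" "u b = u b'" "b \<noteq> b'"
    let ?c = "\<lambda>x. if x = b then 1 else if x = b' then - 1 else 0 :: 'k"
    have "(\<Sum>x\<in>B. ?c x * u x a) = 0" for a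
    proof -
      have "(\<Sum>x\<in>B. ?c x * u x a) = (\<Sum>x\<in>{b, b'}. ?c x * u x a)"
        using b B by (intro sum.mono_neutral_right) auto
      then show ?thesis using b by simp
    qed
    from indep[OF this] b(1) show False by auto
  qed
  have "vs.independent (u ` B)"
  proof
    assume "vs.dependent (u ` B)"
    then obtain c where c: "\<exists>v\<in>u ` B. c v \<noteq> 0" "(\<Sum>v\<in>u ` B. ?sc (c v) v) = 0"
      using vs.dependent_finite[of "u ` B"] B by auto
    have "(\<Sum>b\<in>B. c (u b) * u b a) = 0" for a
    proof -
      have "(\<Sum>v\<in>u ` B. ?sc (c v) v) a = (\<Sum>b\<in>B. c (u b) * u b a)"
        by (simp add: sum_fun_apply sum.reindex[OF inj])
      then show ?thesis using c(2) by simp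
    qed
    from indep[of "\<lambda>b. c (u b)", OF this] c(1) show False by auto
  qed
  moreover have "u ` B \<subseteq> vs.span ((\<lambda>a i. if i = a then 1 else 0) ` B')"
  proof
    fix v assume "v \<in> u ` B"
    then obtain b where b: "b \<in> B" "v = u b" by blast
    have "v = (\<Sum>a\<in>B'. ?sc (v a) (\<lambda>i. if i = a then 1 else 0))"
    proof
      fix i
      have "(\<Sum>a\<in>B'. ?sc (v a) (\<lambda>i. if i = a then 1 else 0)) i = (\<Sum>a\<in>B'. if i = a then v a else 0)"
        by (auto simp: sum_fun_apply intro!: sum.cong)
      then show "v i = (\<Sum>a\<in>B'. ?sc (v a) (\<lambda>i. if i = a then 1 else 0)) i"
        using B' supp[OF b(1), of i] b(2) by simp
    qed
    also have "\<dots> \<in> vs.span ((\<lambda>a i. if i = a then 1 else 0) ` B')"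
      by (intro vs.span_sum vs.span_scale vs.span_base) auto
    finally show "v \<in> vs.span ((\<lambda>a i. if i = a then 1 else 0) ` B')" .
  qed
  ultimately have "card (u ` B) \<le> card ((\<lambda>a i. if i = a then 1 else 0 :: 'k) ` B')"
    using vs.independent_span_bound B' by blast
  also have "\<dots> \<le> card B'" by (rule card_image_le[OF B'])
  finally show ?thesis using card_image[OF inj] by simp
qed

lemma count_list_eq_card: "count_list xs y = card {b. b < length xs \<and> xs ! b = y}"
  by (simp add: count_list_eq_length_filter length_filter_conv_card eq_commute)

context poly_koszul
begin

text \<open>The free module has no Koszul homology except its constants in homological degree 0, and
  \<open>K\<close> contains no constants. This supplies the hypothesis \<open>minimal\<close> of the
  dimension shift.\<close>

lemma no_const_exact:
  assumes K: "\<And>j. K j \<subseteq> free_mod sh j" "\<And>j v a. v \<in> K j \<Longrightarrow> lookup (v a) 0 = 0"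
  shows "kcycles K i j \<subseteq> kbounds (free_mod sh) i j"
proof
  fix z assume z: "z \<in> kcycles K i j"
  then have zc: "z \<in> kchains K i j" by (simp add: kcycles_def)
  have "z \<in> kchains (free_mod sh) i j"
    using kchainsD[OF zc] K(1) by (intro kchainsI) blast+
  then have "z \<in> kcycles (free_mod sh) i j" using z by (simp add: kcycles_def)
  moreover have "lookup (z {} a) 0 = 0" if "i = 0" for a
    using kchainsD(1)[OF zc, of "{}"] K(2) that by simp
  ultimately show "z \<in> kbounds (free_mod sh) i j" by (intro free_mod_exact) auto
qed

lemma free_mod_const:
  assumes "v \<in> free_mod sh j" "lookup (v a) 0 \<noteq> 0"
  shows "a < length sh" "sh ! a = j"
proof -
  have "0 \<in> keys (v a)" using assms(2) by (simp add: in_keys_iff)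
  then have "0 \<in> free_exps V sh a j" using assms(1) unfolding mono_mod_def by blast
  then show "a < length sh" "sh ! a = j" by (auto simp: free_exps_def)
qed

text \<open>Boundaries are combinations of variables, so H_0 of a free module is its reduction
  modulo the irrelevant ideal, read off from constant terms.\<close>

lemma kbounds_free_mod_0:
  assumes z: "z \<in> kcycles (free_mod sh) 0 j"
  shows "z \<in> kbounds (free_mod sh) 0 j \<longleftrightarrow> (\<forall>a. lookup (z {} a) 0 = 0)"
proof
  assume "z \<in> kbounds (free_mod sh) 0 j"
  then obtain y where "z = kd V s vX y" by (auto simp: kbounds_def)
  then have "z {} a = (\<Sum>x\<in>V. sg (s x {}) (var x * y {x} a))" for a
    by (auto simp: kd_def sum_fun_apply sg_def vX_def intro!: sum.cong)
  then show "\<forall>a. lookup (z {} a) 0 = 0"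
    by (simp add: lookup_sum lookup_sg lookup_var_mult)
next
  assume "\<forall>a. lookup (z {} a) 0 = 0"
  then show "z \<in> kbounds (free_mod sh) 0 j" by (intro free_mod_exact[OF z]) simp
qed

lemma unit_chain:
  assumes "b < length sh" "sh ! b = j"
  shows "(\<lambda>S a. if S = {} \<and> a = b then 1 else 0) \<in> kcycles (free_mod sh) 0 j"
  unfolding kcycles_0
proof (rule kchainsI)
  fix S :: "'v set"
  have "keys (if S = {} \<and> a = b then 1 else 0 :: ('v, 'k) mpoly) \<subseteq> free_exps V sh a j" for a
    using assms by (simp add: free_exps_def)
  then show "(\<lambda>a. if S = {} \<and> a = b then 1 else 0) \<in> free_mod sh (j - int 0)"
    by (simp add: mono_mod_def)
next
  fix S assume "\<not> (S \<subseteq> V \<and> card S = 0)"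
  then have "S \<noteq> {}" by auto
  then show "(\<lambda>a. if S = {} \<and> a = b then 1 else 0) = 0" by (simp add: fun_eq_iff)
qed

text \<open>Send the basis elements of degree \<open>j\<close> through the relation and take
  constant terms. A linear relation among these makes the combined image a boundary, hence also the
  same combination of basis elements, whose constant terms are the coefficients.\<close>

lemma rank_free_mod_le:
  assumes "kh_iso (free_mod sh) 0 (free_mod sh') 0 j"
  shows "count_list sh j \<le> count_list sh' j"
proof -
  obtain \<rho> where
    r1: "\<forall>z z'. \<rho> z z' \<longrightarrow> z \<in> kcycles (free_mod sh) 0 j \<and> z' \<in> kcycles (free_mod sh') 0 j \<and>
        (z \<in> kbounds (free_mod sh) 0 j \<longleftrightarrow> z' \<in> kbounds (free_mod sh') 0 j)" and
    r2: "\<forall>z\<in>kcycles (free_mod sh) 0 j. \<exists>z'. \<rho> z z'" and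
    r3: "\<forall>z z' w w'. \<rho> z z' \<longrightarrow> \<rho> w w' \<longrightarrow> \<rho> (z + w) (z' + w')" and
    r4: "\<forall>c z z'. \<rho> z z' \<longrightarrow> \<rho> (csc c z) (csc c z')"
    using assms unfolding subq_iso_def by blast
  note \<rho> = r1[rule_format] r2[rule_format] r3[rule_format] r4[rule_format]
  define B where "B = {b. b < length sh \<and> sh ! b = j}"
  define e :: "nat \<Rightarrow> 'v set \<Rightarrow> nat \<Rightarrow> ('v, 'k) mpoly" where
    "e b = (\<lambda>S a. if S = {} \<and> a = b then 1 else 0)" for b
  have e: "e b \<in> kcycles (free_mod sh) 0 j" if "b \<in> B" for b
    using unit_chain[of b sh j] that by (simp add: B_def e_def)
  define z where "z b = (SOME z'. \<rho> (e b) z')" for b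
  have z: "\<rho> (e b) (z b)" if "b \<in> B" for b
    using someI_ex[OF \<rho>(2)[OF e[OF that]]] unfolding z_def .
  \<comment> \<open>The relation need not pair 0 with 0 by definition, but scaling any pair by the
    scalar 0 does so.\<close>
  have zero: "\<rho> 0 0"
  proof -
    have "0 \<in> kcycles (free_mod sh) 0 j"
      unfolding kcycles_0 by (rule kchainsI) (simp_all add: gsubD(1)[OF gsub_free_mod])
    then obtain z' where "\<rho> 0 z'" using \<rho>(2) by blast
    then have "\<rho> (csc 0 0) (csc 0 z')" by (rule \<rho>(4))
    then show ?thesis by (simp add: csc_def vsc_def zero_fun_def)
  qed
  have "card B \<le> card {b. b < length sh' \<and> sh' ! b = j}"
  proof (rule card_le_of_linear_independence[where u = "\<lambda>b a. lookup (z b {} a) 0"])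
    show "finite B" "finite {b. b < length sh' \<and> sh' ! b = j}" by (auto simp: B_def)
    fix b a assume "b \<in> B" and a: "a \<notin> {b. b < length sh' \<and> sh' ! b = j}"
    then have "z b \<in> kchains (free_mod sh') 0 j" using \<rho>(1) z by (metis kcycles_0)
    then have "z b {} \<in> free_mod sh' j" using kchainsD(1)[of "z b" "free_mod sh'" 0 j "{}"] by simp
    then show "lookup (z b {} a) 0 = 0" using a free_mod_const by blast
  next
    fix c assume c: "\<And>a. (\<Sum>b\<in>B. c b * lookup (z b {} a) 0) = 0"
    have "finite B" by (simp add: B_def)
    have sum: "\<rho> (\<Sum>b\<in>D. csc (c b) (e b)) (\<Sum>b\<in>D. csc (c b) (z b))" if "D \<subseteq> B" for D
      using finite_subset[OF that \<open>finite B\<close>] that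
    proof (induction D rule: finite_induct)
      case empty
      show ?case using zero by (simp only: sum.empty)
    next
      case (insert b D)
      then have "\<rho> (csc (c b) (e b)) (csc (c b) (z b))" using z \<rho>(4) by blast
      from \<rho>(3)[OF this] insert show ?case by (simp only: sum.insert not_False_eq_True insert_subset)
    qed
    note r = \<rho>(1)[OF sum[OF order_refl]]
    have k: "lookup ((\<Sum>b\<in>B. csc (c b) (w b)) {} a) 0 = (\<Sum>b\<in>B. c b * lookup (w b {} a) 0)"
      for a and w :: "nat \<Rightarrow> 'v set \<Rightarrow> nat \<Rightarrow> ('v, 'k) mpoly"
      by (simp add: sum_fun_apply csc_def vsc_def lookup_sum lookup_const_mult)
    have "(\<Sum>b\<in>B. csc (c b) (z b)) \<in> kbounds (free_mod sh') 0 j"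
      using r c by (subst kbounds_free_mod_0) (simp_all add: k)
    then have "(\<Sum>b\<in>B. csc (c b) (e b)) \<in> kbounds (free_mod sh) 0 j" using r by blast
    then have *: "(\<Sum>b\<in>B. c b * lookup (e b {} a) 0) = 0" for a
      using kbounds_free_mod_0[of "\<Sum>b\<in>B. csc (c b) (e b)" sh j] r by (simp add: k)
    show "\<forall>b\<in>B. c b = 0"
    proof
      fix a assume "a \<in> B"
      have "(\<Sum>b\<in>B. c b * lookup (e b {} a) 0) = (\<Sum>b\<in>B. if b = a then c b else 0)"
        by (intro sum.cong) (auto simp: e_def lookup_one)
      then show "c a = 0" using *[of a] \<open>a \<in> B\<close> \<open>finite B\<close> by simp
    qed
  qed
  then show ?thesis by (simp add: count_list_eq_card B_def)
qed

lemma rank_free_mod_eq: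
  "kh_iso (free_mod sh) 0 (free_mod sh') 0 j \<Longrightarrow> count_list sh j = count_list sh' j"
  using rank_free_mod_le subq_iso_sym by (blast intro: antisym)

lemma free_mod_nonexact: "\<not> kcycles (free_mod sh) 0 j \<subseteq> kbounds (free_mod sh) 0 j \<longleftrightarrow> count_list sh j \<noteq> 0"
proof
  assume "\<not> kcycles (free_mod sh) 0 j \<subseteq> kbounds (free_mod sh) 0 j"
  then obtain z where z: "z \<in> kcycles (free_mod sh) 0 j" "z \<notin> kbounds (free_mod sh) 0 j" by blast
  then obtain a where a: "lookup (z {} a) 0 \<noteq> 0"
    using kbounds_free_mod_0[OF z(1)] by blast
  have "z {} \<in> free_mod sh j"
    using z(1) kchainsD(1)[of z "free_mod sh" 0 j "{}"] by (simp add: kcycles_0)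
  then have "a < length sh" "sh ! a = j" using free_mod_const a by blast+
  then show "count_list sh j \<noteq> 0" by (auto simp: count_list_0_iff)
next
  assume "count_list sh j \<noteq> 0"
  then obtain b where b: "b < length sh" "sh ! b = j" by (auto simp: count_list_0_iff in_set_conv_nth)
  have "(\<lambda>S a. if S = {} \<and> a = b then 1 else 0) \<notin> kbounds (free_mod sh) 0 j"
    using kbounds_free_mod_0[OF unit_chain[OF b]] by (auto simp: lookup_one)
  with unit_chain[OF b] show "\<not> kcycles (free_mod sh) 0 j \<subseteq> kbounds (free_mod sh) 0 j" by blast
qed

section \<open>Minimal resolutions in each degree\<close>

text \<open>Indexed so that the \<open>i\<close>-th module is the one covered by F_{i+1}. At 0 it is
  the ideal, the kernel of R -> R/I.\<close>

fun syz :: "'v set set \<Rightarrow> (nat \<Rightarrow> int list) \<Rightarrow> (nat \<Rightarrow> ('v, 'k) mpoly mat) \<Rightarrow> nat \<Rightarrow> int \<Rightarrow>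
    (nat \<Rightarrow> ('v, 'k) mpoly) set" where
  "syz E sh A 0 j = ideal_mod E j"
| "syz E sh A (Suc i) j = {v \<in> free_mod (sh (Suc i)) j. mact (A i) v = 0}"

text \<open>Minimal resolutions in degreewise form, normalised by F_0 = R with its generator in
  degree 0.\<close>

definition gres :: "'v set set \<Rightarrow> (nat \<Rightarrow> int list) \<Rightarrow> (nat \<Rightarrow> ('v, 'k) mpoly mat) \<Rightarrow> bool" where
  "gres E sh A \<longleftrightarrow> sh 0 = [0] \<and> (\<forall>i. gmat V (sh i) (sh (Suc i)) (A i) \<and>
     (\<forall>a<length (sh i). \<forall>b<length (sh (Suc i)). lookup (A i $$ (a, b)) 0 = 0) \<and>
     (\<forall>j. syz E sh A i j = mact (A i) ` free_mod (sh (Suc i)) j))"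

lemma mact_no_const:
  assumes "gmat V sh sh' A" "\<forall>a<length sh. \<forall>b<length sh'. lookup (A $$ (a, b)) 0 = 0"
  shows "lookup (mact A v a) 0 = 0"
  using assms by (auto simp: mact_def gmat_def lookup_sum lookup_mult_0)

text \<open>The cover identifies H_0(F_{i+1}) with H_0 of the \<open>i\<close>-th syzygy module, and
  \<open>i\<close> dimension shifts carry this to H_i of the ideal, which does not depend on the
  resolution.\<close>

lemma gres_iso:
  assumes "gres E sh A"
  shows "kh_iso (free_mod (sh (Suc i))) 0 (ideal_mod E) i j"
proof -
  have A: "gmat V (sh i) (sh (Suc i)) (A i)"
    "\<forall>a<length (sh i). \<forall>b<length (sh (Suc i)). lookup (A i $$ (a, b)) 0 = 0"
    "\<And>j. syz E sh A i j = mact (A i) ` free_mod (sh (Suc i)) j" for i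
    using assms by (auto simp: gres_def)
  have K: "\<And>j. syz E sh A (Suc i) j = {v \<in> free_mod (sh (Suc i)) j. mact (A i) v = 0}" for i by simp
  have min: "kcycles (syz E sh A (Suc i)) k j \<subseteq> kbounds (free_mod (sh (Suc i))) k j" for i k
  proof (rule no_const_exact)
    show "syz E sh A (Suc i) j \<subseteq> free_mod (sh (Suc i)) j" for j by auto
    fix j v a assume "v \<in> syz E sh A (Suc i) j"
    then obtain w where "v = mact (A (Suc i)) w" using A(3)[of "Suc i" j] by blast
    then show "lookup (v a) 0 = 0" using mact_no_const[OF A(1,2)] by simp
  qed
  note shift = kh_iso_shift[OF gsub_free_mod mact_add mact_vX mact_vsc K A(3)]
  note cover = kh_iso_cover[OF gsub_free_mod mact_add mact_vX mact_vsc K A(3)]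
  have gs: "gsub (syz E sh A i)" for i
  proof (cases i)
    case 0
    have "syz E sh A 0 = ideal_mod E" by (rule ext) simp
    then show ?thesis using gsub_ideal_mod 0 by simp
  next
    case (Suc i')
    show ?thesis unfolding Suc
      by (rule gsub_K[OF gsub_free_mod mact_add mact_vX mact_vsc K A(3)])
  qed
  have "kh_iso (syz E sh A l) k (syz E sh A (l + k)) 0 j" for l k
  proof (induction k arbitrary: l)
    case 0
    show ?case using kh_iso_refl[OF gs] by simp
  next
    case (Suc k)
    have "kh_iso (syz E sh A l) (Suc k) (syz E sh A (Suc l)) k j"
      by (rule shift[OF _ min]) (use free_mod_exact in auto)
    from subq_iso_trans[OF this Suc.IH[of "Suc l"]] show ?case by simp
  qed
  from this[of 0 i] have 1: "kh_iso (syz E sh A 0) i (syz E sh A i) 0 j" by simp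
  have 2: "kh_iso (free_mod (sh (Suc i))) 0 (syz E sh A i) 0 j"
    by (rule cover[OF min])
  have "syz E sh A 0 = ideal_mod E" by (rule ext) simp
  with subq_iso_trans[OF 2 subq_iso_sym[OF 1]] show ?thesis by simp
qed

end

section \<open>Resolutions by matrices\<close>

definition tov :: "('v, 'k::field) mpoly vec \<Rightarrow> nat \<Rightarrow> ('v, 'k) mpoly" where
  "tov v = (\<lambda>a. if a < dim_vec v then v $ a else 0)"

lemma tov_inj: "inj_on tov (carrier_vec n)"
proof (rule inj_onI)
  fix v w :: "('v, 'k::field) mpoly vec"
  assume "v \<in> carrier_vec n" "w \<in> carrier_vec n" "tov v = tov w"
  then show "v = w" by (intro eq_vecI) (auto simp: tov_def fun_eq_iff split: if_splits)
qed

lemma tov_fmod: "v \<in> free_module V n \<Longrightarrow> tov v \<in> fmod V n"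
  by (auto simp: free_module_def fmod_def tov_def)

lemma fmod_tov:
  assumes "f \<in> fmod V n"
  shows "vec n f \<in> free_module V n" "tov (vec n f) = f"
  using assms by (auto simp: free_module_def fmod_def tov_def fun_eq_iff)

lemma tov_image: "tov ` {v \<in> free_module V n. P (tov v)} = {v \<in> fmod V n. P v}"
proof (intro subset_antisym subsetI)
  fix f assume "f \<in> {v \<in> fmod V n. P v}"
  then show "f \<in> tov ` {v \<in> free_module V n. P (tov v)}"
    using fmod_tov[of f V n] by (intro image_eqI[of _ _ "vec n f"]) auto
qed (auto simp: tov_fmod)

lemma tov_mult:
  assumes "A \<in> carrier_mat n m" "v \<in> carrier_vec m"
  shows "tov (A *\<^sub>v v) = mact A (tov v)"
  using assms by (auto simp: tov_def mact_def scalar_prod_def fun_eq_iff lessThan_atLeast0 intro!: sum.cong)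

lemma tov_image_mult:
  assumes "A \<in> carrier_mat n m"
  shows "tov ` (*\<^sub>v) A ` free_module V m = mact A ` fmod V m"
proof -
  have "tov ` (*\<^sub>v) A ` free_module V m = mact A ` tov ` {v \<in> free_module V m. True}"
    unfolding image_image by (intro image_cong) (auto simp: free_module_def tov_mult[OF assms])
  then show ?thesis by (simp add: tov_image[of _ _ "\<lambda>_. True", simplified])
qed

lemma tov_eq_0: "w \<in> carrier_vec n \<Longrightarrow> tov w = 0 \<longleftrightarrow> w = 0\<^sub>v n"
  by (auto simp: tov_def fun_eq_iff intro!: eq_vecI split: if_splits)

text \<open>\<open>tov\<close> is injective on vectors of one fixed length, so exactness can be
  transported to the function representation.\<close>

lemma submodule_eq_iff:
  assumes B: "B \<in> carrier_mat n m" and P: "\<And>v. v \<in> free_module V n \<Longrightarrow> Q v \<longleftrightarrow> P (tov v)"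
  shows "{v \<in> free_module V n. Q v} = (*\<^sub>v) B ` free_module V m \<longleftrightarrow>
    {v \<in> fmod V n. P v} = mact B ` fmod V m"
proof -
  have "{v \<in> free_module V n. Q v} = {v \<in> free_module V n. P (tov v)}" using P by blast
  then have 1: "tov ` {v \<in> free_module V n. Q v} = {v \<in> fmod V n. P v}" by (simp only: tov_image)
  have 2: "{v \<in> free_module V n. Q v} \<subseteq> carrier_vec n" by (auto simp: free_module_def)
  have 3: "(*\<^sub>v) B ` free_module V m \<subseteq> carrier_vec n"
    using B by (auto simp: free_module_def)
  show ?thesis
    unfolding inj_on_image_eq_iff[OF tov_inj 2 3, symmetric] 1 tov_image_mult[OF B] ..
qed

definition sqf_ideal :: "'v set \<Rightarrow> 'v set set \<Rightarrow> ('v, 'k::field) mpoly set" where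
  "sqf_ideal V E = {p. \<forall>m\<in>keys p. keys m \<subseteq> V \<and> (\<exists>A\<in>E. A \<subseteq> keys m)}"

lemma sqf_ideal_add: "p \<in> sqf_ideal V E \<Longrightarrow> q \<in> sqf_ideal V E \<Longrightarrow> p + q \<in> sqf_ideal V E"
  using Poly_Mapping.keys_add[of p q] unfolding sqf_ideal_def by blast

lemma sqf_ideal_const: "p \<in> sqf_ideal V E \<Longrightarrow> {} \<notin> E \<Longrightarrow> lookup p 0 = 0"
proof (rule ccontr)
  assume p: "p \<in> sqf_ideal V E" and E: "{} \<notin> E" and c: "lookup p 0 \<noteq> 0"
  have "0 \<in> keys p" using c by (simp add: in_keys_iff)
  then have "\<exists>A\<in>E. A \<subseteq> keys (0 :: 'a \<Rightarrow>\<^sub>0 nat)"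
    using p unfolding sqf_ideal_def by blast
  with E show False by simp
qed

lemma sqf_ideal_const_mult:
  assumes "c \<noteq> (0::'k::field)"
  shows "single 0 c * p \<in> sqf_ideal V E \<longleftrightarrow> p \<in> sqf_ideal V E"
proof -
  have "keys (single 0 c * p) = keys p"
    using assms by (auto simp: in_keys_iff lookup_const_mult)
  then show ?thesis by (simp add: sqf_ideal_def)
qed

context poly_koszul
begin

lemma ideal_mod_eq: "{v \<in> fmod V 1. v 0 \<in> sqf_ideal V E} \<inter> free_mod [0] j = ideal_mod E j"
proof (intro subset_antisym subsetI)
  fix v assume v: "v \<in> {v \<in> fmod V 1. v 0 \<in> sqf_ideal V E} \<inter> free_mod [0] j"
  have "keys (v a) \<subseteq> ideal_exps V E a j" for a
  proof (cases "a = 0")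
    case True
    have "keys (v 0) \<subseteq> free_exps V [0] 0 j" using v by (auto simp: mono_mod_def)
    then show ?thesis using v True by (auto simp: sqf_ideal_def ideal_exps_def free_exps_def)
  next
    case False
    have "keys (v a) \<subseteq> free_exps V [0] a j" using v by (simp add: mono_mod_def)
    then show ?thesis using False by (auto simp: free_exps_def)
  qed
  then show "v \<in> ideal_mod E j" by (simp add: mono_mod_def)
next
  fix v assume v: "v \<in> ideal_mod E j"
  have k: "keys (v a) \<subseteq> ideal_exps V E a j" for a using v by (simp add: mono_mod_def)
  have "keys (v a) \<subseteq> free_exps V [0] a j" for a
    using k[of a] by (auto simp: ideal_exps_def free_exps_def)
  then have f: "v \<in> free_mod [0] j" by (simp add: mono_mod_def)
  then have "v \<in> fmod V 1" using free_mod_subset_fmod[of V "[0]" j] by auto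
  moreover have "v 0 \<in> sqf_ideal V E" using k[of 0] by (auto simp: sqf_ideal_def ideal_exps_def)
  ultimately show "v \<in> {v \<in> fmod V 1. v 0 \<in> sqf_ideal V E} \<inter> free_mod [0] j" using f by blast
qed

lemma exact_0_iff:
  assumes "gmat V [0] sh' B"
  shows "{v \<in> fmod V 1. v 0 \<in> sqf_ideal V E} = mact B ` fmod V (length sh') \<longleftrightarrow>
    (\<forall>j. ideal_mod E j = mact B ` free_mod sh' j)"
proof -
  let ?U = "{v \<in> fmod V 1. v 0 \<in> sqf_ideal V E}"
  have "?U = mact B ` fmod V (length sh') \<longleftrightarrow>
    (\<forall>j. ?U \<inter> free_mod [0] j = mact B ` free_mod sh' j)"
  proof (rule graded_image_iff[OF assms])
    show "?U \<subseteq> fmod V (length [0::int])" by auto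
    show "0 \<in> ?U" by (simp add: fmod_0 sqf_ideal_def)
    fix u v :: "nat \<Rightarrow> ('v, 'k) mpoly" and j
    assume u: "u \<in> ?U"
    show "u + v \<in> ?U" if "v \<in> ?U"
      using u that by (simp add: fmod_add sqf_ideal_add)
    have "hcv [0] j u \<in> fmod V (length [0::int])"
      using hcv_free_mod[of u V "[0]" j] u free_mod_subset_fmod[of V "[0]" j] by auto
    moreover have "hcv [0] j u 0 \<in> sqf_ideal V E" using u by (auto simp: hcv_def sqf_ideal_def keys_hc)
    ultimately show "hcv [0] j u \<in> ?U" by simp
  qed
  then show ?thesis by (simp only: ideal_mod_eq)
qed

lemma exact_Suc_iff:
  fixes A B :: "('v, 'k) mpoly mat"
  assumes A: "gmat V sh sh' A" and B: "gmat V sh' sh'' B"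
  shows "{v \<in> fmod V (length sh'). mact A v = 0} = mact B ` fmod V (length sh'') \<longleftrightarrow>
    (\<forall>j. {v \<in> free_mod sh' j. mact A v = 0} = mact B ` free_mod sh'' j)"
proof -
  let ?U = "{v \<in> fmod V (length sh'). mact A v = 0}"
  have "?U = mact B ` fmod V (length sh'') \<longleftrightarrow>
    (\<forall>j. ?U \<inter> free_mod sh' j = mact B ` free_mod sh'' j)"
  proof (rule graded_image_iff[OF B])
    show "?U \<subseteq> fmod V (length sh')" by auto
    show "0 \<in> ?U" by (simp add: fmod_0 mact_0)
    fix u v :: "nat \<Rightarrow> ('v, 'k) mpoly" and j
    assume u: "u \<in> ?U"
    show "u + v \<in> ?U" if "v \<in> ?U"
      using u that by (simp add: fmod_add mact_add)
    have "hcv sh' j u \<in> fmod V (length sh')"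
      using hcv_free_mod[of u V sh' j] u free_mod_subset_fmod[of V sh' j] by auto
    moreover have "mact A (hcv sh' j u) = 0"
      unfolding hcv_mact[OF A, symmetric] using u by (simp add: hcv_def fun_eq_iff)
    ultimately show "hcv sh' j u \<in> ?U" by simp
  qed
  moreover have "?U \<inter> free_mod sh' j = {v \<in> free_mod sh' j. mact A v = 0}" for j
    using free_mod_subset_fmod[of V sh' j] by blast
  ultimately show ?thesis by simp
qed

lemma gmat_carrier: "gmat V sh sh' A \<Longrightarrow> A \<in> carrier_mat (length sh) (length sh')"
  by (simp add: gmat_def)

lemma free_module_kernel:
  assumes A: "A \<in> carrier_mat k n" and v: "v \<in> free_module V n"
  shows "A *\<^sub>v v = 0\<^sub>v k \<longleftrightarrow> mact A (tov v) = 0"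
proof -
  have v': "v \<in> carrier_vec n" using v by (simp add: free_module_def)
  then have "A *\<^sub>v v \<in> carrier_vec k" using A by simp
  then show ?thesis using tov_eq_0 tov_mult[OF A v'] by metis
qed

lemma kernel_eq_iff:
  assumes A: "A \<in> carrier_mat k n" and B: "B \<in> carrier_mat n m"
  shows "{v \<in> free_module V n. A *\<^sub>v v = 0\<^sub>v k} = (*\<^sub>v) B ` free_module V m \<longleftrightarrow>
    {v \<in> fmod V n. mact A v = 0} = mact B ` fmod V m"
  by (rule submodule_eq_iff[where P = "\<lambda>f. mact A f = 0", OF B free_module_kernel[OF A]])

text \<open>The augmentation sends the single generator of F_0 to 1, so exactness at F_0 says that
  the image of the first matrix is the ideal.\<close>

lemma resolution_of_gres:
  assumes g: "gres E sh A" 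
  shows "minimal_graded_free_resolution V (sqf_ideal V E)
    \<lparr>res_shifts = sh, res_aug = vec 1 (\<lambda>_. 1), res_map = A\<rparr>"
proof -
  have sh0: "sh 0 = [0]" and G: "\<And>i. gmat V (sh i) (sh (Suc i)) (A i)"
    and c: "\<And>i a b. a < length (sh i) \<Longrightarrow> b < length (sh (Suc i)) \<Longrightarrow> lookup (A i $$ (a, b)) 0 = 0"
    and im: "\<And>i j. syz E sh A i j = mact (A i) ` free_mod (sh (Suc i)) j"
    using g by (auto simp: gres_def)
  have sp: "vec 1 (\<lambda>_. 1) \<bullet> v = v $ 0" if "v \<in> carrier_vec 1" for v :: "('v, 'k) mpoly vec"
    using that by (simp add: scalar_prod_def)
  have aug: "vec 1 (\<lambda>_. 1) \<in> free_module V (length (sh 0))"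
    by (simp add: free_module_def sh0)
  have surj: "\<exists>v\<in>free_module V (length (sh 0)). p - vec 1 (\<lambda>_. 1) \<bullet> v \<in> sqf_ideal V E"
    if "p \<in> carrier (poly_ring V)" for p :: "('v, 'k) mpoly"
  proof (rule bexI)
    have "vec 1 (\<lambda>_. 1) \<bullet> vec 1 (\<lambda>_. p) = p" by (subst sp) auto
    then show "p - vec 1 (\<lambda>_. 1) \<bullet> vec 1 (\<lambda>_. p) \<in> sqf_ideal V E" by (simp add: sqf_ideal_def)
    show "vec 1 (\<lambda>_. p) \<in> free_module V (length (sh 0))" using that by (simp add: sh0 free_module_def)
  qed
  have ex0: "{v \<in> free_module V (length (sh 0)). vec 1 (\<lambda>_. 1) \<bullet> v \<in> sqf_ideal V E} =
      (*\<^sub>v) (A 0) ` free_module V (length (sh 1))"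
  proof -
    have "{v \<in> free_module V 1. vec 1 (\<lambda>_. 1) \<bullet> v \<in> sqf_ideal V E} = (*\<^sub>v) (A 0) ` free_module V (length (sh 1)) \<longleftrightarrow>
      {v \<in> fmod V 1. v 0 \<in> sqf_ideal V E} = mact (A 0) ` fmod V (length (sh 1))"
    proof (rule submodule_eq_iff)
      show "A 0 \<in> carrier_mat 1 (length (sh 1))" using gmat_carrier[OF G[of 0]] by (simp add: sh0)
      fix v :: "('v, 'k) mpoly vec" assume v: "v \<in> free_module V 1"
      then have "v \<in> carrier_vec 1" by (simp add: free_module_def)
      from sp[OF this] this show "vec 1 (\<lambda>_. 1) \<bullet> v \<in> sqf_ideal V E \<longleftrightarrow> tov v 0 \<in> sqf_ideal V E"
        by (simp add: tov_def)
    qed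
    moreover have "{v \<in> fmod V 1. v 0 \<in> sqf_ideal V E} = mact (A 0) ` fmod V (length (sh 1))"
      using exact_0_iff[of "sh 1" "A 0" E] G[of 0] im[of 0] by (simp add: sh0)
    ultimately show ?thesis by (simp add: sh0)
  qed
  have ex: "{v \<in> free_module V (length (sh (Suc i))). A i *\<^sub>v v = 0\<^sub>v (length (sh i))} =
      (*\<^sub>v) (A (Suc i)) ` free_module V (length (sh (Suc (Suc i))))" for i
    using kernel_eq_iff[OF gmat_carrier[OF G[of i]] gmat_carrier[OF G[of "Suc i"]]]
      exact_Suc_iff[OF G[of i] G[of "Suc i"]] im[of "Suc i"] by simp
  show ?thesis
    unfolding minimal_graded_free_resolution_def graded_free_resolution_def
    using aug surj ex0 ex G c finite_V
    by (auto simp: gmat_def sh0 homogeneous_def irrelevant_ideal_eq)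
qed

lemma mult_vec_no_const:
  fixes A :: "('v, 'k) mpoly mat"
  assumes "A \<in> carrier_mat n m" "v \<in> carrier_vec m" "a < n"
    and "\<And>b. b < m \<Longrightarrow> lookup (A $$ (a, b)) 0 = 0"
  shows "lookup ((A *\<^sub>v v) $ a) 0 = 0"
  using assms by (simp add: scalar_prod_def lookup_sum lookup_mult_0)

text \<open>The definition allows any F_0 with any augmentation, so F_0 = R has to be derived. By
  minimality the kernel of the augmentation has no constant terms. As 1 is reached modulo a proper
  ideal (\<open>{} \<notin> E\<close>), some entry \<open>p $ b\<close> has a nonzero constant term
  and is therefore a scalar \<open>k\<close> of degree 0.\<close>

lemma gres_of_resolution:
  assumes F: "minimal_graded_free_resolution V (sqf_ideal V E :: ('v, 'k) mpoly set) F" and E: "{} \<notin> E"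
  shows "gres E (res_shifts F) (res_map F)"
proof -
  define sh A p where "sh = res_shifts F" and "A = res_map F" and "p = res_aug F"
  note defs = F[unfolded minimal_graded_free_resolution_def graded_free_resolution_def, folded sh_def A_def p_def]
  have p: "p \<in> free_module V (length (sh 0))"
      "\<And>b. b < length (sh 0) \<Longrightarrow> homogeneous (sh 0 ! b) (p $ b)"
    and G: "\<And>i. gmat V (sh i) (sh (Suc i)) (A i)"
    and surj: "\<And>q. q \<in> carrier (poly_ring V) \<Longrightarrow> \<exists>v\<in>free_module V (length (sh 0)). q - p \<bullet> v \<in> sqf_ideal V E"
    and ex0: "{v \<in> free_module V (length (sh 0)). p \<bullet> v \<in> sqf_ideal V E} = (*\<^sub>v) (A 0) ` free_module V (length (sh 1))"
    and ex: "\<And>i. {v \<in> free_module V (length (sh (Suc i))). A i *\<^sub>v v = 0\<^sub>v (length (sh i))} =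
      (*\<^sub>v) (A (Suc i)) ` free_module V (length (sh (Suc (Suc i))))"
    using defs by (auto simp: gmat_def)
  have c: "\<And>i a b. a < length (sh i) \<Longrightarrow> b < length (sh (Suc i)) \<Longrightarrow> lookup (A i $$ (a, b)) 0 = 0"
    using defs finite_V by (auto simp: irrelevant_ideal_eq)
  let ?n = "length (sh 0)"
  have dimp: "dim_vec p = ?n" using p(1) by (auto simp: free_module_def)
  have sp: "p \<bullet> v = (\<Sum>a<?n. p $ a * v $ a)" if "v \<in> carrier_vec ?n" for v
    using that by (simp add: scalar_prod_def lessThan_atLeast0)
  have ker: "lookup (v $ a) 0 = 0"
    if "v \<in> free_module V ?n" "p \<bullet> v \<in> sqf_ideal V E" "a < ?n" for v a
  proof -
    have "v \<in> (*\<^sub>v) (A 0) ` free_module V (length (sh 1))" using that ex0 by blast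
    then obtain w where "w \<in> free_module V (length (sh 1))" "v = A 0 *\<^sub>v w" by blast
    then show ?thesis
      using mult_vec_no_const[OF gmat_carrier[OF G[of 0]], of w a] that(3) c[of _ 0]
      by (simp add: free_module_def)
  qed
  obtain v where v: "v \<in> free_module V ?n" "1 - p \<bullet> v \<in> sqf_ideal V E" using surj[of 1] by auto
  have "lookup (1 - p \<bullet> v) 0 = 0" by (rule sqf_ideal_const[OF v(2) E])
  then have "(\<Sum>a<?n. lookup (p $ a) 0 * lookup (v $ a) 0) = 1"
    using v(1) by (simp add: sp free_module_def lookup_minus lookup_sum lookup_mult_0)
  then have "\<not> (\<forall>a\<in>{..<?n}. lookup (p $ a) 0 * lookup (v $ a) 0 = 0)"
    using sum.neutral[of "{..<?n}" "\<lambda>a. lookup (p $ a) 0 * lookup (v $ a) 0"] by auto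
  then obtain b where b: "b < ?n" "lookup (p $ b) 0 \<noteq> 0" by auto
  define k where "k = lookup (p $ b) 0"
  have "0 \<in> keys (p $ b)" using b(2) by (simp add: in_keys_iff)
  then have shb: "sh 0 ! b = 0" using p(2)[OF b(1)] by (force simp: homogeneous_def)
  have pb: "p $ b = single 0 k"
    using homogeneous_0_const[of "p $ b"] p(2)[OF b(1)] shb by (simp add: k_def)
  have "a = b" if a: "a < ?n" for a
  proof (rule ccontr)
    assume ab: "a \<noteq> b"
    \<comment> \<open>A second basis element \<open>a\<close> would give the kernel element e_a -
      k^{-1} p_a e_b, whose entry 1 at \<open>a\<close> contradicts minimality.\<close>
    define w where "w = vec ?n (\<lambda>i. if i = a then 1 else if i = b then - (single 0 (inverse k) * p $ a) else 0)"
    have w: "w \<in> free_module V ?n"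
      using p(1) a by (auto simp: free_module_def w_def intro!: poly_ring_closed)
    have "p \<bullet> w = (\<Sum>i\<in>{a, b}. p $ i * w $ i)"
      using w a b(1) by (simp add: sp free_module_def) (intro sum.mono_neutral_right, auto simp: w_def)
    also have "\<dots> = p $ a - (single 0 k * single 0 (inverse k)) * p $ a"
      using a b(1) ab by (simp add: w_def pb mult.assoc)
    also have "\<dots> = 0" using b(2) by (simp add: mult_single k_def)
    finally have "p \<bullet> w \<in> sqf_ideal V E" by (simp add: sqf_ideal_def)
    from ker[OF w this a] show False using a by (simp add: w_def lookup_one)
  qed
  then have n1: "?n = 1" using b(1) by (metis One_nat_def less_nat_zero_code less_one linorder_neqE_nat nat_neq_iff zero_less_Suc)
  then have b0: "b = 0" using b(1) by simp
  have sh0: "sh 0 = [0]" using n1 shb b0 by (cases "sh 0") auto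
  \<comment> \<open>The augmentation is now multiplication by the unit \<open>k\<close>, so its
    kernel is again the ideal.\<close>
  have "{v \<in> free_module V 1. p \<bullet> v \<in> sqf_ideal V E} = (*\<^sub>v) (A 0) ` free_module V (length (sh 1)) \<longleftrightarrow>
    {v \<in> fmod V 1. v 0 \<in> sqf_ideal V E} = mact (A 0) ` fmod V (length (sh 1))"
  proof (rule submodule_eq_iff)
    show "A 0 \<in> carrier_mat 1 (length (sh 1))" using gmat_carrier[OF G[of 0]] n1 by simp
    fix v :: "('v, 'k) mpoly vec" assume v: "v \<in> free_module V 1"
    then have "p \<bullet> v = single 0 k * v $ 0" using sp[of v] n1 pb b0 by (simp add: free_module_def)
    moreover have "dim_vec v = 1" using v by (auto simp: free_module_def)
    then have "tov v 0 = v $ 0" by (simp only: tov_def) simp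
    ultimately show "p \<bullet> v \<in> sqf_ideal V E \<longleftrightarrow> tov v 0 \<in> sqf_ideal V E"
      using b(2) by (simp add: sqf_ideal_const_mult k_def)
  qed
  then have e0: "ideal_mod E j = mact (A 0) ` free_mod (sh 1) j" for j
    using ex0 exact_0_iff[of "sh 1" "A 0" E] G[of 0] by (simp add: sh0)
  have e: "{v \<in> free_mod (sh (Suc i)) j. mact (A i) v = 0} = mact (A (Suc i)) ` free_mod (sh (Suc (Suc i))) j" for i j
    using kernel_eq_iff[OF gmat_carrier[OF G[of i]] gmat_carrier[OF G[of "Suc i"]]]
      exact_Suc_iff[OF G[of i] G[of "Suc i"]] ex[of i] by simp
  have "syz E sh A i j = mact (A i) ` free_mod (sh (Suc i)) j" for i j
    by (cases i) (use e0 e in simp_all)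
  then show ?thesis using sh0 G c by (simp add: gres_def sh_def A_def)
qed

end

section \<open>Existence of minimal resolutions\<close>

lemma finite_monomials_of_degree:
  assumes "finite V"
  shows "finite {m :: 'v \<Rightarrow>\<^sub>0 nat. keys m \<subseteq> V \<and> int (mon_degree m) = d}" (is "finite ?M")
proof (rule inj_on_finite)
  show "inj_on (\<lambda>m. restrict (lookup m) V) ?M"
  proof (rule inj_onI, rule poly_mapping_eqI)
    fix m n :: "'v \<Rightarrow>\<^sub>0 nat" and x
    assume mn: "m \<in> ?M" "n \<in> ?M" "restrict (lookup m) V = restrict (lookup n) V"
    show "lookup m x = lookup n x"
    proof (cases "x \<in> V")
      case True
      then show ?thesis using fun_cong[OF mn(3), of x] by simp
    next
      case False
      then have "x \<notin> keys m" "x \<notin> keys n" using mn by auto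
      then show ?thesis by (simp add: in_keys_iff)
    qed
  qed
  show "(\<lambda>m. restrict (lookup m) V) ` ?M \<subseteq> PiE V (\<lambda>_. {..nat d})"
  proof (intro image_subsetI restrict_PiE_iff[THEN iffD2] ballI)
    fix m x assume m: "m \<in> ?M" and x: "x \<in> V"
    have "lookup m x \<le> mon_degree m"
      using mon_degree_superset[OF assms, of m] m x assms
      by (auto intro: member_le_sum[of x V "lookup m"])
    then show "lookup m x \<in> {..nat d}" using m by auto
  qed
  show "finite (PiE V (\<lambda>_. {..nat d}))" using assms by (simp add: finite_PiE)
qed

context poly_koszul
begin

lemma gsub_monomial:
  assumes K: "gsub K" and v: "v \<in> K d" and m: "keys m \<subseteq> V"
  shows "(\<lambda>a. single m c * v a) \<in> K (d + int (mon_degree m))"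
  using m
proof (induction "mon_degree m" arbitrary: m)
  case 0
  have "lookup m x = 0" for x
  proof (rule ccontr)
    assume "lookup m x \<noteq> 0"
    then show False using 0(1) by (auto simp: mon_degree_def in_keys_iff)
  qed
  then have "m = 0" by (intro poly_mapping_eqI) simp
  then show ?case using gsubD(4)[OF K v, of c] by (simp add: vsc_def)
next
  case (Suc n)
  have "m \<noteq> 0" using Suc(2) by auto
  then obtain x where x: "x \<in> keys m" by (metis ex_in_conv keys_eq_empty)
  define l where "l = m - single x 1"
  have ml: "m = single x 1 + l"
    using x by (intro poly_mapping_eqI) (auto simp: l_def lookup_add lookup_minus lookup_single when_def in_keys_iff)
  have "mon_degree m = Suc (mon_degree l)" unfolding ml by (simp add: mon_degree_add)
  then have "n = mon_degree l" using Suc(2) by simp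
  moreover have "keys l \<subseteq> V" using Suc.prems unfolding ml keys_add_nat by simp
  ultimately have "(\<lambda>a. single l c * v a) \<in> K (d + int (mon_degree l))" by (rule Suc.hyps(1))
  from gsubD(5)[OF K this, of x]
  have "vX x (\<lambda>a. single l c * v a) \<in> K (d + int (mon_degree l) + 1)"
    using x Suc.prems by blast
  moreover have "vX x (\<lambda>a. single l c * v a) = (\<lambda>a. single m c * v a)"
    by (simp add: vX_def var_def ml mult_single flip: mult.assoc)
  moreover have "d + int (mon_degree l) + 1 = d + int (mon_degree m)" by (simp add: \<open>mon_degree m = Suc _\<close>)
  ultimately show ?case by simp
qed

lemma gsub_mult:
  assumes K: "gsub K" and v: "v \<in> K d" and p: "p \<in> carrier (poly_ring V)" "homogeneous (j - d) p"
  shows "(\<lambda>a. p * v a) \<in> K j"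
proof -
  have "(\<lambda>a. p * v a) = (\<Sum>m\<in>keys p. (\<lambda>a. single m (lookup p m) * v a))"
    by (rule ext, subst poly_mapping_expand[of p]) (simp add: sum_fun_apply sum_distrib_right)
  also have "\<dots> \<in> K j"
  proof (rule gsub_sum[OF K])
    fix m assume m: "m \<in> keys p"
    have "d + int (mon_degree m) = j" using p(2) m by (auto simp: homogeneous_def)
    then show "(\<lambda>a. single m (lookup p m) * v a) \<in> K j"
      using gsub_monomial[OF K v, of m "lookup p m"] p(1) m by (auto simp: carrier_poly_ring)
  qed
  finally show ?thesis .
qed

text \<open>Generators are pairs of a degree and an element, because the element alone does not
  determine its degree (0 lies in all of them).\<close>

definition coeffs_of_degree ::
    "(int \<times> (nat \<Rightarrow> ('v, 'k) mpoly)) set \<Rightarrow> int \<Rightarrow> (int \<times> (nat \<Rightarrow> ('v, 'k) mpoly) \<Rightarrow> ('v, 'k) mpoly) set" where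
  "coeffs_of_degree T j = {u. \<forall>t\<in>T. u t \<in> carrier (poly_ring V) \<and> homogeneous (j - fst t) (u t)}"

definition comb :: "(int \<times> (nat \<Rightarrow> ('v, 'k) mpoly)) set \<Rightarrow>
    (int \<times> (nat \<Rightarrow> ('v, 'k) mpoly) \<Rightarrow> ('v, 'k) mpoly) \<Rightarrow> nat \<Rightarrow> ('v, 'k) mpoly" where
  "comb T u = (\<lambda>a. \<Sum>t\<in>T. u t * snd t a)"

text \<open>One inclusion suffices here: for a graded submodule the other follows from closure under
  homogeneous multiples.\<close>

definition generates where
  "generates T K \<longleftrightarrow> finite T \<and> (\<forall>t\<in>T. snd t \<in> K (fst t)) \<and> (\<forall>j. K j \<subseteq> comb T ` coeffs_of_degree T j)"

lemma homogeneous_add: "homogeneous d p \<Longrightarrow> homogeneous d q \<Longrightarrow> homogeneous d (p + q)"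
  using Poly_Mapping.keys_add[of p q] unfolding homogeneous_def by blast

lemma homogeneous_minus: "homogeneous d p \<Longrightarrow> homogeneous d (- p)"
  by (simp add: homogeneous_def)

lemma homogeneous_mult:
  assumes "homogeneous d p" "homogeneous e q"
  shows "homogeneous (d + e) (p * q)"
  unfolding homogeneous_def
proof
  fix m assume "m \<in> keys (p * q)"
  then obtain a b where "m = a + b" "a \<in> keys p" "b \<in> keys q"
    using keys_mult[of p q] by blast
  then show "int (mon_degree m) = d + e" using assms by (auto simp: homogeneous_def mon_degree_add)
qed

lemma gsub_comb: "gsub (\<lambda>j. comb T ` coeffs_of_degree T j)"
  unfolding gsub_def
proof (intro allI conjI ballI; (elim imageE)?)
  fix j
  show "0 \<in> comb T ` coeffs_of_degree T j"
    by (intro image_eqI[of _ _ "\<lambda>_. 0"]) (auto simp: comb_def coeffs_of_degree_def homogeneous_def)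
  fix w u assume u: "w = comb T u" "u \<in> coeffs_of_degree T j"
  show "- w \<in> comb T ` coeffs_of_degree T j"
    using u by (intro image_eqI[of _ _ "\<lambda>t. - u t"])
      (auto simp: comb_def coeffs_of_degree_def homogeneous_minus sum_negf fun_eq_iff)
  show "vsc c w \<in> comb T ` coeffs_of_degree T j" for c
  proof (intro image_eqI[of _ _ "\<lambda>t. single 0 c * u t"])
    show "vsc c w = comb T (\<lambda>t. single 0 c * u t)"
      using u by (simp add: comb_def vsc_def fun_eq_iff sum_distrib_left mult.assoc)
    have "homogeneous 0 (single 0 c :: ('v, 'k) mpoly)" by (simp add: homogeneous_def)
    from homogeneous_mult[OF this] show "(\<lambda>t. single 0 c * u t) \<in> coeffs_of_degree T j"
      using u by (auto simp: coeffs_of_degree_def intro!: poly_ring_closed)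
  qed
  show "vX x w \<in> comb T ` coeffs_of_degree T (j + 1)" if x: "x \<in> V" for x
  proof (intro image_eqI[of _ _ "\<lambda>t. var x * u t"])
    show "vX x w = comb T (\<lambda>t. var x * u t)"
      using u by (simp add: comb_def vX_def fun_eq_iff sum_distrib_left mult.assoc)
    have "homogeneous 1 (var x :: ('v, 'k) mpoly)" by (simp add: homogeneous_def var_def)
    moreover have "(var x :: ('v, 'k) mpoly) \<in> carrier (poly_ring V)"
      using x by (simp add: carrier_poly_ring var_def)
    ultimately show "(\<lambda>t. var x * u t) \<in> coeffs_of_degree T (j + 1)"
      using u homogeneous_mult[of 1 "var x :: ('v, 'k) mpoly"]
      by (fastforce simp: coeffs_of_degree_def algebra_simps intro!: poly_ring_closed)
  qed
  fix w' u' assume u': "w' = comb T u'" "u' \<in> coeffs_of_degree T j"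
  show "w + w' \<in> comb T ` coeffs_of_degree T j"
  proof (intro image_eqI[of _ _ "\<lambda>t. u t + u' t"])
    show "w + w' = comb T (\<lambda>t. u t + u' t)"
      using u u' by (simp add: comb_def fun_eq_iff sum.distrib distrib_right)
    show "(\<lambda>t. u t + u' t) \<in> coeffs_of_degree T j"
      using u u' by (auto simp: coeffs_of_degree_def intro!: poly_ring_closed homogeneous_add)
  qed
qed

text \<open>Degree \<open>j\<close> of a free module is spanned by finitely many monomials, so
  \<open>K j\<close> is finite-dimensional. Spanning is expressed through graded submodules
  \<open>G\<close>, the form in which generation is tested.\<close>

lemma finite_span:
  assumes K: "gsub K" "K j \<subseteq> free_mod sh j"
  obtains X where "finite X" "X \<subseteq> K j"
    "\<And>G. gsub G \<Longrightarrow> X \<subseteq> G j \<Longrightarrow> K j \<subseteq> G j"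
proof -
  interpret vs: vector_space "vsc :: 'k \<Rightarrow> (nat \<Rightarrow> ('v, 'k) mpoly) \<Rightarrow> _"
  proof
    fix a b :: 'k and x y :: "nat \<Rightarrow> ('v, 'k) mpoly"
    show "vsc a (x + y) = vsc a x + vsc a y" by (simp add: vsc_def fun_eq_iff algebra_simps)
    show "vsc (a + b) x = vsc a x + vsc b x" by (simp add: vsc_def fun_eq_iff single_add algebra_simps)
    show "vsc a (vsc b x) = vsc (a * b) x" by (simp add: vsc_def fun_eq_iff mult_single flip: mult.assoc)
    show "vsc 1 x = x" by (simp add: vsc_def fun_eq_iff)
  qed
  define M where "M a = {m. keys m \<subseteq> V \<and> int (mon_degree m) = j - sh ! a}" for a
  define e :: "nat \<Rightarrow> ('v \<Rightarrow>\<^sub>0 nat) \<Rightarrow> nat \<Rightarrow> ('v, 'k) mpoly" where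
    "e a m = (\<lambda>i. if i = a then single m 1 else 0)" for a m
  define Y where "Y = (\<Union>a<length sh. e a ` M a)"
  have finM: "finite (M a)" for a unfolding M_def by (rule finite_monomials_of_degree[OF finite_V])
  have finY: "finite Y" using finM by (simp add: Y_def)
  have "free_mod sh j \<subseteq> vs.span Y"
  proof
    fix v assume v: "v \<in> free_mod sh j"
    have "v = (\<Sum>a<length sh. \<Sum>m\<in>M a. vsc (lookup (v a) m) (e a m))"
    proof (intro ext poly_mapping_eqI)
      fix i n
      have "lookup ((\<Sum>a<length sh. \<Sum>m\<in>M a. vsc (lookup (v a) m) (e a m)) i) n
          = (\<Sum>a<length sh. \<Sum>m\<in>M a. if i = a \<and> m = n then lookup (v i) n else 0)"
        by (auto simp: sum_fun_apply lookup_sum vsc_def e_def lookup_const_mult lookup_single when_def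
            intro!: sum.cong)
      also have "\<dots> = (\<Sum>a<length sh. if i = a \<and> n \<in> M i then lookup (v i) n else 0)"
      proof (intro sum.cong refl)
        fix a
        show "(\<Sum>m\<in>M a. if i = a \<and> m = n then lookup (v i) n else 0)
            = (if i = a \<and> n \<in> M i then lookup (v i) n else 0)"
          using finM[of a] by (cases "i = a") simp_all
      qed
      also have "\<dots> = (if i < length sh \<and> n \<in> M i then lookup (v i) n else 0)"
        by (cases "n \<in> M i") simp_all
      also have "\<dots> = lookup (v i) n"
        using v by (auto simp: mono_mod_def free_exps_def M_def in_keys_iff subset_iff)
      finally show "lookup (v i) n = lookup
          ((\<Sum>a<length sh. \<Sum>m\<in>M a. vsc (lookup (v a) m) (e a m)) i) n" by simp
    qed
    also have "\<dots> \<in> vs.span Y"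
      by (intro vs.span_sum vs.span_scale vs.span_base) (auto simp: Y_def)
    finally show "v \<in> vs.span Y" .
  qed
  with K(2) have KY: "K j \<subseteq> vs.span Y" by blast
  obtain X where X: "X \<subseteq> K j" "vs.independent X" "K j \<subseteq> vs.span X"
    using vs.maximal_independent_subset[of "K j"] by blast
  have "finite X" using vs.independent_span_bound[OF finY X(2)] X(1) KY by blast
  moreover have "K j \<subseteq> G j" if G: "gsub G" "X \<subseteq> G j" for G
  proof -
    have "vs.subspace (G j)" unfolding vs.subspace_def using gsubD[OF G(1)] by blast
    then show ?thesis using vs.span_minimal[OF G(2)] X(3) by blast
  qed
  ultimately show ?thesis using that X(1) by blast
qed

text \<open>Graded Nakayama argument in place of noetherianity. Where H_0(K) vanishes,
  \<open>K j\<close> consists of combinations of variables times \<open>K (j - 1)\<close>; new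
  generators are needed only in the finitely many other degrees. Induction on the degree starts from
  a degree where \<open>K\<close> is zero.\<close>

lemma generates_exists:
  assumes K: "gsub K" "\<And>j. K j \<subseteq> free_mod sh j"
    and fin: "finite {j. \<not> kcycles K 0 j \<subseteq> kbounds K 0 j}"
  shows "\<exists>T. generates T K"
proof -
  define D where "D = {j. \<not> kcycles K 0 j \<subseteq> kbounds K 0 j}"
  have "\<exists>X. finite X \<and> X \<subseteq> K j \<and> (\<forall>G. gsub G \<longrightarrow> X \<subseteq> G j \<longrightarrow> K j \<subseteq> G j)" for j
    using finite_span[OF K(1) K(2)[of j]] by metis
  then obtain X where X: "\<And>j. finite (X j)" "\<And>j. X j \<subseteq> K j"
    "\<And>j G. gsub G \<Longrightarrow> X j \<subseteq> G j \<Longrightarrow> K j \<subseteq> G j" by metis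
  define T where "T = Sigma D X"
  define G where "G = (\<lambda>j. comb T ` coeffs_of_degree T j)"
  have G: "gsub G" unfolding G_def by (rule gsub_comb)
  have finT: "finite T" using fin X(1) by (simp add: T_def D_def)
  have X_G: "X j \<subseteq> G j" if j: "j \<in> D" for j
  proof
    fix x assume x: "x \<in> X j"
    have t: "(j, x) \<in> T" using j x by (simp add: T_def)
    have "x = comb T (\<lambda>t. if t = (j, x) then 1 else 0)"
    proof
      fix a
      have "comb T (\<lambda>t. if t = (j, x) then 1 else 0) a = (\<Sum>t\<in>T. if t = (j, x) then x a else 0)"
        unfolding comb_def by (intro sum.cong) auto
      then show "x a = comb T (\<lambda>t. if t = (j, x) then 1 else 0) a" using t finT by simp
    qed
    moreover have "(\<lambda>t. if t = (j, x) then 1 else 0) \<in> coeffs_of_degree T j"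
      by (auto simp: coeffs_of_degree_def homogeneous_def)
    ultimately show "x \<in> G j" unfolding G_def by blast
  qed
  \<comment> \<open>A lower bound for all shifts; the extra 0 keeps the set nonempty.\<close>
  define j0 where "j0 = Min (insert 0 (set sh))"
  have below: "K j \<subseteq> {0}" if j: "j < j0" for j
  proof
    fix v assume v: "v \<in> K j"
    have "v a = 0" for a
    proof -
      have "keys (v a) \<subseteq> free_exps V sh a j"
        using v K(2) by (auto simp: mono_mod_def)
      also have "\<dots> = {}"
      proof -
        have "j0 \<le> sh ! a" if "a < length sh" using that by (simp add: j0_def)
        then show ?thesis using j by (force simp: free_exps_def)
      qed
      finally show ?thesis by simp
    qed
    then show "v \<in> {0}" by (simp add: fun_eq_iff)
  qed
  \<comment> \<open>The offset -1 puts the base case into a degree below all shifts, where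
    \<open>K\<close> is zero.\<close>
  have "K (j0 + int n - 1) \<subseteq> G (j0 + int n - 1)" for n
  proof (induction n)
    case 0
    have "K (j0 - 1) \<subseteq> {0}" by (rule below) simp
    then show ?case using gsubD(1)[OF G] by auto
  next
    case (Suc n)
    define j where "j = j0 + int (Suc n) - 1"
    have j1: "j - 1 = j0 + int n - 1" by (simp add: j_def)
    have "K j \<subseteq> G j"
    proof (cases "j \<in> D")
      case True
      then show ?thesis using X(3)[OF G X_G] by blast
    next
      case False
      show ?thesis
      proof
        fix v assume v: "v \<in> K j"
        \<comment> \<open>As a Koszul 0-chain \<open>v\<close> is a cycle, hence a boundary in this
          degree; evaluated at \<open>{}\<close>, this writes \<open>v\<close> with variables as
          coefficients.\<close>
        define z where "z S = (if S = {} then v else 0)" for S :: "'v set"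
        have "z \<in> kchains K 0 j"
        proof (rule kchainsI)
          fix S :: "'v set" assume "S \<subseteq> V" "card S = 0"
          then have "S = {}" using finite_subset[OF _ finite_V, of S] by simp
          then show "z S \<in> K (j - int 0)" using v by (simp add: z_def)
        next
          fix S :: "'v set" assume "\<not> (S \<subseteq> V \<and> card S = 0)"
          then show "z S = 0" by (auto simp: z_def)
        qed
        then have "z \<in> kbounds K 0 j" using False by (auto simp: D_def kcycles_0)
        then obtain y where y: "y \<in> kchains K (Suc 0) j" "kd V s vX y = z" by (auto simp: kbounds_def)
        have "v = (\<Sum>x\<in>V. sg (s x {}) (vX x (y {x})))"
          using fun_cong[OF y(2), of "{}"] by (simp add: z_def kd_def)
        also have "\<dots> \<in> G j"
        proof (intro gsub_sum[OF G] gsub_sg[OF G])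
          fix x assume x: "x \<in> V"
          have "y {x} \<in> K (j - 1)" using kchainsD(1)[OF y(1), of "{x}"] x by simp
          then have "y {x} \<in> G (j - 1)" using Suc.IH j1 by auto
          from gsubD(5)[OF G this x] show "vX x (y {x}) \<in> G j" by simp
        qed
        finally show "v \<in> G j" .
      qed
    qed
    then show ?case by (simp add: j_def)
  qed
  note ge = this
  have "K j \<subseteq> G j" for j
  proof (cases "j0 - 1 \<le> j")
    case True
    then show ?thesis using ge[of "nat (j - j0 + 1)"] by simp
  next
    case False
    have "K j \<subseteq> {0}" by (rule below) (use False in simp)
    then show ?thesis using gsubD(1)[OF G] by auto
  qed
  moreover have "\<forall>t\<in>T. snd t \<in> K (fst t)" using X(2) by (auto simp: T_def)
  ultimately have "generates T K" using finT unfolding generates_def G_def by blast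
  then show ?thesis by blast
qed

text \<open>
  A relation with a constant coefficient \<open>c \<noteq> 0\<close> makes the corresponding generator redundant.
\<close>

lemma minimal_generators:
  assumes "generates T K"
  obtains T where "generates T K" "\<And>j u t. u \<in> coeffs_of_degree T j \<Longrightarrow> comb T u = 0 \<Longrightarrow> t \<in> T \<Longrightarrow>
    lookup (u t) 0 = 0"
proof -
  obtain T where T: "generates T K" and min: "\<And>T'. generates T' K \<Longrightarrow> card T \<le> card T'"
    using ex_has_least_nat[of "\<lambda>T. generates T K", OF assms] by blast
  have finT: "finite T" using T by (simp add: generates_def)
  have "lookup (w t) 0 = 0" if w: "w \<in> coeffs_of_degree T j" "comb T w = 0" and t: "t \<in> T" for j w t
  proof (rule ccontr)
    assume c: "lookup (w t) 0 \<noteq> 0"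
    define k where "k = lookup (w t) 0"
    have hw: "homogeneous (j - fst t) (w t)" using w(1) t by (simp add: coeffs_of_degree_def)
    have "0 \<in> keys (w t)" using c by (simp add: in_keys_iff)
    then have j: "j = fst t" using hw by (force simp: homogeneous_def)
    have wt: "w t = single 0 k"
      using homogeneous_0_const[of "w t"] hw j by (simp add: k_def)
    have "generates (T - {t}) K"
      unfolding generates_def
    proof (intro conjI allI subsetI)
      show "finite (T - {t})" using finT by simp
      show "\<forall>t\<in>T - {t}. snd t \<in> K (fst t)" using T by (auto simp: generates_def)
      fix i v assume "v \<in> K i"
      then obtain u where u: "u \<in> coeffs_of_degree T i" "v = comb T u" using T unfolding generates_def by blast
      \<comment> \<open>The multiple of the relation \<open>w\<close> that cancels the coefficient
        of \<open>t\<close>. Since \<open>w\<close> evaluates to 0, subtracting it does not change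
        \<open>v\<close>.\<close>
      define q where "q = single 0 (inverse k) * u t"
      define u' where "u' r = u r - q * w r" for r
      have "single 0 k * single 0 (inverse k) = (1 :: ('v, 'k) mpoly)"
        using c by (simp add: mult_single k_def)
      then have u't: "u' t = 0" by (simp add: u'_def q_def wt ac_simps flip: mult.assoc)
      have q: "q \<in> carrier (poly_ring V)" "homogeneous (i - fst t) q"
      proof -
        show "q \<in> carrier (poly_ring V)"
          using u(1) t by (auto simp: q_def coeffs_of_degree_def intro!: poly_ring_closed)
        have "homogeneous 0 (single 0 (inverse k) :: ('v, 'k) mpoly)" by (simp add: homogeneous_def)
        from homogeneous_mult[OF this, of "i - fst t" "u t"] show "homogeneous (i - fst t) q"
          using u(1) t by (simp add: q_def coeffs_of_degree_def)
      qed
      have "u' \<in> coeffs_of_degree T i"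
        unfolding coeffs_of_degree_def mem_Collect_eq
      proof (intro ballI conjI)
        fix r assume r: "r \<in> T"
        have wr: "w r \<in> carrier (poly_ring V)" "homogeneous (j - fst r) (w r)"
          and ur: "u r \<in> carrier (poly_ring V)" "homogeneous (i - fst r) (u r)"
          using w(1) u(1) r by (auto simp: coeffs_of_degree_def)
        have e: "u' r = u r + - (q * w r)" by (simp add: u'_def)
        have "homogeneous (i - fst r) (q * w r)" using homogeneous_mult[OF q(2) wr(2)] j by simp
        then show "homogeneous (i - fst r) (u' r)" unfolding e by (intro homogeneous_add homogeneous_minus ur)
        show "u' r \<in> carrier (poly_ring V)" unfolding e
          by (intro poly_ring_closed poly_ring_uminus[THEN iffD2] q wr ur)
      qed
      then have "u' \<in> coeffs_of_degree (T - {t}) i" by (simp add: coeffs_of_degree_def)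
      moreover have "v = comb (T - {t}) u'"
      proof
        fix a
        have "comb (T - {t}) u' a = (\<Sum>r\<in>T. u' r * snd r a)"
          unfolding comb_def using finT t by (simp add: sum.remove[of T t] u't)
        also have "\<dots> = comb T u a - q * comb T w a"
          by (simp add: u'_def comb_def algebra_simps sum_subtractf sum_distrib_left)
        finally show "v a = comb (T - {t}) u' a" using u(2) w(2) by simp
      qed
      ultimately show "v \<in> comb (T - {t}) ` coeffs_of_degree (T - {t}) i" by blast
    qed
    from min[OF this] show False using finT t by (metis card_Diff1_less linorder_not_le)
  qed
  then show ?thesis using that T by blast
qed

text \<open>The columns of the matrix are the elements of a minimal generating set. The last two
  conclusions keep the construction going: the kernel has no constant terms, and the entries inherit
  the absence of constant terms from \<open>K\<close>.\<close>

lemma minimal_cover: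
  assumes K: "gsub K" "\<And>j. K j \<subseteq> free_mod sh j"
    and fin: "finite {j. \<not> kcycles K 0 j \<subseteq> kbounds K 0 j}"
  obtains sh' A where "gmat V sh sh' A" "\<And>j. K j = mact A ` free_mod sh' j"
    "\<And>j v a. v \<in> free_mod sh' j \<Longrightarrow> mact A v = 0 \<Longrightarrow> lookup (v a) 0 = 0"
    "\<And>a b. a < length sh \<Longrightarrow> b < length sh' \<Longrightarrow> \<exists>x\<in>K (sh' ! b). A $$ (a, b) = x a"
proof -
  obtain T where T: "generates T K" and min: "\<And>j u t. u \<in> coeffs_of_degree T j \<Longrightarrow> comb T u = 0 \<Longrightarrow> t \<in> T \<Longrightarrow>
    lookup (u t) 0 = 0"
    using generates_exists[OF K fin] minimal_generators by metis
  have finT: "finite T" and TK: "\<And>t. t \<in> T \<Longrightarrow> snd t \<in> K (fst t)" using T by (auto simp: generates_def)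
  define n where "n = card T"
  obtain h where h: "bij_betw h {..<n} T"
    using ex_bij_betw_nat_finite[OF finT] unfolding n_def by (metis atLeast0LessThan)
  have hT: "h b \<in> T" if "b < n" for b using h that by (auto simp: bij_betw_def)
  define sh' where "sh' = map (\<lambda>b. fst (h b)) [0..<n]"
  define A where "A = mat (length sh) n (\<lambda>(a, b). snd (h b) a)"
  have len: "length sh' = n" by (simp add: sh'_def)
  have sh': "sh' ! b = fst (h b)" if "b < n" for b using that by (simp add: sh'_def)
  have x: "snd (h b) \<in> free_mod sh (fst (h b))" if "b < n" for b using TK[OF hT[OF that]] K(2) by blast
  have gm: "gmat V sh sh' A"
    unfolding gmat_def
  proof (intro conjI allI impI)
    show "A \<in> carrier_mat (length sh) (length sh')" by (simp add: A_def len)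
    fix a b assume ab: "a < length sh" "b < length sh'"
    then have "A $$ (a, b) = snd (h b) a" by (simp add: A_def len)
    then show "A $$ (a, b) \<in> carrier (poly_ring V)" "homogeneous (sh' ! b - sh ! a) (A $$ (a, b))"
      using x[of b] ab by (auto simp: free_mod_iff fmod_def len sh')
  qed
  have mact: "mact A v = comb T u" if "\<And>b. b < n \<Longrightarrow> v b = u (h b)" for v u
  proof
    fix a
    have c: "comb T u a = (\<Sum>b<n. u (h b) * snd (h b) a)"
      unfolding comb_def by (rule sum.reindex_bij_betw[OF h, symmetric])
    show "mact A v a = comb T u a"
    proof (cases "a < length sh")
      case True
      then show ?thesis unfolding c by (auto simp: mact_def A_def that mult.commute intro!: sum.cong)
    next
      case False
      have "snd (h b) a = 0" if "b < n" for b using x[OF that] False by (auto simp: free_mod_iff fmod_def)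
      then show ?thesis unfolding c using False by (simp add: mact_def A_def)
    qed
  qed
  have coeffs: "\<exists>u\<in>coeffs_of_degree T j. \<forall>b<n. v b = u (h b)" if v: "v \<in> free_mod sh' j" for v j
  proof (rule bexI)
    let ?u = "\<lambda>t. v (inv_into {..<n} h t)"
    have inv: "inv_into {..<n} h (h b) = b" if "b < n" for b
      using h that by (intro inv_into_f_f) (auto simp: bij_betw_def)
    show "\<forall>b<n. v b = ?u (h b)" using inv by simp
    show "?u \<in> coeffs_of_degree T j"
      unfolding coeffs_of_degree_def mem_Collect_eq
    proof
      fix t assume "t \<in> T"
      then obtain b where b: "b < n" "t = h b" using h by (auto simp: bij_betw_def)
      then show "?u t \<in> carrier (poly_ring V) \<and> homogeneous (j - fst t) (?u t)"
        using v inv[of b] sh'[of b] by (auto simp: free_mod_iff fmod_def len)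
    qed
  qed
  have image: "K j = mact A ` free_mod sh' j" for j
  proof (intro subset_antisym subsetI)
    fix v assume "v \<in> K j"
    then obtain u where u: "u \<in> coeffs_of_degree T j" "v = comb T u" using T unfolding generates_def by blast
    define w where "w b = (if b < n then u (h b) else 0)" for b
    have "w \<in> free_mod sh' j"
      using u(1) hT sh' by (auto simp: free_mod_iff fmod_def w_def len coeffs_of_degree_def)
    moreover have "mact A w = comb T u" by (rule mact) (simp add: w_def)
    ultimately show "v \<in> mact A ` free_mod sh' j" using u(2) by (metis imageI)
  next
    fix v assume "v \<in> mact A ` free_mod sh' j"
    then obtain w where w: "w \<in> free_mod sh' j" "v = mact A w" by blast
    then obtain u where u: "u \<in> coeffs_of_degree T j" "\<forall>b<n. w b = u (h b)" using coeffs by blast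
    have "v = (\<Sum>t\<in>T. (\<lambda>a. u t * snd t a))"
      using w(2) mact[of w u] u(2) by (simp add: comb_def fun_eq_iff sum_fun_apply)
    also have "\<dots> \<in> K j"
      by (intro gsub_sum[OF K(1)] gsub_mult[OF K(1) TK]) (use u(1) in \<open>auto simp: coeffs_of_degree_def\<close>)
    finally show "v \<in> K j" .
  qed
  have kernel: "lookup (v a) 0 = 0" if v: "v \<in> free_mod sh' j" "mact A v = 0" for j v a
  proof (cases "a < n")
    case True
    obtain u where u: "u \<in> coeffs_of_degree T j" "\<forall>b<n. v b = u (h b)" using coeffs[OF v(1)] by blast
    have "comb T u = 0" using mact[of v u] u(2) v(2) by simp
    from min[OF u(1) this hT[OF True]] show ?thesis using u(2) True by simp
  next
    case False
    then show ?thesis using v(1) by (auto simp: free_mod_iff fmod_def len)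
  qed
  have entries: "\<exists>x\<in>K (sh' ! b). A $$ (a, b) = x a" if "a < length sh" "b < length sh'" for a b
    using that TK[OF hT, of b] by (intro bexI[of _ "snd (h b)"]) (auto simp: A_def len sh')
  show ?thesis by (rule that[of sh' A, OF gm]) (rule image, erule (1) kernel, erule (1) entries)
qed

end

section \<open>Multidegrees that split into two parts\<close>

text \<open>Wedge a chain on \<open>X\<close> with the full set \<open>Y\<close>. The complement of
  \<open>S \<union> Y\<close> in \<open>X \<union> Y\<close> is that of \<open>S\<close> in
  \<open>X\<close>, so the monomial parts stay the same.\<close>

definition ext_chain :: "'v set \<Rightarrow> 'v set \<Rightarrow> ('v set \<Rightarrow> 'k::zero) \<Rightarrow> 'v set \<Rightarrow> 'k" where
  "ext_chain X Y b S = (if Y \<subseteq> S \<and> S \<subseteq> X \<union> Y then b (S - Y) else 0)"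

text \<open>The sign that the differential of \<open>X \<union> Y\<close> induces on chains on
  \<open>X\<close> to whose index sets \<open>Y\<close> is attached.\<close>

definition rel_sign :: "('v \<Rightarrow> 'v set \<Rightarrow> bool) \<Rightarrow> 'v set \<Rightarrow> 'v \<Rightarrow> 'v set \<Rightarrow> bool" where
  "rel_sign s Y = (\<lambda>x S. s x (S \<union> Y))"

lemma koszul_sign_rel_sign:
  assumes "koszul_sign V s" "X \<subseteq> V" "Y \<subseteq> V" "X \<inter> Y = {}"
  shows "koszul_sign X (rel_sign s Y)"
proof
  interpret koszul_sign V s by fact
  show "finite X" using assms(2) finite_V finite_subset by blast
  fix x y S assume "x \<in> X" "y \<in> X" "x \<noteq> y" "S \<subseteq> X" "x \<notin> S" "y \<notin> S"
  with assms swap[of x y "S \<union> Y"] show "(rel_sign s Y x (insert y S) \<noteq> rel_sign s Y y S) \<noteq>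
      (rel_sign s Y y (insert x S) \<noteq> rel_sign s Y x S)"
    unfolding rel_sign_def by auto
qed

lemma kd_card:
  assumes "finite W" "\<And>S. z S \<noteq> 0 \<Longrightarrow> card S = Suc n" "kd\<^sub>1 W s z S \<noteq> 0"
  shows "S \<subseteq> W" "card S = n"
proof -
  show "S \<subseteq> W" using assms(3) by (auto simp: kd_def split: if_splits)
  then have "finite S" using assms(1) finite_subset by blast
  have "\<exists>x\<in>W - S. z (insert x S) \<noteq> 0"
  proof (rule ccontr)
    assume "\<not> (\<exists>x\<in>W - S. z (insert x S) \<noteq> 0)"
    then have "kd\<^sub>1 W s z S = 0" by (simp add: kd_def)
    with assms(3) show False by simp
  qed
  then show "card S = n" using assms(2) \<open>finite S\<close> by fastforce
qed

text \<open>Once \<open>S\<close> contains \<open>Y\<close>, only elements of \<open>X\<close> can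
  still be inserted, so the differential is that of \<open>X\<close> with the induced sign.\<close>

lemma kd_ext_chain:
  assumes XY: "X \<inter> Y = {}" and S: "Y \<subseteq> S" "S \<subseteq> X \<union> Y"
  shows "kd\<^sub>1 (X \<union> Y) s (ext_chain X Y b) S = kd\<^sub>1 X (rel_sign s Y) b (S - Y)"
proof -
  have "X \<union> Y - S = X - (S - Y)" using XY S by blast
  moreover have "S - Y \<subseteq> X" "S - Y \<union> Y = S" using S by auto
  moreover have "ext_chain X Y b (insert x S) = b (insert x (S - Y))" if "x \<in> X - (S - Y)" for x
  proof -
    have "insert x S - Y = insert x (S - Y)" using that XY by blast
    then show ?thesis using that S by (auto simp: ext_chain_def)
  qed
  ultimately show ?thesis using S by (simp add: kd_def rel_sign_def)
qed

text \<open>An extended chain is nonzero only on sets containing \<open>Y\<close>, and the only such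
  set one element above \<open>S\<close> is \<open>X \<union> Y\<close>, where its value is
  \<open>b X = 0\<close>. Hence a correction made for one part does not disturb the other.\<close>

lemma kd_ext_chain_0:
  assumes XY: "X \<inter> Y = {}" and S: "\<not> Y \<subseteq> S" "X \<subseteq> S" "S \<subseteq> X \<union> Y" and b: "b X = 0"
  shows "kd\<^sub>1 (X \<union> Y) s (ext_chain X Y b) S = 0"
proof -
  have "ext_chain X Y b (insert x S) = 0" if "x \<in> X \<union> Y - S" for x
  proof (cases "Y \<subseteq> insert x S")
    case True
    then have "insert x S - Y = X" using that S XY by blast
    then show ?thesis using b by (simp add: ext_chain_def)
  qed (simp add: ext_chain_def)
  then show ?thesis by (simp add: kd_def)
qed

lemma kd_restrict_chain:
  assumes XY: "X \<inter> Y = {}" and S: "S \<subseteq> X"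
  shows "kd\<^sub>1 X (rel_sign s Y) (\<lambda>S. c (S \<union> Y)) S = kd\<^sub>1 (X \<union> Y) s c (S \<union> Y)"
proof -
  have "X \<union> Y - (S \<union> Y) = X - S" "S \<union> Y \<subseteq> X \<union> Y" using XY S by auto
  then show ?thesis using S by (simp add: kd_def rel_sign_def)
qed

lemma ext_chain_card:
  assumes "finite (X \<union> Y)" "X \<inter> Y = {}" "\<And>S. b S \<noteq> 0 \<Longrightarrow> S \<subseteq> X \<and> card S + card Y = n"
    and "ext_chain X Y b S \<noteq> 0"
  shows "card S = n"
proof -
  have S: "Y \<subseteq> S" "S \<subseteq> X \<union> Y" "b (S - Y) \<noteq> 0" using assms(4) by (auto simp: ext_chain_def split: if_splits)
  have "finite S" using S(2) assms(1) finite_subset by blast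
  then have "card S = card (S - Y) + card Y"
    using S(1) by (metis add.commute card_Diff_subset card_mono finite_subset le_add_diff_inverse)
  then show ?thesis using assms(3)[OF S(3)] by simp
qed

lemma kd_id_add: "kd\<^sub>1 W s (z + w) = kd\<^sub>1 W s z + kd\<^sub>1 W s w"
  by (rule ext) (simp add: kd_def sg_add sum.distrib)

lemma kd_id_diff: "kd\<^sub>1 W s (z - w) = kd\<^sub>1 W s z - kd\<^sub>1 W s w"
  using kd_id_add[of W s "z - w" w] by (simp add: algebra_simps)

text \<open>
  The sets \<open>S\<close> that contain neither \<open>X\<close> nor \<open>Y\<close> form the subcomplex of those \<open>T = X \<union> Y - S\<close> that meet
  both \<open>X\<close> and \<open>Y\<close>. It computes the reduced cohomology of a disjoint union of two simplices, which is
  concentrated in \<open>card T = 2\<close>.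
\<close>

lemma mixed_exact:
  fixes c :: "'v set \<Rightarrow> 'k::field"
  assumes s: "koszul_sign (X \<union> Y) s" and XY: "X \<inter> Y = {}"
    and c: "\<And>S. c S \<noteq> 0 \<Longrightarrow> S \<subseteq> X \<union> Y \<and> card S = i \<and> \<not> X \<subseteq> S \<and> \<not> Y \<subseteq> S"
    and cyc: "kd\<^sub>1 (X \<union> Y) s c = 0"
    and i: "i + 3 \<le> card (X \<union> Y)"
  obtains b where "\<And>S. b S \<noteq> 0 \<Longrightarrow> S \<subseteq> X \<union> Y \<and> card S = Suc i \<and> \<not> X \<subseteq> S \<and> \<not> Y \<subseteq> S"
    "kd\<^sub>1 (X \<union> Y) s b = c"
proof (cases "X = {} \<or> Y = {}")
  case True
  then have "c S = 0" for S using c[of S] by blast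
  then have "kd\<^sub>1 (X \<union> Y) s (\<lambda>_. 0) = c" by (simp add: kd_def fun_eq_iff)
  then show ?thesis using that[of "\<lambda>_. 0"] by simp
next
  case False
  then obtain p q where p: "p \<in> X" and q: "q \<in> Y" by blast
  define W where "W = X \<union> Y"
  have YX: "Y \<union> X = W" "Y \<inter> X = {}" using XY by (auto simp: W_def)
  interpret koszul_sign W s using s by (simp add: W_def)
  interpret Y: koszul_sign Y "rel_sign s X"
    by (rule koszul_sign_rel_sign[OF koszul_sign_axioms]) (use XY in \<open>auto simp: W_def\<close>)
  have fin: "finite X" "finite Y" using finite_V by (auto simp: W_def)
  \<comment> \<open>A first preimage of \<open>c\<close>. As \<open>p\<close> lies outside
    \<open>Y\<close>, coning cannot complete a set to contain \<open>Y\<close>, but it can complete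
    one to contain \<open>X\<close>; those values have to be removed.\<close>
  define h where "h = cone p c"
  have kdh: "kd\<^sub>1 W s h S = c S" if "S \<subseteq> W" for S
    unfolding h_def by (rule kd_cone) (use that p cyc in \<open>auto simp: W_def\<close>)
  have h: "p \<in> S \<and> S \<subseteq> W \<and> card S = Suc i \<and> \<not> Y \<subseteq> S" if "h S \<noteq> 0" for S
  proof -
    have S: "p \<in> S" "S \<subseteq> W" "c (S - {p}) \<noteq> 0" using that by (auto simp: h_def cone_def split: if_splits)
    have "finite S" using S(2) finite_V finite_subset by blast
    then have "card S = Suc i" using c[OF S(3)] S(1) by (metis card.remove)
    moreover have "\<not> Y \<subseteq> S" using c[OF S(3)] p XY by blast
    ultimately show ?thesis using S by blast
  qed
  \<comment> \<open>The unwanted values of \<open>h\<close>, seen as a chain on \<open>Y\<close>.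
    They form a cycle because \<open>c\<close> vanishes on sets containing \<open>X\<close>, so a
    cone at \<open>q\<close> fills them.\<close>
  define h' where "h' S = h (S \<union> X)" for S
  have cyc': "kd\<^sub>1 Y (rel_sign s X) h' S = 0" if "S \<subseteq> Y" for S
  proof -
    have "kd\<^sub>1 Y (rel_sign s X) h' S = kd\<^sub>1 W s h (S \<union> X)"
      unfolding h'_def using kd_restrict_chain[OF YX(2) that, of s h] YX(1) by simp
    also have "\<dots> = c (S \<union> X)" by (rule kdh) (use that in \<open>auto simp: W_def\<close>)
    also have "\<dots> = 0" using c[of "S \<union> X"] by blast
    finally show ?thesis .
  qed
  define k where "k = Y.cone q h'"
  have kdk: "kd\<^sub>1 Y (rel_sign s X) k S = h' S" if "S \<subseteq> Y" for S
    unfolding k_def by (rule Y.kd_cone[OF q that]) (use that in \<open>auto intro: cyc'\<close>)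
  have k: "S \<subseteq> Y \<and> card S + card X = Suc (Suc i)" if "k S \<noteq> 0" for S
  proof -
    have S: "q \<in> S" "S \<subseteq> Y" "h (S - {q} \<union> X) \<noteq> 0"
      using that by (auto simp: k_def Y.cone_def h'_def split: if_splits)
    have "finite S" using S(2) fin finite_subset by blast
    moreover have "card (S - {q} \<union> X) = card (S - {q}) + card X"
      using S(2) XY fin \<open>finite S\<close> by (intro card_Un_disjoint) auto
    ultimately show ?thesis using h[OF S(3)] S(1,2) by (metis Suc_inject add_Suc card.remove)
  qed
  \<comment> \<open>Here the bound on \<open>i\<close> enters: \<open>k\<close> is supported on sets
    with \<open>card S + card X = i + 2\<close>, while the full set would need at least
    \<open>i + 3\<close>.\<close>
  have kY: "k Y = 0"
  proof (rule ccontr)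
    assume "k Y \<noteq> 0"
    then have "card Y + card X = Suc (Suc i)" using k by blast
    moreover have "card (X \<union> Y) = card X + card Y" using fin XY by (simp add: card_Un_disjoint)
    ultimately show False using i by simp
  qed
  define e where "e = ext_chain Y X k"
  have e_card: "card S = Suc (Suc i)" if "e S \<noteq> 0" for S
    by (rule ext_chain_card[OF _ YX(2) k]) (use that fin in \<open>auto simp: e_def\<close>)
  \<comment> \<open>Subtracting a boundary keeps the preimage property, and
    \<open>kd\<^sub>1 W s e\<close> agrees with \<open>h\<close> on sets containing
    \<open>X\<close>, so \<open>b\<close> vanishes there.\<close>
  define b where "b = h - kd\<^sub>1 W s e"
  have e1: "kd\<^sub>1 W s e S = h S" if "X \<subseteq> S" "S \<subseteq> W" for S
  proof -
    have "kd\<^sub>1 W s e S = kd\<^sub>1 Y (rel_sign s X) k (S - X)"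
      unfolding e_def using kd_ext_chain[OF YX(2) that(1), of s k] that(2) YX(1) by simp
    also have "\<dots> = h' (S - X)" by (rule kdk) (use that in \<open>auto simp: W_def\<close>)
    also have "\<dots> = h S" using that(1) by (simp add: h'_def Un_absorb2)
    finally show ?thesis .
  qed
  have e2: "kd\<^sub>1 W s e S = 0" if "\<not> X \<subseteq> S" "Y \<subseteq> S" "S \<subseteq> W" for S
  proof -
    have "S \<subseteq> Y \<union> X" using that(3) unfolding YX(1) .
    from kd_ext_chain_0[where b = k and s = s, OF YX(2) that(1,2) this kY] show ?thesis unfolding YX(1) e_def .
  qed
  show ?thesis
  proof (rule that)
    fix S assume bS: "b S \<noteq> 0"
    then consider "h S \<noteq> 0" | "kd\<^sub>1 W s e S \<noteq> 0"
      by (cases "h S = 0") (auto simp: b_def)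
    then have S: "S \<subseteq> W" "card S = Suc i"
      using h kd_card[OF finite_V e_card] by (cases; blast)+
    moreover have "\<not> X \<subseteq> S" using bS e1[OF _ S(1)] by (auto simp: b_def)
    moreover have "\<not> Y \<subseteq> S"
    proof
      assume Y: "Y \<subseteq> S"
      then have "h S = 0" using h by blast
      moreover have "kd\<^sub>1 W s e S = 0" using e2 \<open>\<not> X \<subseteq> S\<close> Y S(1) by blast
      ultimately show False using bS by (simp add: b_def)
    qed
    ultimately show "S \<subseteq> X \<union> Y \<and> card S = Suc i \<and> \<not> X \<subseteq> S \<and> \<not> Y \<subseteq> S" by (simp add: W_def)
  next
    have "kd\<^sub>1 W s (kd\<^sub>1 W s e) = 0" by (rule kd_kd) simp_all
    moreover have "kd\<^sub>1 W s h = c"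
    proof
      fix S
      show "kd\<^sub>1 W s h S = c S"
      proof (cases "S \<subseteq> W")
        case False
        then have "c S = 0" using c[of S] by (auto simp: W_def)
        then show ?thesis using False by (simp add: kd_def)
      qed (rule kdh)
    qed
    ultimately show "kd\<^sub>1 (X \<union> Y) s b = c" by (simp add: b_def kd_id_diff flip: W_def)
  qed
qed

text \<open>Choose one element in each part and fill up arbitrarily; this requires size at least
  two, hence the form \<open>Suc (Suc n)\<close>.\<close>

lemma mixed_subset:
  assumes "finite T" "T \<inter> X \<noteq> {}" "T \<inter> Y \<noteq> {}" "X \<inter> Y = {}" "Suc (Suc n) \<le> card T"
  obtains A where "A \<subseteq> T" "card A = Suc (Suc n)" "A \<inter> X \<noteq> {}" "A \<inter> Y \<noteq> {}"
proof -
  obtain x y where xy: "x \<in> T" "x \<in> X" "y \<in> T" "y \<in> Y" using assms by blast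
  then have "x \<noteq> y" using assms(4) by blast
  then have "n \<le> card (T - {x, y})" using assms(1,5) xy by (simp add: card_Diff_subset)
  then obtain B where B: "B \<subseteq> T - {x, y}" "card B = n" by (metis obtain_subset_with_card_n)
  have "finite B" using B(1) assms(1) finite_subset by blast
  moreover have "x \<notin> B" "y \<notin> B" using B(1) by auto
  ultimately have "card (insert x (insert y B)) = Suc (Suc n)" using B(2) \<open>x \<noteq> y\<close> by simp
  then show ?thesis using that[of "insert x (insert y B)"] B xy by blast
qed

text \<open>The values of \<open>c\<close> on sets containing \<open>Y\<close> form a cycle in the
  complex of \<open>X\<close>, since further insertions stay in \<open>X\<close>. If that complex
  has no homology there, a preimage extended by \<open>Y\<close> corrects \<open>c\<close> on these
  sets and leaves the sets containing only \<open>X\<close> alone.\<close>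

lemma sqf_hnz_correction:
  fixes c :: "'v set \<Rightarrow> 'k::field"
  assumes XY: "X \<inter> Y = {}" "finite (X \<union> Y)"
    and E1: "\<And>A. A \<in> E1 \<Longrightarrow> A \<in> E \<and> A \<noteq> {}" and E: "\<And>A. A \<in> E \<Longrightarrow> A \<subseteq> X \<Longrightarrow> A \<in> E1"
    and c: "sqf_chain E (X \<union> Y) i c" "kd\<^sub>1 (X \<union> Y) s c = 0"
    and none: "\<And>i'. i' + card Y = i \<Longrightarrow> \<not> sqf_hnz TYPE('k) (rel_sign s Y) E1 X i'"
  obtains e :: "'v set \<Rightarrow> 'k" where "sqf_chain E (X \<union> Y) (Suc i) e"
    "\<And>S. Y \<subseteq> S \<Longrightarrow> S \<subseteq> X \<union> Y \<Longrightarrow> kd\<^sub>1 (X \<union> Y) s e S = c S"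
    "\<And>S. X \<subseteq> S \<Longrightarrow> \<not> Y \<subseteq> S \<Longrightarrow> S \<subseteq> X \<union> Y \<Longrightarrow> kd\<^sub>1 (X \<union> Y) s e S = 0"
proof -
  define c' where "c' S = (if S \<subseteq> X then c (S \<union> Y) else 0)" for S
  have c': "S \<subseteq> X \<and> card S + card Y = i \<and> (\<exists>A\<in>E1. A \<subseteq> X - S)" if "c' S \<noteq> 0" for S
  proof -
    have S: "S \<subseteq> X" "c (S \<union> Y) \<noteq> 0" using that by (auto simp: c'_def split: if_splits)
    have "card (S \<union> Y) = card S + card Y"
      using S(1) XY finite_subset by (intro card_Un_disjoint) auto
    moreover have "X \<union> Y - (S \<union> Y) = X - S" using XY S by blast
    moreover have "card (S \<union> Y) = i" "\<exists>A\<in>E. A \<subseteq> X \<union> Y - (S \<union> Y)"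
      using c(1) S(2) unfolding sqf_chain_def by blast+
    ultimately show ?thesis using S(1) E by (metis Diff_subset order_trans)
  qed
  have kd': "kd\<^sub>1 X (rel_sign s Y) c' = 0"
  proof
    fix S
    show "kd\<^sub>1 X (rel_sign s Y) c' S = 0 S"
    proof (cases "S \<subseteq> X")
      case True
      have "kd\<^sub>1 X (rel_sign s Y) c' S = kd\<^sub>1 X (rel_sign s Y) (\<lambda>S. c (S \<union> Y)) S"
        using True by (simp add: kd_def c'_def)
      then show ?thesis using kd_restrict_chain[OF XY(1) True, of s c] c(2) by simp
    qed (simp add: kd_def)
  qed
  obtain b where
    b: "\<And>S. b S \<noteq> 0 \<Longrightarrow> S \<subseteq> X \<and> card S + card Y = Suc i \<and> (\<exists>A\<in>E1. A \<subseteq> X - S)"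
    and kdb: "\<And>S. S \<subseteq> X \<Longrightarrow> kd\<^sub>1 X (rel_sign s Y) b S = c (S \<union> Y)"
  proof (cases "card Y \<le> i")
    case True
    define i' where "i' = i - card Y"
    have i': "i' + card Y = i" using True by (simp add: i'_def)
    have "sqf_chain E1 X i' c'" using c' i' by (auto simp: sqf_chain_def)
    then obtain b where b: "sqf_chain E1 X (Suc i') b" "kd\<^sub>1 X (rel_sign s Y) b = c'"
      using none[OF i'] kd' unfolding sqf_hnz_def by blast
    show ?thesis by (rule that[of b]) (use b i' in \<open>auto simp: sqf_chain_def c'_def\<close>)
  next
    case False
    \<comment> \<open>If \<open>Y\<close> has more than \<open>i\<close> elements, no set of size
      \<open>i\<close> contains it.\<close>
    then have z: "c' S = 0" for S using c'[of S] by linarith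
    show ?thesis
    proof (rule that[of "\<lambda>_. 0"])
      fix S assume "S \<subseteq> X"
      then show "kd\<^sub>1 X (rel_sign s Y) (\<lambda>_. 0) S = c (S \<union> Y)"
        using z[of S] by (simp add: kd_def c'_def)
    qed simp
  qed
  \<comment> \<open>A nonzero value at \<open>X\<close> would require a generator inside
    \<open>X - X\<close>, but generators are nonempty.\<close>
  have bX: "b X = 0" using b[of X] E1 by auto
  show ?thesis
  proof (rule that[of "ext_chain X Y b"])
    show "sqf_chain E (X \<union> Y) (Suc i) (ext_chain X Y b)"
      unfolding sqf_chain_def
    proof (intro allI impI)
      fix S assume e: "ext_chain X Y b S \<noteq> 0"
      then have S: "Y \<subseteq> S" "S \<subseteq> X \<union> Y" "b (S - Y) \<noteq> 0" by (auto simp: ext_chain_def split: if_splits)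
      have "card S = Suc i"
        by (rule ext_chain_card[OF XY(2,1), of b]) (use b e in auto)
      moreover have "X - (S - Y) \<subseteq> X \<union> Y - S" using XY(1) by blast
      ultimately show "S \<subseteq> X \<union> Y \<and> card S = Suc i \<and> (\<exists>A\<in>E. A \<subseteq> X \<union> Y - S)"
        using b[OF S(3)] E1 S(2) by (meson order_trans)
    qed
    show "kd\<^sub>1 (X \<union> Y) s (ext_chain X Y b) S = c S" if "Y \<subseteq> S" "S \<subseteq> X \<union> Y" for S
    proof -
      have "S - Y \<subseteq> X" "S - Y \<union> Y = S" using that by auto
      then show ?thesis unfolding kd_ext_chain[OF XY(1) that] using kdb[of "S - Y"] by simp
    qed
    show "kd\<^sub>1 (X \<union> Y) s (ext_chain X Y b) S = 0" if "X \<subseteq> S" "\<not> Y \<subseteq> S" "S \<subseteq> X \<union> Y" for S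
      by (rule kd_ext_chain_0[where b = b, OF XY(1) that(2,1,3) bX])
  qed
qed

text \<open>Modulo the mixed sets, the complex of the join is the direct sum of those of the two parts.\<close>

lemma sqf_hnz_join:
  fixes X :: "'v set"
  assumes s: "koszul_sign (X \<union> Y) s" and XY: "X \<inter> Y = {}"
    and E1: "\<And>A. A \<in> E1 \<Longrightarrow> A \<in> E \<and> A \<noteq> {}" "\<And>A. A \<in> E \<Longrightarrow> A \<subseteq> X \<Longrightarrow> A \<in> E1"
    and E2: "\<And>A. A \<in> E2 \<Longrightarrow> A \<in> E \<and> A \<noteq> {}" "\<And>A. A \<in> E \<Longrightarrow> A \<subseteq> Y \<Longrightarrow> A \<in> E2"
    and mixed: "\<And>A. A \<subseteq> X \<union> Y \<Longrightarrow> card A = r + 1 \<Longrightarrow> A \<inter> X \<noteq> {} \<Longrightarrow> A \<inter> Y \<noteq> {} \<Longrightarrow> A \<in> E"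
    and r: "r > 0" and i: "i + r + 2 \<le> card (X \<union> Y)"
    and nz: "sqf_hnz TYPE('k::field) s E (X \<union> Y) i"
  shows "(\<exists>i'. i' + card Y = i \<and> sqf_hnz TYPE('k::field) (rel_sign s Y) E1 X i') \<or>
    (\<exists>i'. i' + card X = i \<and> sqf_hnz TYPE('k::field) (rel_sign s X) E2 Y i')"
proof (rule ccontr)
  assume none: "\<not> ?thesis"
  interpret koszul_sign "X \<union> Y" s by fact
  have fin: "finite X" "finite Y" using finite_V by auto
  have YX: "Y \<inter> X = {}" "Y \<union> X = X \<union> Y" using XY by auto
  let ?kd = "kd\<^sub>1 (X \<union> Y) s"
  obtain c :: "'v set \<Rightarrow> 'k" where c: "sqf_chain E (X \<union> Y) i c" "?kd c = 0"
    "\<not> (\<exists>b. sqf_chain E (X \<union> Y) (Suc i) b \<and> ?kd b = c)"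
    using nz by (auto simp: sqf_hnz_def)
  obtain e1 :: "'v set \<Rightarrow> 'k" where e1: "sqf_chain E (X \<union> Y) (Suc i) e1"
    and k11: "\<And>S. Y \<subseteq> S \<Longrightarrow> S \<subseteq> X \<union> Y \<Longrightarrow> ?kd e1 S = c S"
    and k12: "\<And>S. X \<subseteq> S \<Longrightarrow> \<not> Y \<subseteq> S \<Longrightarrow> S \<subseteq> X \<union> Y \<Longrightarrow> ?kd e1 S = 0"
    using sqf_hnz_correction[OF XY finite_V E1 c(1,2)] none by blast
  have c': "finite (Y \<union> X)" "sqf_chain E (Y \<union> X) i c" "kd\<^sub>1 (Y \<union> X) s c = 0"
    unfolding YX(2) using finite_V c(1,2) by auto
  obtain e2 :: "'v set \<Rightarrow> 'k" where e2: "sqf_chain E (X \<union> Y) (Suc i) e2"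
    and k22: "\<And>S. X \<subseteq> S \<Longrightarrow> S \<subseteq> X \<union> Y \<Longrightarrow> ?kd e2 S = c S"
    and k21: "\<And>S. Y \<subseteq> S \<Longrightarrow> \<not> X \<subseteq> S \<Longrightarrow> S \<subseteq> X \<union> Y \<Longrightarrow> ?kd e2 S = 0"
    using sqf_hnz_correction[OF YX(1) c'(1) E2 c'(2,3)] none unfolding YX(2) by blast
  \<comment> \<open>The two corrections remove all values of \<open>c\<close> on sets containing
    \<open>X\<close> or \<open>Y\<close>; what remains lives on mixed complements.\<close>
  define d where "d = c - ?kd e1 - ?kd e2"
  have d: "S \<subseteq> X \<union> Y \<and> card S = i \<and> \<not> X \<subseteq> S \<and> \<not> Y \<subseteq> S" if dS: "d S \<noteq> 0" for S
  proof -
    have card_e: "card T = Suc i" if "e1 T \<noteq> 0 \<or> e2 T \<noteq> 0" for T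
      using e1 e2 that unfolding sqf_chain_def by blast
    consider "c S \<noteq> 0" | "?kd e1 S \<noteq> 0" | "?kd e2 S \<noteq> 0"
      using dS by (cases "c S = 0"; cases "?kd e1 S = 0") (auto simp: d_def)
    then have S: "S \<subseteq> X \<union> Y \<and> card S = i"
    proof cases
      case 1
      then show ?thesis using c(1) by (auto simp: sqf_chain_def)
    next
      case 2
      then show ?thesis using kd_card[OF finite_V, of e1 i s S] card_e by blast
    next
      case 3
      then show ?thesis using kd_card[OF finite_V, of e2 i s S] card_e by blast
    qed
    have "\<not> (X \<subseteq> S \<and> Y \<subseteq> S)"
    proof
      assume "X \<subseteq> S \<and> Y \<subseteq> S"
      then have "S = X \<union> Y" using S by blast
      then show False using S i by simp
    qed
    moreover have "d S = 0" if "X \<subseteq> S" "\<not> Y \<subseteq> S"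
      using k12[OF that] k22[OF that(1)] S by (simp add: d_def)
    moreover have "d S = 0" if "Y \<subseteq> S" "\<not> X \<subseteq> S"
      using k21[OF that] k11[OF that(1)] S by (simp add: d_def)
    ultimately show ?thesis using S dS by blast
  qed
  have kdd: "?kd d = 0"
  proof -
    have "?kd (?kd z) = 0" for z :: "'v set \<Rightarrow> 'k" by (rule kd_kd) simp_all
    then show ?thesis using c(2) by (simp add: d_def kd_id_diff)
  qed
  \<comment> \<open>With \<open>r\<close> at least 1 the numerical hypothesis gives the range in
    which the mixed sets are exact.\<close>
  have "i + 3 \<le> card (X \<union> Y)" using i r by simp
  then obtain b where b: "\<And>S. b S \<noteq> 0 \<Longrightarrow> S \<subseteq> X \<union> Y \<and> card S = Suc i \<and> \<not> X \<subseteq> S \<and> \<not> Y \<subseteq> S"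
    "?kd b = d"
    using mixed_exact[OF s XY d kdd] by blast
  have bE: "sqf_chain E (X \<union> Y) (Suc i) b"
    unfolding sqf_chain_def
  proof (intro allI impI)
    fix S assume "b S \<noteq> 0"
    then have S: "S \<subseteq> X \<union> Y" "card S = Suc i" "\<not> X \<subseteq> S" "\<not> Y \<subseteq> S" using b(1) by auto
    define T where "T = X \<union> Y - S"
    have "card T = card (X \<union> Y) - Suc i"
      using S(1,2) finite_V finite_subset unfolding T_def by (metis card_Diff_subset)
    \<comment> \<open>The complement of \<open>S\<close> has at least \<open>r + 1\<close> elements
      and meets both parts, so it contains a mixed generator; thus the preimage \<open>b\<close>,
      found without reference to \<open>E\<close>, lies in the complex of \<open>E\<close>.\<close>
    then have "Suc (Suc (r - 1)) \<le> card T" using i r by simp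
    moreover have "T \<inter> X \<noteq> {}" "T \<inter> Y \<noteq> {}" using S by (auto simp: T_def)
    moreover have "finite T" using finite_V by (simp add: T_def)
    ultimately obtain A where A: "A \<subseteq> T" "card A = Suc (Suc (r - 1))" "A \<inter> X \<noteq> {}" "A \<inter> Y \<noteq> {}"
      using mixed_subset[OF _ _ _ XY] by metis
    then have "A \<in> E" using r by (intro mixed) (auto simp: T_def)
    then show "S \<subseteq> X \<union> Y \<and> card S = Suc i \<and> (\<exists>A\<in>E. A \<subseteq> X \<union> Y - S)" using S A(1) T_def by blast
  qed
  have "sqf_chain E (X \<union> Y) (Suc i) (b + e1 + e2)"
    unfolding sqf_chain_def
  proof (intro allI impI)
    fix S assume "(b + e1 + e2) S \<noteq> 0"
    then have "b S \<noteq> 0 \<or> e1 S \<noteq> 0 \<or> e2 S \<noteq> 0" by auto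
    then show "S \<subseteq> X \<union> Y \<and> card S = Suc i \<and> (\<exists>A\<in>E. A \<subseteq> X \<union> Y - S)"
      using bE e1 e2 unfolding sqf_chain_def by blast
  qed
  moreover have "?kd (b + e1 + e2) = c" using b(2) by (simp add: kd_id_add d_def)
  ultimately show False using c(3) by blast
qed

section \<open>Construction of a minimal resolution of a squarefree monomial ideal\<close>

context poly_koszul
begin

lemma ideal_mod_nonexact_bound:
  assumes "\<not> kcycles (ideal_mod E) i j \<subseteq> kbounds (ideal_mod E) i j"
  shows "j \<in> {0..int (card V)}"
  using assms card_mono[OF finite_V] unfolding ideal_mod_nonexact by fastforce

text \<open>Dependent choice of successive minimal covers. The invariant \<open>P\<close> records
  that H_i of the \<open>n\<close>-th syzygy module is H_{n+i} of the ideal; this bounds the degrees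
  of its minimal generators and so makes the next cover finite.\<close>

lemma gres_exists:
  assumes E: "{} \<notin> E"
  shows "\<exists>sh A. gres E sh A"
proof -
  let ?K0 = "\<lambda>j. ideal_mod E j"
  define P where "P n x \<longleftrightarrow> (case x of (sh, K) \<Rightarrow>
      (n = 0 \<longrightarrow> sh = [0] \<and> K = ?K0) \<and> gsub K \<and> (\<forall>j. K j \<subseteq> free_mod sh j) \<and>
      (\<forall>j. \<forall>v\<in>K j. \<forall>a. lookup (v a) 0 = 0) \<and>
      (\<forall>i j. kh_iso K i ?K0 (n + i) j))" for n :: nat and x
  define cover where "cover x y A \<longleftrightarrow> (case x of (sh, K) \<Rightarrow> case y of (sh', K') \<Rightarrow>
      gmat V sh sh' A \<and> (\<forall>a<length sh. \<forall>b<length sh'. lookup (A $$ (a, b)) 0 = 0) \<and>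
      (\<forall>j. K j = mact A ` free_mod sh' j) \<and> K' = (\<lambda>j. {v \<in> free_mod sh' j. mact A v = 0}))" for x y A
  have "\<exists>f. \<forall>n. P n (f n) \<and> (\<exists>A. cover (f n) (f (Suc n)) A)"
  proof (rule dependent_nat_choice)
    have "ideal_mod E j \<subseteq> free_mod [0] j" for j using ideal_mod_eq[of E j] by blast
    moreover have "lookup (v a) 0 = 0" if "v \<in> ideal_mod E j" for v a j
    proof (rule ccontr)
      assume "lookup (v a) 0 \<noteq> 0"
      then have "0 \<in> keys (v a)" by (simp add: in_keys_iff)
      then have "0 \<in> ideal_exps V E a j" using that by (auto simp: mono_mod_def)
      then show False using E by (auto simp: ideal_exps_def)
    qed
    ultimately have "P 0 ([0], ?K0)"
      unfolding P_def using gsub_ideal_mod kh_iso_refl[OF gsub_ideal_mod] by simp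
    then show "\<exists>x. P 0 x" by blast
  next
    fix x n assume Px: "P n x"
    obtain sh K where x: "x = (sh, K)" by (cases x)
    have K: "gsub K" "\<And>j. K j \<subseteq> free_mod sh j" "\<And>j v a. v \<in> K j \<Longrightarrow> lookup (v a) 0 = 0"
      and iso: "\<And>i j. kh_iso K i ?K0 (n + i) j"
      using Px unfolding P_def x by auto
    \<comment> \<open>For \<open>i = 0\<close> the invariant compares H_0(K) with homology of the
      ideal, which lives in squarefree multidegrees and hence in degrees from 0 to
      \<open>card V\<close>.\<close>
    have fin: "finite {j. \<not> kcycles K 0 j \<subseteq> kbounds K 0 j}"
    proof (rule finite_subset)
      show "{j. \<not> kcycles K 0 j \<subseteq> kbounds K 0 j} \<subseteq> {0..int (card V)}"
        using subq_iso_subset[OF iso] ideal_mod_nonexact_bound by blast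
    qed simp
    obtain sh' A where A: "gmat V sh sh' A" "\<And>j. K j = mact A ` free_mod sh' j"
      "\<And>j v a. v \<in> free_mod sh' j \<Longrightarrow> mact A v = 0 \<Longrightarrow> lookup (v a) 0 = 0"
      "\<And>a b. a < length sh \<Longrightarrow> b < length sh' \<Longrightarrow> \<exists>x\<in>K (sh' ! b). A $$ (a, b) = x a"
      using minimal_cover[OF K(1,2) fin] by blast
    define K' where "K' = (\<lambda>j. {v \<in> free_mod sh' j. mact A v = 0})"
    have K'j: "\<And>j. K' j = {v \<in> free_mod sh' j. mact A v = 0}" by (simp add: K'_def)
    have K'sub: "\<And>j. K' j \<subseteq> free_mod sh' j" by (auto simp: K'_def)
    have K'c: "\<And>j v a. v \<in> K' j \<Longrightarrow> lookup (v a) 0 = 0" using A(3) by (auto simp: K'_def)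
    have gs: "gsub K'"
      by (rule gsub_K[OF gsub_free_mod mact_add mact_vX mact_vsc K'j A(2)])
    have "kh_iso K' i ?K0 (Suc n + i) j" for i j
    proof -
      have "kcycles K' i j \<subseteq> kbounds (free_mod sh') i j"
        by (rule no_const_exact[OF K'sub]) (erule K'c)
      then have "kh_iso K (Suc i) K' i j"
        by (intro kh_iso_shift[OF gsub_free_mod mact_add mact_vX mact_vsc K'j A(2)])
          (use free_mod_exact in auto)
      from subq_iso_trans[OF subq_iso_sym[OF this] iso] show ?thesis by simp
    qed
    then have "P (Suc n) (sh', K')" unfolding P_def using gs K'sub K'c by simp
    moreover have "cover x (sh', K') A"
    proof -
      have "lookup (A $$ (a, b)) 0 = 0" if "a < length sh" "b < length sh'" for a b
        using A(4)[OF that] K(3) by force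
      then show ?thesis unfolding cover_def x using A(1,2) by (simp add: K'_def)
    qed
    ultimately show "\<exists>y. P (Suc n) y \<and> (\<exists>A. cover x y A)" by blast
  qed
  then obtain f where f: "\<And>n. P n (f n)" "\<And>n. \<exists>A. cover (f n) (f (Suc n)) A" by blast
  then obtain A where A: "\<And>n. cover (f n) (f (Suc n)) (A n)" by metis
  define sh where "sh n = fst (f n)" for n
  define K where "K n = snd (f n)" for n
  have fn: "f n = (sh n, K n)" for n by (simp add: sh_def K_def)
  have 0: "sh 0 = [0]" "K 0 = ?K0" using f(1)[of 0] unfolding P_def fn by auto
  have c: "gmat V (sh n) (sh (Suc n)) (A n)"
    "\<forall>a<length (sh n). \<forall>b<length (sh (Suc n)). lookup (A n $$ (a, b)) 0 = 0"
    "\<forall>j. K n j = mact (A n) ` free_mod (sh (Suc n)) j"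
    "K (Suc n) = (\<lambda>j. {v \<in> free_mod (sh (Suc n)) j. mact (A n) v = 0})" for n
    using A[of n] unfolding cover_def fn by simp_all
  have "syz E sh A n j = K n j" for n j
    by (cases n) (simp_all add: 0 c(4))
  then have "gres E sh A" using 0(1) c by (simp add: gres_def)
  then show ?thesis by blast
qed

section \<open>Betti numbers and regularity\<close>

lemma gres_unique_ranks:
  assumes "gres E sh A" "gres E sh' A'"
  shows "count_list (sh i) j = count_list (sh' i) j"
proof (cases i)
  case 0
  then show ?thesis using assms by (simp add: gres_def)
next
  case (Suc i')
  then show ?thesis
    using rank_free_mod_eq[OF subq_iso_trans[OF gres_iso[OF assms(1)] subq_iso_sym[OF gres_iso[OF assms(2)]]]]
    by simp
qed

lemma graded_betti_gres:
  assumes g: "gres E sh A" and E: "{} \<notin> E"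
  shows "graded_betti V (sqf_ideal V E :: ('v, 'k) mpoly set) i j = count_list (sh i) j"
  unfolding graded_betti_def
proof (rule the_equality)
  show "\<exists>F. minimal_graded_free_resolution V (sqf_ideal V E :: ('v, 'k) mpoly set) F \<and>
      count_list (sh i) j = count_list (res_shifts F i) j"
    by (rule exI[where x = "\<lparr>res_shifts = sh, res_aug = vec 1 (\<lambda>_. 1), res_map = A\<rparr>"])
      (simp add: resolution_of_gres[OF g, simplified])
  fix n assume "\<exists>F. minimal_graded_free_resolution V (sqf_ideal V E :: ('v, 'k) mpoly set) F \<and>
      n = count_list (res_shifts F i) j"
  then obtain F where F: "minimal_graded_free_resolution V (sqf_ideal V E :: ('v, 'k) mpoly set) F"
    "n = count_list (res_shifts F i) j" by blast
  from gres_unique_ranks[OF gres_of_resolution[OF F(1) E] g] F(2) show "n = count_list (sh i) j" by simp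
qed

text \<open>A nonvanishing form of Hochster's formula. The shift from \<open>Suc i\<close> to
  \<open>i\<close> is the passage from R/I to I, and index 0 carries only the generator 1 of
  R/I.\<close>

lemma graded_betti_sqf_ideal:
  assumes E: "{} \<notin> E"
  shows "graded_betti V (sqf_ideal V E :: ('v, 'k) mpoly set) 0 j \<noteq> 0 \<longleftrightarrow> j = 0"
    and "graded_betti V (sqf_ideal V E :: ('v, 'k) mpoly set) (Suc i) j \<noteq> 0 \<longleftrightarrow>
      (\<exists>W\<subseteq>V. int (card W) = j \<and> sqf_hnz TYPE('k) s E W i)"
proof -
  obtain sh A where g: "gres E sh A" using gres_exists[OF E] by blast
  then have "sh 0 = [0]" by (simp add: gres_def)
  then show "graded_betti V (sqf_ideal V E :: ('v, 'k) mpoly set) 0 j \<noteq> 0 \<longleftrightarrow> j = 0"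
    by (simp add: graded_betti_gres[OF g E])
  show "graded_betti V (sqf_ideal V E :: ('v, 'k) mpoly set) (Suc i) j \<noteq> 0 \<longleftrightarrow>
      (\<exists>W\<subseteq>V. int (card W) = j \<and> sqf_hnz TYPE('k) s E W i)"
    unfolding graded_betti_gres[OF g E] free_mod_nonexact[symmetric] subq_iso_subset[OF gres_iso[OF g]]
    by (rule ideal_mod_nonexact)
qed

end

text \<open>A class at \<open>W\<close> in homology degree \<open>i\<close> is a Betti number of R/I
  at \<open>(i + 1, card W)\<close>; the formula is the difference of the two degrees.\<close>

definition sqf_degrees :: "'k::field itself \<Rightarrow> ('v \<Rightarrow> 'v set \<Rightarrow> bool) \<Rightarrow> 'v set set \<Rightarrow> 'v set \<Rightarrow> int set" where
  "sqf_degrees k s E V = {int (card W) - int i - 1 | W i. W \<subseteq> V \<and> sqf_hnz k s E W i}"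

lemma finite_sqf_degrees:
  assumes "finite V"
  shows "finite (sqf_degrees k s E V)"
proof (rule finite_subset)
  show "sqf_degrees k s E V \<subseteq> {- 1..int (card V)}"
  proof
    fix d assume "d \<in> sqf_degrees k s E V"
    then obtain W i where W: "d = int (card W) - int i - 1" "W \<subseteq> V" "sqf_hnz k s E W i"
      by (auto simp: sqf_degrees_def)
    have "i \<le> card W" using sqf_hnz_card[OF W(3)] W(2) assms finite_subset by blast
    then show "d \<in> {- 1..int (card V)}" using W card_mono[OF assms W(2)] by auto
  qed
qed simp

text \<open>The 0 comes from the Betti number at (0, 0). The left side does not contain
  \<open>s\<close>, so the maximum is the same for all admissible signs.\<close>

lemma reg_quotient_sqf_ideal:
  assumes s: "koszul_sign V s" and E: "{} \<notin> E"
  shows "reg_quotient V (sqf_ideal V E :: ('v, 'k::field) mpoly set) =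
    Max (insert 0 (sqf_degrees TYPE('k) s E V))"
proof -
  interpret koszul_sign V s by fact
  interpret poly_koszul V s "TYPE('k)" ..
  let ?b = "graded_betti V (sqf_ideal V E :: ('v, 'k) mpoly set)"
  have "{j - int i | i j. ?b i j \<noteq> 0} = insert 0 (sqf_degrees TYPE('k) s E V)"
  proof (intro subset_antisym subsetI)
    fix d assume "d \<in> {j - int i | i j. ?b i j \<noteq> 0}"
    then obtain i j where d: "d = j - int i" "?b i j \<noteq> 0" by blast
    show "d \<in> insert 0 (sqf_degrees TYPE('k) s E V)"
    proof (cases i)
      case 0
      then show ?thesis using d graded_betti_sqf_ideal(1)[OF E] by simp
    next
      case (Suc i')
      then obtain W where "W \<subseteq> V" "int (card W) = j" "sqf_hnz TYPE('k) s E W i'"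
        using d(2) graded_betti_sqf_ideal(2)[OF E] by blast
      moreover from this have "d = int (card W) - int i' - 1" using d(1) Suc by simp
      ultimately show ?thesis unfolding sqf_degrees_def by blast
    qed
  next
    fix d assume "d \<in> insert 0 (sqf_degrees TYPE('k) s E V)"
    then consider "d = 0" | W i where "d = int (card W) - int i - 1" "W \<subseteq> V" "sqf_hnz TYPE('k) s E W i"
      by (auto simp: sqf_degrees_def)
    then show "d \<in> {j - int i | i j. ?b i j \<noteq> 0}"
    proof cases
      case 1
      then show ?thesis using graded_betti_sqf_ideal(1)[OF E, of 0] by (intro CollectI exI[of _ 0]) auto
    next
      case 2
      then have "?b (Suc i) (int (card W)) \<noteq> 0" using graded_betti_sqf_ideal(2)[OF E] by blast
      with 2(1) show ?thesis by (intro CollectI exI[of _ "Suc i"] exI[of _ "int (card W)"]) simp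
    qed
  qed
  then show ?thesis by (simp add: reg_quotient_def)
qed

text \<open>A minimal generator survives modulo the irrelevant ideal: the class is the coefficient 1
  at \<open>{}\<close> in multidegree \<open>A\<close>, and a preimage would need a generator inside
  some \<open>A - {x}\<close>.\<close>

lemma sqf_hnz_generator:
  fixes s :: "'v \<Rightarrow> 'v set \<Rightarrow> bool"
  assumes A: "A \<in> E" "finite A" and min: "\<And>B. B \<in> E \<Longrightarrow> \<not> B \<subset> A"
  shows "sqf_hnz TYPE('k::field) s E A 0"
  unfolding sqf_hnz_def
proof (intro exI conjI notI)
  let ?c = "\<lambda>S :: 'v set. if S = {} then 1 else 0 :: 'k"
  show "sqf_chain E A 0 ?c" using A by (auto simp: sqf_chain_def)
  show "kd\<^sub>1 A s ?c = 0" by (auto simp: kd_def fun_eq_iff)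
  assume "\<exists>b. sqf_chain E A (Suc 0) b \<and> kd\<^sub>1 A s b = ?c"
  then obtain b where b: "sqf_chain E A (Suc 0) b" "kd\<^sub>1 A s b = ?c" by blast
  have "b {x} = 0" if "x \<in> A" for x
  proof (rule ccontr)
    assume "b {x} \<noteq> 0"
    then obtain B where "B \<in> E" "B \<subseteq> A - {x}" using b(1) by (auto simp: sqf_chain_def)
    then show False using min[of B] that by blast
  qed
  then have "kd\<^sub>1 A s b {} = 0" by (simp add: kd_def)
  then show False using b(2) by simp
qed

section \<open>The ideal of connected sets of a join\<close>

definition conn_sets :: "nat \<Rightarrow> 'v pair_pre_digraph \<Rightarrow> 'v set set" where
  "conn_sets r G = {A. A \<subseteq> pverts G \<and> card A = r + 1 \<and> Digraph_Component.connected (with_proj G \<restriction> A)}"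

lemma connected_ideal_eq:
  assumes "finite (pverts G)"
  shows "connected_ideal r G = (sqf_ideal (pverts G) (conn_sets r G) :: ('v, 'k::field) mpoly set)"
proof -
  have "{\<Prod>x\<in>A. var x | A. A \<subseteq> pverts G \<and> card A = r + 1 \<and> Digraph_Component.connected (with_proj G \<restriction> A)}
      = {\<Prod>x\<in>A. var x :: ('v, 'k) mpoly | A. A \<in> conn_sets r G}"
    by (simp add: conn_sets_def)
  then show ?thesis
    unfolding connected_ideal_def sqf_ideal_def
    by (simp only:) (rule genideal_sqfree[OF assms], simp add: conn_sets_def)
qed

lemma sqf_ideal_nonzero:
  assumes "finite V" "\<And>A. A \<in> E \<Longrightarrow> A \<subseteq> V"
  shows "(sqf_ideal V E :: ('v, 'k::field) mpoly set) \<noteq> {0} \<longleftrightarrow> E \<noteq> {}"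
proof
  assume nz: "(sqf_ideal V E :: ('v, 'k) mpoly set) \<noteq> {0}"
  show "E \<noteq> {}"
  proof
    assume "E = {}"
    then have "(sqf_ideal V E :: ('v, 'k) mpoly set) = {0}"
      by (auto simp: sqf_ideal_def)
    with nz show False ..
  qed
next
  assume "E \<noteq> {}"
  then obtain A where A: "A \<in> E" by blast
  have "finite A" using assms A finite_subset by blast
  then have "single (sqm A) 1 \<in> (sqf_ideal V E :: ('v, 'k) mpoly set)"
    using A assms(2) by (auto simp: sqf_ideal_def)
  moreover have "single (sqm A) (1::'k) \<noteq> 0"
    by (metis lookup_single_eq lookup_zero zero_neq_one)
  ultimately show "(sqf_ideal V E :: ('v, 'k) mpoly set) \<noteq> {0}" by blast
qed

text \<open>Every arc that the join adds to the first graph has an end outside \<open>A\<close>.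
  Both orders of the join are covered so that the lemma serves either part.\<close>

lemma induce_graph_join_left:
  assumes "pair_graph G\<^sub>1" "pair_graph G\<^sub>2" "pverts G\<^sub>1 \<inter> pverts G\<^sub>2 = {}" "A \<subseteq> pverts G\<^sub>1"
  shows "with_proj (graph_join G\<^sub>1 G\<^sub>2) \<restriction> A = with_proj G\<^sub>1 \<restriction> A"
    and "with_proj (graph_join G\<^sub>2 G\<^sub>1) \<restriction> A = with_proj G\<^sub>1 \<restriction> A"
proof -
  interpret G2: pair_graph G\<^sub>2 by fact
  have "fst e \<notin> A" if "e \<in> parcs G\<^sub>2" for e using G2.arc_fst_in_verts[OF that] assms(3,4) by blast
  then show "with_proj (graph_join G\<^sub>1 G\<^sub>2) \<restriction> A = with_proj G\<^sub>1 \<restriction> A"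
    "with_proj (graph_join G\<^sub>2 G\<^sub>1) \<restriction> A = with_proj G\<^sub>1 \<restriction> A"
    using assms(3,4) by (auto simp: induce_subgraph_def with_proj_def graph_join_def)
qed

text \<open>Two vertices in different parts are adjacent in the join, and two in the same part have
  a common neighbour in \<open>A\<close> on the other side.\<close>

lemma connected_mixed:
  assumes A: "A \<subseteq> pverts G\<^sub>1 \<union> pverts G\<^sub>2" "A \<inter> pverts G\<^sub>1 \<noteq> {}" "A \<inter> pverts G\<^sub>2 \<noteq> {}"
  shows "Digraph_Component.connected (with_proj (graph_join G\<^sub>1 G\<^sub>2) \<restriction> A)"
  unfolding connected_def
proof (rule strongly_connectedI)
  let ?H = "mk_symmetric (with_proj (graph_join G\<^sub>1 G\<^sub>2) \<restriction> A)"
  show "verts ?H \<noteq> {}" using A by auto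
  have arc: "(u, v) \<in> parcs ?H" if "u \<in> A" "v \<in> A" "u \<in> pverts G\<^sub>1 \<and> v \<in> pverts G\<^sub>2 \<or> u \<in> pverts G\<^sub>2 \<and> v \<in> pverts G\<^sub>1" for u v
    using that by (auto simp: parcs_mk_symmetric induce_subgraph_def graph_join_def)
  have step: "(u, v) \<in> rtrancl_on A (parcs ?H)" if "u \<in> A" "v \<in> A" "(u, v) \<in> parcs ?H" for u v
    using that by (meson rtrancl_on.intros)
  fix u v assume "u \<in> verts ?H" "v \<in> verts ?H"
  then have uv: "u \<in> A" "v \<in> A" by simp_all
  obtain x y where xy: "x \<in> A" "x \<in> pverts G\<^sub>1" "y \<in> A" "y \<in> pverts G\<^sub>2" using A by blast
  have two_steps: "(u, v) \<in> rtrancl_on A (parcs ?H)" if "w \<in> A" "(u, w) \<in> parcs ?H" "(w, v) \<in> parcs ?H" for w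
    using step[OF uv(1) that(1,2)] that(3) uv(2) by (rule rtrancl_on_into_rtrancl_on)
  consider "u \<in> pverts G\<^sub>1" "v \<in> pverts G\<^sub>1" | "u \<in> pverts G\<^sub>2" "v \<in> pverts G\<^sub>2"
    | "u \<in> pverts G\<^sub>1 \<and> v \<in> pverts G\<^sub>2 \<or> u \<in> pverts G\<^sub>2 \<and> v \<in> pverts G\<^sub>1"
    using uv A(1) by blast
  then have "(u, v) \<in> rtrancl_on A (parcs ?H)"
  proof cases
    case 1
    then show ?thesis using two_steps[OF xy(3)] arc uv xy by blast
  next
    case 2
    then show ?thesis using two_steps[OF xy(1)] arc uv xy by blast
  next
    case 3
    then show ?thesis using step uv arc by blast
  qed
  then show "u \<rightarrow>\<^sup>*\<^bsub>with_proj ?H\<^esub> v" by (simp add: reachable_def)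
qed

text \<open>Multidegrees inside one part see only the generators of that part, which gives the lower
  bound. For the upper bound, values above \<open>r\<close> are traced back to one part by the
  splitting of the complex, and values up to \<open>r\<close> are covered by a generator.\<close>

lemma regularity_join:
  fixes V1 V2 :: "'v set"
  assumes fin: "finite V1" "finite V2" and disj: "V1 \<inter> V2 = {}"
    and card: "\<And>A. A \<in> E \<Longrightarrow> A \<subseteq> V1 \<union> V2 \<and> card A = r + 1"
    and E1: "\<And>A. A \<in> E1 \<longleftrightarrow> A \<in> E \<and> A \<subseteq> V1" and E2: "\<And>A. A \<in> E2 \<longleftrightarrow> A \<in> E \<and> A \<subseteq> V2"
    and mixed: "\<And>A. A \<subseteq> V1 \<union> V2 \<Longrightarrow> card A = r + 1 \<Longrightarrow> A \<inter> V1 \<noteq> {} \<Longrightarrow> A \<inter> V2 \<noteq> {} \<Longrightarrow> A \<in> E"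
    and r: "r > 0" and nondeg: "E \<noteq> {} \<Longrightarrow> E1 \<noteq> {} \<or> E2 \<noteq> {}"
  shows "reg_quotient (V1 \<union> V2) (sqf_ideal (V1 \<union> V2) E :: ('v, 'k::field) mpoly set) =
    max (reg_quotient V1 (sqf_ideal V1 E1 :: ('v, 'k) mpoly set))
        (reg_quotient V2 (sqf_ideal V2 E2 :: ('v, 'k) mpoly set))"
proof -
  let ?V = "V1 \<union> V2"
  let ?D = "sqf_degrees TYPE('k)"
  define reg1 where "reg1 = reg_quotient V1 (sqf_ideal V1 E1 :: ('v, 'k) mpoly set)"
  define reg2 where "reg2 = reg_quotient V2 (sqf_ideal V2 E2 :: ('v, 'k) mpoly set)"
  have finV: "finite ?V" using fin by simp
  obtain s where s: "koszul_sign ?V s" using koszul_sign_exists[OF finV] by blast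
  have E0: "{} \<notin> E" "{} \<notin> E1" "{} \<notin> E2" using card[of "{}"] E1 E2 by auto
  have s0: "koszul_sign V1 s" "koszul_sign V2 s"
    using koszul_sign_rel_sign[OF s, of V1 "{}"] koszul_sign_rel_sign[OF s, of V2 "{}"]
    by (auto simp: rel_sign_def)
  have reg: "reg_quotient ?V (sqf_ideal ?V E :: ('v, 'k) mpoly set) = Max (insert 0 (?D s E ?V))"
    by (rule reg_quotient_sqf_ideal[OF s E0(1)])
  \<comment> \<open>The sign \<open>t\<close> stays free: homology of the first part will appear
    with a sign that depends on \<open>W \<inter> V2\<close>.\<close>
  have reg1: "reg1 = Max (insert 0 (?D t E1 V1))" if "koszul_sign V1 t" for t
    unfolding reg1_def by (rule reg_quotient_sqf_ideal[OF that E0(2)])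
  have reg2: "reg2 = Max (insert 0 (?D t E2 V2))" if "koszul_sign V2 t" for t
    unfolding reg2_def by (rule reg_quotient_sqf_ideal[OF that E0(3)])
  have ge1: "d \<le> reg1" if "koszul_sign V1 t" "d \<in> ?D t E1 V1" for t d
    unfolding reg1[OF that(1)] by (intro Max_ge) (use that(2) finite_sqf_degrees[OF fin(1)] in auto)
  have ge2: "d \<le> reg2" if "koszul_sign V2 t" "d \<in> ?D t E2 V2" for t d
    unfolding reg2[OF that(1)] by (intro Max_ge) (use that(2) finite_sqf_degrees[OF fin(2)] in auto)
  have pos: "0 \<le> reg1" "0 \<le> reg2"
    unfolding reg1[OF s0(1)] reg2[OF s0(2)] using finite_sqf_degrees fin by (auto intro!: Max_ge)
  have hnz_eq: "sqf_hnz TYPE('k) s E' W i \<longleftrightarrow> sqf_hnz TYPE('k) s E W i"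
    if "\<And>A. A \<subseteq> W \<Longrightarrow> A \<in> E' \<longleftrightarrow> A \<in> E" for E' W i
  proof -
    have "(\<exists>A\<in>E'. A \<subseteq> W - S) \<longleftrightarrow> (\<exists>A\<in>E. A \<subseteq> W - S)" for S using that by blast
    then have "sqf_chain E' W i c \<longleftrightarrow> sqf_chain E W i c" for i and c :: "'v set \<Rightarrow> 'k"
      by (simp add: sqf_chain_def)
    then show ?thesis by (simp add: sqf_hnz_def)
  qed
  have D_sub: "?D s E' V' \<subseteq> ?D s E ?V"
    if E': "\<And>A. A \<in> E' \<longleftrightarrow> A \<in> E \<and> A \<subseteq> V'" and V': "V' \<subseteq> ?V" for E' V'
  proof
    fix d assume "d \<in> ?D s E' V'"
    then obtain W i where W: "d = int (card W) - int i - 1" "W \<subseteq> V'" "sqf_hnz TYPE('k) s E' W i"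
      by (auto simp: sqf_degrees_def)
    then have "sqf_hnz TYPE('k) s E W i" using hnz_eq[of W E' i] E' by auto
    then show "d \<in> ?D s E ?V" unfolding sqf_degrees_def using W V' by blast
  qed
  have lower: "reg1 \<le> Max (insert 0 (?D s E ?V))" "reg2 \<le> Max (insert 0 (?D s E ?V))"
    unfolding reg1[OF s0(1)] reg2[OF s0(2)] using finite_sqf_degrees[OF finV] D_sub[OF E1] D_sub[OF E2]
    by (auto intro!: Max_mono)
  \<comment> \<open>All generators have size \<open>r + 1\<close>, hence are minimal and contribute
    the value \<open>r\<close>; \<open>nondeg\<close> provides one inside a single part.\<close>
  have r_le: "int r \<le> max reg1 reg2" if "E \<noteq> {}"
  proof -
    have gen: "int r \<in> ?D s E' V'"
      if E': "\<And>A. A \<in> E' \<longleftrightarrow> A \<in> E \<and> A \<subseteq> V'" and A': "A \<in> E'" for E' V' A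
    proof -
      have A: "A \<subseteq> V'" "A \<subseteq> ?V" "card A = r + 1" using A' E' card by blast+
      then have finA: "finite A" using finV finite_subset by blast
      have "\<not> B \<subset> A" if "B \<in> E'" for B
        using that E' card A(3) psubset_card_mono[OF finA] by (metis nat_neq_iff)
      then have "sqf_hnz TYPE('k) s E' A 0" using sqf_hnz_generator[OF A' finA] by blast
      then have "int (card A) - int 0 - 1 \<in> ?D s E' V'" unfolding sqf_degrees_def using A(1) by blast
      then show ?thesis using A(3) by simp
    qed
    have 1: "int r \<le> reg1" if "A \<in> E1" for A by (rule ge1[OF s0(1) gen[OF E1 that]])
    have 2: "int r \<le> reg2" if "A \<in> E2" for A by (rule ge2[OF s0(2) gen[OF E2 that]])
    show ?thesis using nondeg[OF that] 1 2 by fastforce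
  qed
  have upper: "d \<le> max reg1 reg2" if d: "d \<in> ?D s E ?V" for d
  proof -
    obtain W i where W: "d = int (card W) - int i - 1" "W \<subseteq> ?V" "sqf_hnz TYPE('k) s E W i"
      using d by (auto simp: sqf_degrees_def)
    have ne: "E \<noteq> {}"
    proof
      assume "E = {}"
      then have "\<And>c :: 'v set \<Rightarrow> 'k. sqf_chain E W i c \<Longrightarrow> c = (\<lambda>_. 0)" by (auto simp: sqf_chain_def)
      moreover have "sqf_chain E W (Suc i) (\<lambda>_. 0 :: 'k) \<and> kd\<^sub>1 W s (\<lambda>_. 0 :: 'k) = (\<lambda>_. 0)"
        by (simp add: sqf_chain_def kd_def fun_eq_iff)
      ultimately show False using W(3) unfolding sqf_hnz_def by metis
    qed
    show ?thesis
    \<comment> \<open>Since \<open>d = card W - i - 1\<close>, the case \<open>d > r\<close> is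
      exactly the range \<open>i + r + 2 \<le> card W\<close> in which the complex splits.\<close>
    proof (cases "d \<le> int r")
      case True
      then show ?thesis using r_le[OF ne] by linarith
    next
      case False
      let ?X = "W \<inter> V1" and ?Y = "W \<inter> V2"
      have WXY: "?X \<union> ?Y = W" "?X \<inter> ?Y = {}" using W(2) disj by blast+
      have finXY: "finite ?X" "finite ?Y" using fin by auto
      have cardW: "card W = card ?X + card ?Y" using card_Un_disjoint[OF finXY WXY(2)] WXY(1) by simp
      have sW: "koszul_sign W s"
        using koszul_sign_rel_sign[OF s W(2), of "{}"] by (simp add: rel_sign_def)
      have "(\<exists>i'. i' + card ?Y = i \<and> sqf_hnz TYPE('k) (rel_sign s ?Y) E1 ?X i') \<or>
          (\<exists>i'. i' + card ?X = i \<and> sqf_hnz TYPE('k) (rel_sign s ?X) E2 ?Y i')"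
      proof (rule sqf_hnz_join[where E = E and r = r])
        show "koszul_sign (?X \<union> ?Y) s" "?X \<inter> ?Y = {}" "r > 0"
          "sqf_hnz TYPE('k) s E (?X \<union> ?Y) i" "i + r + 2 \<le> card (?X \<union> ?Y)"
          using sW WXY r W(1,3) False by simp_all
        show "A \<in> E \<and> A \<noteq> {}" if "A \<in> E1" for A using that E1 E0 by blast
        show "A \<in> E \<and> A \<noteq> {}" if "A \<in> E2" for A using that E2 E0 by blast
        show "A \<in> E1" if "A \<in> E" "A \<subseteq> ?X" for A using that E1 by blast
        show "A \<in> E2" if "A \<in> E" "A \<subseteq> ?Y" for A using that E2 by blast
        show "A \<in> E" if "A \<subseteq> ?X \<union> ?Y" "card A = r + 1" "A \<inter> ?X \<noteq> {}" "A \<inter> ?Y \<noteq> {}" for A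
          using that by (intro mixed) blast+
      qed
      then show ?thesis
      proof (elim disjE exE conjE)
        fix i' assume i': "i' + card ?Y = i" "sqf_hnz TYPE('k) (rel_sign s ?Y) E1 ?X i'"
        have "koszul_sign V1 (rel_sign s ?Y)" by (rule koszul_sign_rel_sign[OF s]) (use disj in auto)
        moreover have "d = int (card ?X) - int i' - 1" using W(1) cardW i'(1) by simp
        then have "d \<in> ?D (rel_sign s ?Y) E1 V1" using i'(2) unfolding sqf_degrees_def by blast
        ultimately show ?thesis using ge1 by fastforce
      next
        fix i' assume i': "i' + card ?X = i" "sqf_hnz TYPE('k) (rel_sign s ?X) E2 ?Y i'"
        have "koszul_sign V2 (rel_sign s ?X)" by (rule koszul_sign_rel_sign[OF s]) (use disj in auto)
        moreover have "d = int (card ?Y) - int i' - 1" using W(1) cardW i'(1) by simp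
        then have "d \<in> ?D (rel_sign s ?X) E2 V2" using i'(2) unfolding sqf_degrees_def by blast
        ultimately show ?thesis using ge2 by fastforce
      qed
    qed
  qed
  have "Max (insert 0 (?D s E ?V)) \<le> max reg1 reg2"
    using finite_sqf_degrees[OF finV] upper pos by (subst Max_le_iff) auto
  with lower show ?thesis unfolding reg reg1_def[symmetric] reg2_def[symmetric] by simp
qed

text \<open>The hypothesis \<open>nondegenerate\<close> excludes joins whose only generators are
  mixed. For two single vertices and \<open>r = 1\<close> the equality fails: both parts have the
  zero ideal and regularity 0, while the join is an edge with ideal generated by xy and regularity
  1.\<close>

theorem proposition1p2:
  fixes G\<^sub>1 G\<^sub>2 :: "'v pair_pre_digraph" and r :: nat
  assumes "pair_graph G\<^sub>1" and "pair_graph G\<^sub>2"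
    and "pverts G\<^sub>1 \<inter> pverts G\<^sub>2 = {}"
    and "r > 0"
    and nondegenerate:
      "(connected_ideal r (graph_join G\<^sub>1 G\<^sub>2) :: ('v, 'k::field) mpoly set) \<noteq> {0} \<Longrightarrow>
        (connected_ideal r G\<^sub>1 :: ('v, 'k) mpoly set) \<noteq> {0} \<or>
        (connected_ideal r G\<^sub>2 :: ('v, 'k) mpoly set) \<noteq> {0}"
  shows "reg_quotient (pverts (graph_join G\<^sub>1 G\<^sub>2))
           (connected_ideal r (graph_join G\<^sub>1 G\<^sub>2) :: ('v, 'k) mpoly set) =
         max (reg_quotient (pverts G\<^sub>1) (connected_ideal r G\<^sub>1 :: ('v, 'k) mpoly set))
             (reg_quotient (pverts G\<^sub>2) (connected_ideal r G\<^sub>2 :: ('v, 'k) mpoly set))"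
proof -
  interpret G1: pair_graph G\<^sub>1 by fact
  interpret G2: pair_graph G\<^sub>2 by fact
  let ?G = "graph_join G\<^sub>1 G\<^sub>2"
  have V: "pverts ?G = pverts G\<^sub>1 \<union> pverts G\<^sub>2" by (simp add: graph_join_def)
  have fin: "finite (pverts G\<^sub>1)" "finite (pverts G\<^sub>2)" "finite (pverts ?G)"
    using G1.pair_finite_verts G2.pair_finite_verts V by auto
  have sub: "A \<subseteq> pverts G" if "A \<in> conn_sets r G" for A and G :: "'v pair_pre_digraph"
    using that by (simp add: conn_sets_def)
  note ideals = connected_ideal_eq[OF fin(1)] connected_ideal_eq[OF fin(2)] connected_ideal_eq[OF fin(3)]
  have nz_iff: "(connected_ideal r G :: ('v, 'k) mpoly set) \<noteq> {0} \<longleftrightarrow> conn_sets r G \<noteq> {}"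
    if "finite (pverts G)" for G :: "'v pair_pre_digraph"
    unfolding connected_ideal_eq[OF that] by (rule sqf_ideal_nonzero[OF that sub])
  have nz: "conn_sets r G\<^sub>1 \<noteq> {} \<or> conn_sets r G\<^sub>2 \<noteq> {}" if "conn_sets r ?G \<noteq> {}"
    using nondegenerate that unfolding nz_iff[OF fin(1)] nz_iff[OF fin(2)] nz_iff[OF fin(3)] by simp
  have disj': "pverts G\<^sub>2 \<inter> pverts G\<^sub>1 = {}" using assms(3) by blast
  show ?thesis
    unfolding ideals unfolding V
  proof (rule regularity_join[where r = r])
    show "A \<subseteq> pverts G\<^sub>1 \<union> pverts G\<^sub>2 \<and> card A = r + 1" if "A \<in> conn_sets r ?G" for A
      using that by (simp add: conn_sets_def V)
    show "A \<in> conn_sets r G\<^sub>1 \<longleftrightarrow> A \<in> conn_sets r ?G \<and> A \<subseteq> pverts G\<^sub>1" for A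
      using induce_graph_join_left(1)[OF assms(1,2,3), of A] by (auto simp: conn_sets_def V)
    show "A \<in> conn_sets r G\<^sub>2 \<longleftrightarrow> A \<in> conn_sets r ?G \<and> A \<subseteq> pverts G\<^sub>2" for A
      using induce_graph_join_left(2)[OF assms(2,1) disj', of A] by (auto simp: conn_sets_def V)
    show "A \<in> conn_sets r ?G" if "A \<subseteq> pverts G\<^sub>1 \<union> pverts G\<^sub>2" "card A = r + 1"
      "A \<inter> pverts G\<^sub>1 \<noteq> {}" "A \<inter> pverts G\<^sub>2 \<noteq> {}" for A
      using that connected_mixed[OF that(1,3,4)] by (simp add: conn_sets_def V)
  qed (use assms fin nz in auto)
qed

end
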